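(* Let $A\subset\mathbb{R}^m$ be a finite set whose convex hull $P=\mathrm{conv}(A)$ has dimension $m$, let $\alpha_a>0$ for $a\in A$, and let $\mathcal{E}(x)=\sum_{a\in A}\xi_a\alpha_ae^{\langle a,x\rangle}$ with $\xi_a$ i.i.d. standard real Gaussian variables. Then $$\mathbb{E}\mathbb{S}\{\mathcal{E};\mathbb{R}^m\}>\frac{1}{2^{m-1}s_m}\,\frac{\mathrm{vol}_m(P)}{\mathrm{diam}(P)^m}.$$
   Context: $\mathbb{E}\mathbb{S}\{\mathcal{E};\mathbb{R}^m\}$ is the expected number of $x\in\mathbb{R}^m$ with $\mathcal{E}_1(x)=\dots=\mathcal{E}_m(x)=0$, where $\mathcal{E}_1,\dots,\mathcal{E}_m$ are i.i.d. copies of $\mathcal{E}$. $\mathrm{vol}_m$ is Euclidean volume, $\mathrm{diam}(P)=\max\{\|p_1-p_2\|\mid p_1,p_2\in P\}$, and $s_m$ is the $m$-dimensional volume of the unit sphere $S^m\subset\mathbb{R}^{m+1}$. *)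

theory Defs
  imports "HOL-Probability.Probability"
begin

(* The i.i.d. copies of the random function E, defined on M, are realised as the functions
   E (\<omega> i) on the product of CARD('m) copies of M.  Zeros are counted with the counting measure,
   so that an infinite zero set contributes infinity (card would contribute 0). *)
definition expected_zeros ::
  "'w measure \<Rightarrow> ('w \<Rightarrow> real ^ 'm \<Rightarrow> real) \<Rightarrow> (real ^ 'm) set \<Rightarrow> ennreal" where
  "expected_zeros M E U =
     (\<integral>\<^sup>+ \<omega>. emeasure (count_space UNIV) {x \<in> U. \<forall>i. E (\<omega> i) x = 0}
        \<partial>(Pi\<^sub>M (UNIV :: 'm set) (\<lambda>_. M)))"

(* The (n-1)-dimensional volume of a hypersurface in Euclidean n-space, as its Minkowski content:
   the volume of the e-neighbourhood divided by its thickness 2 * e, in the limit e -> 0. *)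
definition hypersurface_volume :: "'a :: euclidean_space set \<Rightarrow> real" where
  "hypersurface_volume S = Lim (at_right 0) (\<lambda>e. measure lebesgue (\<Union>s\<in>S. ball s e) / (2 * e))"

lemma sphere_neighbourhood:
  assumes "0 < e" "e < 1"
  shows "(\<Union>s\<in>sphere (0 :: 'a :: euclidean_space) 1. ball s e) = ball 0 (1 + e) - cball 0 (1 - e)"
proof (intro subset_antisym subsetI)
  fix x :: 'a
  assume "x \<in> (\<Union>s\<in>sphere 0 1. ball s e)"
  then obtain s where s: "norm s = 1" "norm (s - x) < e"
    by (auto simp: dist_norm)
  have "norm x \<le> norm s + norm (s - x)" "norm s \<le> norm x + norm (s - x)"
    using norm_triangle_ineq4[of s "s - x"] norm_triangle_ineq[of x "s - x"] by simp_all
  with s show "x \<in> ball 0 (1 + e) - cball 0 (1 - e)"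
    by simp
next
  fix x :: 'a
  assume x: "x \<in> ball 0 (1 + e) - cball 0 (1 - e)"
  with assms have nz: "x \<noteq> 0" by auto
  define s where "s = x /\<^sub>R norm x"
  have "s - x = ((1 - norm x) / norm x) *\<^sub>R x"
    using nz by (simp add: s_def diff_divide_distrib inverse_eq_divide algebra_simps)
  hence "norm (s - x) = \<bar>1 - norm x\<bar>"
    using nz by simp
  moreover have "norm s = 1"
    using nz by (simp add: s_def)
  ultimately show "x \<in> (\<Union>s\<in>sphere 0 1. ball s e)"
    using x by (intro UN_I[of s]) (auto simp: dist_norm)
qed

lemma hypersurface_volume_unit_sphere:
  "hypersurface_volume (sphere (0 :: 'a :: euclidean_space) 1) = DIM('a) * unit_ball_vol DIM('a)"
proof -
  define n where "n = DIM('a)"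
  define V where "V = unit_ball_vol (real n)"
  have vol: "measure lebesgue (\<Union>s\<in>sphere (0 :: 'a) 1. ball s e) = V * ((1 + e) ^ n - (1 - e) ^ n)"
    if e: "0 < e" "e < 1" for e
  proof -
    have "measure lebesgue (ball 0 (1 + e) - cball (0 :: 'a) (1 - e)) =
        measure lebesgue (ball (0 :: 'a) (1 + e)) - measure lebesgue (cball (0 :: 'a) (1 - e))"
      using e by (intro measurable_measure_Diff) auto
    thus ?thesis
      using e sphere_neighbourhood[OF e, where 'a = 'a]
      by (simp add: content_ball content_cball V_def n_def algebra_simps)
  qed
  have "((\<lambda>e. V * ((1 + e) ^ n - (1 - e) ^ n)) has_real_derivative 2 * (V * n)) (at 0)"
    by (auto intro!: derivative_eq_intros)
  hence "((\<lambda>e. V * ((1 + e) ^ n - (1 - e) ^ n) / e) \<longlongrightarrow> 2 * (V * n)) (at_right 0)"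
    by (auto simp: has_field_derivative_iff intro: filterlim_mono at_le)
  hence "((\<lambda>e. V * ((1 + e) ^ n - (1 - e) ^ n) / e / 2) \<longlongrightarrow> 2 * (V * n) / 2) (at_right 0)"
    by (rule tendsto_divide) auto
  moreover have "eventually (\<lambda>e. V * ((1 + e) ^ n - (1 - e) ^ n) / e / 2 =
      measure lebesgue (\<Union>s\<in>sphere (0 :: 'a) 1. ball s e) / (2 * e)) (at_right 0)"
    by (rule eventually_mono[OF eventually_at_right_real[of 0 1]]) (auto simp: vol)
  ultimately have "((\<lambda>e. measure lebesgue (\<Union>s\<in>sphere (0 :: 'a) 1. ball s e) / (2 * e))
      \<longlongrightarrow> 2 * (V * n) / 2) (at_right 0)"
    by (rule Lim_transform_eventually)
  thus ?thesis
    unfolding hypersurface_volume_def n_def V_def by (intro tendsto_Lim) (auto simp: mult.commute)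
qed

end

theory Submission
  imports Defs
begin

text \<open>
  This is the Kac--Rice formula, with every step reduced to an inequality. Fix \<open>b\<close> in \<open>A\<close> and condition
  on the coefficients of all other exponentials: the zeros are then the fibre, over a Gaussian vector, of a smooth map of
  \<open>real ^ 'm\<close> to itself, and the area formula bounds their expected number from below by the integral
  over \<open>x\<close> of a Gaussian average of \<open>\<bar>det D\<bar>\<close>, where \<open>D\<close> is a matrix with
  independent rows. As the determinant is linear in each row, two such averages can be compared one row at a time, where
  only a scalar expectation is involved. The comparison with a matrix \<open>G\<close> of independent
  normal variables yields the density \<open>K * det C(x) / d ^ m\<close>, where \<open>C(x)\<close> is the covariance
  matrix of the points \<open>a\<close> with probabilities proportional to
  \<open>(\<alpha> a * exp (a \<bullet> x))\<^sup>2\<close>, \<open>d\<^sup>2 = (diameter P)\<^sup>2 / 2\<close> bounds its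
  eigenvalues, and \<open>K = E\<bar>det G\<bar> / (2 * pi) powr (m / 2)\<close>.

  The same comparison applied to the affine system \<open>G *v z = y\<close>, which has exactly one zero, gives
  \<open>K \<ge> 2 / s\<close>, where \<open>s\<close> is the volume of the unit sphere. Finally \<open>2 * C(x)\<close> is the Jacobian matrix of the moment map,
  the mean of the points \<open>a\<close>, whose image contains the interior of \<open>P\<close>, so that the
  integral of \<open>det C\<close> is at least \<open>vol P / 2 ^ m\<close>. The factor \<open>sqrt 2 ^ m\<close> gained in
  \<open>d\<close> makes the inequality strict.
\<close>

section \<open>Sums of independent normal variables\<close>

text \<open>Since only a lower bound is wanted, critical points may be dropped: they add nothing to
  the integral of the Jacobian and can only add zeros. The scalar expectation has a closed form. For
  forms \<open>U\<close>, \<open>V\<close> with coefficients \<open>p\<close>, \<open>q\<close> in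
  the same independent normal variables, the mean of
  \<open>std_normal_density V * \<bar>U\<bar>\<close> is the root of a Gram determinant over
  \<open>pi * Q\<close>, where \<open>Q\<close> is 1 plus the squared norm of \<open>q\<close>. For
  a row of the fibre system paired with a vector \<open>c\<close> this is
  \<open>sqrt (c \<bullet> C c) / pi\<close>, whatever \<open>b\<close> is; for a row
  \<open>L g\<close> with normal \<open>g\<close> and weight \<open>std_normal_density 0\<close> it
  is \<open>norm (L^T c) / pi\<close>. A square root of \<open>C\<close> as \<open>L\<close> would
  make the two equal and produce the exact density, proportional to \<open>sqrt (det C)\<close>. But
  the Jacobian of the moment map involves \<open>det C\<close>. Hence \<open>L = C / d\<close>: the
  eigenvalue bound \<open>C \<le> d^2\<close> gives \<open>C^2 / d^2 \<le> C\<close>, which is the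
  row inequality, and \<open>det L = det C / d^m\<close>. For the affine system the matrix to be
  rooted is a rank one update of the identity, so the root is explicit, the rows agree exactly and
  nothing is lost in the constant.\<close>

abbreviation std_normal :: "real measure" where
  "std_normal \<equiv> density lborel (\<lambda>x. ennreal (std_normal_density x))"

lemma prob_space_std_normal: "prob_space std_normal"
  by (rule prob_space_normal_density) simp

lemma nn_integral_std_normal:
  assumes [measurable]: "f \<in> borel_measurable borel"
  shows "(\<integral>\<^sup>+x. f x \<partial>std_normal) = (\<integral>\<^sup>+x. ennreal (std_normal_density x) * f x \<partial>lborel)"
  by (rule nn_integral_density) auto

lemma nn_integral_std_normal_Fubini:
  fixes f :: "real \<Rightarrow> real \<Rightarrow> ennreal"
  assumes "case_prod f \<in> borel_measurable (borel \<Otimes>\<^sub>M borel)"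
  shows "(\<integral>\<^sup>+x. \<integral>\<^sup>+y. f x y \<partial>std_normal \<partial>std_normal) = (\<integral>\<^sup>+y. \<integral>\<^sup>+x. f x y \<partial>std_normal \<partial>std_normal)"
proof -
  interpret pair_sigma_finite std_normal std_normal
    by (intro pair_sigma_finite.intro prob_space_imp_sigma_finite prob_space_std_normal)
  show ?thesis
    using assms by (intro Fubini') simp
qed

text \<open>Two one-dimensional substitutions replace the planar rotation:
  \<open>u = c * x + d * y\<close> at fixed \<open>y\<close>, then
  \<open>v = (y - d * u) / c\<close> at fixed \<open>u\<close>. Their factors
  \<open>1 / \<bar>c\<bar>\<close> and \<open>\<bar>c\<bar>\<close> cancel.\<close>

lemma nn_integral_lborel_rotation_nonzero:
  fixes k :: "real \<Rightarrow> real \<Rightarrow> ennreal"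
  assumes k [measurable]: "case_prod k \<in> borel_measurable (borel \<Otimes>\<^sub>M borel)"
    and cd: "c\<^sup>2 + d\<^sup>2 = 1" and c: "c \<noteq> 0"
  shows "(\<integral>\<^sup>+x. \<integral>\<^sup>+y. k (c * x + d * y) (c * y - d * x) \<partial>lborel \<partial>lborel) =
    (\<integral>\<^sup>+x. \<integral>\<^sup>+y. k x y \<partial>lborel \<partial>lborel)"
proof -
  have km: "(\<lambda>z. k (f z) (g z)) \<in> borel_measurable M" if "f \<in> borel_measurable M" "g \<in> borel_measurable M" for f g and M :: "'z measure"
    using measurable_compose[OF measurable_Pair[OF that] k] by simp
  have "(\<integral>\<^sup>+x. \<integral>\<^sup>+y. k (c * x + d * y) (c * y - d * x) \<partial>lborel \<partial>lborel) =
      (\<integral>\<^sup>+y. \<integral>\<^sup>+x. k (c * x + d * y) (c * y - d * x) \<partial>lborel \<partial>lborel)"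
    by (rule lborel_pair.Fubini') (auto simp: case_prod_beta' intro!: km)
  also have "\<dots> = (\<integral>\<^sup>+y. ennreal (1 / \<bar>c\<bar>) * (\<integral>\<^sup>+u. k u ((y - d * u) / c) \<partial>lborel) \<partial>lborel)"
  proof (rule nn_integral_cong)
    fix y
    have 1: "c * (- (d * y) / c + 1 / c * u) + d * y = u" for u
      using c by (simp add: field_simps)
    have 2: "c * y - d * (- (d * y) / c + 1 / c * u) = (y - d * u) / c" for u
    proof -
      have "c * y - d * (- (d * y) / c + 1 / c * u) = ((c\<^sup>2 + d\<^sup>2) * y - d * u) / c"
        using c by (simp add: field_simps power2_eq_square)
      thus ?thesis by (simp add: cd)
    qed
    show "(\<integral>\<^sup>+x. k (c * x + d * y) (c * y - d * x) \<partial>lborel) =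
        ennreal (1 / \<bar>c\<bar>) * (\<integral>\<^sup>+u. k u ((y - d * u) / c) \<partial>lborel)"
      by (subst nn_integral_real_affine[of _ "1 / c" "- (d * y) / c"], force intro!: km,
          use c in simp, unfold 1 2) (simp add: abs_divide)
  qed
  also have "\<dots> = (\<integral>\<^sup>+y. \<integral>\<^sup>+u. ennreal (1 / \<bar>c\<bar>) * k u ((y - d * u) / c) \<partial>lborel \<partial>lborel)"
    by (intro nn_integral_cong nn_integral_cmult[symmetric] km) auto
  also have "\<dots> = (\<integral>\<^sup>+u. \<integral>\<^sup>+y. ennreal (1 / \<bar>c\<bar>) * k u ((y - d * u) / c) \<partial>lborel \<partial>lborel)"
    by (rule lborel_pair.Fubini') (auto simp: case_prod_beta' intro!: km borel_measurable_times)
  also have "\<dots> = (\<integral>\<^sup>+u. \<integral>\<^sup>+v. k u v \<partial>lborel \<partial>lborel)"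
  proof (rule nn_integral_cong)
    fix u
    have 1: "(d * u + c * v - d * u) / c = v" for v
      using c by (simp add: field_simps)
    have "(\<integral>\<^sup>+y. ennreal (1 / \<bar>c\<bar>) * k u ((y - d * u) / c) \<partial>lborel) =
        ennreal (1 / \<bar>c\<bar>) * (ennreal \<bar>c\<bar> * (\<integral>\<^sup>+v. k u v \<partial>lborel))"
      by (subst nn_integral_cmult, force intro!: km,
          subst nn_integral_real_affine[of _ c "d * u"])
        (use c in \<open>auto simp: 1 intro!: km\<close>)
    also have "\<dots> = (\<integral>\<^sup>+v. k u v \<partial>lborel)"
      using c by (simp add: mult.assoc[symmetric] ennreal_mult'[symmetric])
    finally show "(\<integral>\<^sup>+y. ennreal (1 / \<bar>c\<bar>) * k u ((y - d * u) / c) \<partial>lborel) = (\<integral>\<^sup>+v. k u v \<partial>lborel)" .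
  qed
  finally show ?thesis .
qed

text \<open>The joint density depends on \<open>x\<^sup>2 + y\<^sup>2\<close> only, and Lebesgue
  measure is invariant under rotations.\<close>

lemma nn_integral_std_normal_rotation:
  fixes h :: "real \<Rightarrow> real \<Rightarrow> ennreal"
  assumes h [measurable]: "case_prod h \<in> borel_measurable (borel \<Otimes>\<^sub>M borel)"
    and cd: "c\<^sup>2 + d\<^sup>2 = 1"
  shows "(\<integral>\<^sup>+x. \<integral>\<^sup>+y. h (c * x + d * y) (c * y - d * x) \<partial>std_normal \<partial>std_normal) =
    (\<integral>\<^sup>+x. \<integral>\<^sup>+y. h x y \<partial>std_normal \<partial>std_normal)"
proof -
  have hm: "(\<lambda>z. h (f z) (g z)) \<in> borel_measurable M" if "f \<in> borel_measurable M" "g \<in> borel_measurable M" for f g and M :: "'z measure"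
    using measurable_compose[OF measurable_Pair[OF that] h] by simp
  define k where "k = (\<lambda>x y. ennreal (std_normal_density x * std_normal_density y) * h x y)"
  have km: "case_prod k \<in> borel_measurable (borel \<Otimes>\<^sub>M borel)"
    unfolding k_def by measurable
  have eq: "(\<integral>\<^sup>+x. \<integral>\<^sup>+y. h (f x y) (g x y) \<partial>std_normal \<partial>std_normal) =
      (\<integral>\<^sup>+x. \<integral>\<^sup>+y. ennreal (std_normal_density x * std_normal_density y) * h (f x y) (g x y) \<partial>lborel \<partial>lborel)"
    if [measurable]: "case_prod f \<in> borel_measurable (borel \<Otimes>\<^sub>M borel)" "case_prod g \<in> borel_measurable (borel \<Otimes>\<^sub>M borel)" for f g :: "real \<Rightarrow> real \<Rightarrow> real"
  proof -
    have [measurable]: "(\<lambda>(x, y). h (f x y) (g x y)) \<in> borel_measurable (borel \<Otimes>\<^sub>M borel)"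
      using hm[OF that] by (simp add: case_prod_beta')
    have [measurable]: "(\<lambda>y. h (f x y) (g x y)) \<in> borel_measurable borel" for x
      by measurable
    show ?thesis
      by (simp add: nn_integral_density nn_integral_cmult[symmetric] ennreal_mult mult.assoc)
  qed
  show ?thesis
  proof (cases "c = 0")
    case False
    have "(\<integral>\<^sup>+x. \<integral>\<^sup>+y. h (c * x + d * y) (c * y - d * x) \<partial>std_normal \<partial>std_normal) =
        (\<integral>\<^sup>+x. \<integral>\<^sup>+y. k (c * x + d * y) (c * y - d * x) \<partial>lborel \<partial>lborel)"
    proof (subst eq)
      have "(c * x + d * y)\<^sup>2 + (c * y - d * x)\<^sup>2 = (c\<^sup>2 + d\<^sup>2) * (x\<^sup>2 + y\<^sup>2)" for x y
        by (simp add: power2_eq_square algebra_simps)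
      hence "(c * x + d * y)\<^sup>2 + (c * y - d * x)\<^sup>2 = x\<^sup>2 + y\<^sup>2" for x y
        by (simp add: cd)
      hence "- (c * x + d * y)\<^sup>2 / 2 + - (c * y - d * x)\<^sup>2 / 2 = - x\<^sup>2 / 2 + - y\<^sup>2 / 2" for x y
        by (smt (verit) add_divide_distrib)
      hence "std_normal_density (c * x + d * y) * std_normal_density (c * y - d * x) =
          std_normal_density x * std_normal_density y" for x y
        by (simp add: std_normal_density_def mult_exp_exp del: mult_minus_left)
      thus "(\<integral>\<^sup>+x. \<integral>\<^sup>+y. ennreal (std_normal_density x * std_normal_density y) * h (c * x + d * y) (c * y - d * x) \<partial>lborel \<partial>lborel) =
          (\<integral>\<^sup>+x. \<integral>\<^sup>+y. k (c * x + d * y) (c * y - d * x) \<partial>lborel \<partial>lborel)"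
        by (simp add: k_def)
    qed measurable
    also have "\<dots> = (\<integral>\<^sup>+x. \<integral>\<^sup>+y. k x y \<partial>lborel \<partial>lborel)"
      by (rule nn_integral_lborel_rotation_nonzero[OF km cd False])
    also have "\<dots> = (\<integral>\<^sup>+x. \<integral>\<^sup>+y. h x y \<partial>std_normal \<partial>std_normal)"
      by (subst eq) (auto simp: k_def)
    finally show ?thesis .
  next
    case True
    \<comment> \<open>The substitutions used for the other case divide by \<open>c\<close>. A
      quarter turn is instead a swap of the variables combined with a reflection of one of
      them.\<close>
    hence d: "d = 1 \<or> d = -1" using cd by (simp add: power2_eq_1_iff)
    have m: "(\<integral>\<^sup>+y. f (- y) \<partial>std_normal) = (\<integral>\<^sup>+y. f y \<partial>std_normal)" if [measurable]: "f \<in> borel_measurable borel" for f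
      unfolding nn_integral_std_normal[OF that] nn_integral_std_normal[OF measurable_compose[OF borel_measurable_uminus[OF measurable_ident_sets[OF refl]] that]]
      by (subst (2) nn_integral_real_affine[of _ "-1" 0]) (auto simp: normal_density_def)
    from d show ?thesis
    proof
      assume d: "d = 1"
      interpret G: sigma_finite_measure std_normal
        by (intro prob_space_imp_sigma_finite prob_space_std_normal)
      have "(\<integral>\<^sup>+x. \<integral>\<^sup>+y. h y (- x) \<partial>std_normal \<partial>std_normal) = (\<integral>\<^sup>+x. \<integral>\<^sup>+y. h y x \<partial>std_normal \<partial>std_normal)"
        by (rule m) (simp add: G.borel_measurable_nn_integral)
      thus ?thesis
        using True d nn_integral_std_normal_Fubini[OF h] by simp
    next
      assume d: "d = -1"
      have "(\<integral>\<^sup>+y. h (- y) x \<partial>std_normal) = (\<integral>\<^sup>+y. h y x \<partial>std_normal)" for x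
        by (rule m) (auto intro!: hm)
      hence "(\<integral>\<^sup>+x. \<integral>\<^sup>+y. h (- y) x \<partial>std_normal \<partial>std_normal) = (\<integral>\<^sup>+x. \<integral>\<^sup>+y. h y x \<partial>std_normal \<partial>std_normal)"
        by simp
      thus ?thesis
        using True d nn_integral_std_normal_Fubini[OF h]
          nn_integral_std_normal_Fubini[of "\<lambda>x y. h (- y) x"] by simp
    qed
  qed
qed

text \<open>The direction of the vector \<open>(s, p)\<close>; at the origin any unit vector serves,
  here \<open>(1, 0)\<close>.\<close>

lemma sincos_direction_exists:
  fixes s p :: real
  obtains c d where "c\<^sup>2 + d\<^sup>2 = 1" "sqrt (s\<^sup>2 + p\<^sup>2) * c = s" "sqrt (s\<^sup>2 + p\<^sup>2) * d = p"
proof (cases "sqrt (s\<^sup>2 + p\<^sup>2) = 0")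
  case True
  thus ?thesis
    using that[of 1 0] by (simp add: sum_power2_eq_zero_iff)
next
  case False
  hence "s\<^sup>2 + p\<^sup>2 \<noteq> 0" by simp
  show ?thesis
    by (rule that[of "s / sqrt (s\<^sup>2 + p\<^sup>2)" "p / sqrt (s\<^sup>2 + p\<^sup>2)"])
       (use False \<open>s\<^sup>2 + p\<^sup>2 \<noteq> 0\<close> in \<open>simp_all add: power_divide add_divide_distrib[symmetric]\<close>)
qed

text \<open>Two linear forms in independent normal variables are jointly normal. The triangular
  matrix with rows \<open>(s, 0)\<close> and \<open>(r, t)\<close> is a Cholesky factor of the Gram
  matrix of \<open>p\<close> and \<open>q\<close>. Having \<open>h\<close> universally quantified
  inside the conclusion lets the induction apply it to an integral over the new variable.\<close>

lemma nn_integral_PiM_std_normal_two_sums: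
  fixes p q :: "'a \<Rightarrow> real"
  assumes "finite A"
  obtains s r t where "s\<^sup>2 = (\<Sum>a\<in>A. (p a)\<^sup>2)" "s * r = (\<Sum>a\<in>A. p a * q a)" "r\<^sup>2 + t\<^sup>2 = (\<Sum>a\<in>A. (q a)\<^sup>2)"
    "\<And>h :: real \<Rightarrow> real \<Rightarrow> ennreal. case_prod h \<in> borel_measurable (borel \<Otimes>\<^sub>M borel) \<Longrightarrow>
      (\<integral>\<^sup>+\<xi>. h (\<Sum>a\<in>A. \<xi> a * p a) (\<Sum>a\<in>A. \<xi> a * q a) \<partial>Pi\<^sub>M A (\<lambda>_. std_normal)) =
      (\<integral>\<^sup>+x. \<integral>\<^sup>+y. h (s * x) (r * x + t * y) \<partial>std_normal \<partial>std_normal)"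
  using assms
proof (induction A arbitrary: thesis rule: finite_induct)
  case empty
  interpret N: prob_space std_normal by (rule prob_space_std_normal)
  show ?case
    by (rule empty[of 0 0 0]) (simp_all add: PiM_empty nn_integral_count_space_finite N.emeasure_space_1[simplified])
next
  case (insert b A)
  interpret N: prob_space std_normal by (rule prob_space_std_normal)
  interpret N: pair_sigma_finite std_normal std_normal
    by (intro pair_sigma_finite.intro prob_space_imp_sigma_finite prob_space_std_normal)
  interpret P: product_sigma_finite "\<lambda>_. std_normal"
    by (intro product_sigma_finite.intro prob_space_imp_sigma_finite prob_space_std_normal)
  obtain s r t where srt: "s\<^sup>2 = (\<Sum>a\<in>A. (p a)\<^sup>2)" "s * r = (\<Sum>a\<in>A. p a * q a)" "r\<^sup>2 + t\<^sup>2 = (\<Sum>a\<in>A. (q a)\<^sup>2)"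
    and IH: "\<And>h :: real \<Rightarrow> real \<Rightarrow> ennreal. case_prod h \<in> borel_measurable (borel \<Otimes>\<^sub>M borel) \<Longrightarrow>
      (\<integral>\<^sup>+\<xi>. h (\<Sum>a\<in>A. \<xi> a * p a) (\<Sum>a\<in>A. \<xi> a * q a) \<partial>Pi\<^sub>M A (\<lambda>_. std_normal)) =
      (\<integral>\<^sup>+x. \<integral>\<^sup>+y. h (s * x) (r * x + t * y) \<partial>std_normal \<partial>std_normal)"
    using insert.IH by blast
  obtain c d where cd: "c\<^sup>2 + d\<^sup>2 = 1" and c: "sqrt (s\<^sup>2 + (p b)\<^sup>2) * c = s" and d: "sqrt (s\<^sup>2 + (p b)\<^sup>2) * d = p b"
    by (rule sincos_direction_exists)
  \<comment> \<open>The first rotation mixes \<open>x\<close> with the new variable \<open>w\<close>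
    so that the first form depends on \<open>x\<close> alone; the second form then has coefficients
    \<open>r'\<close> and \<open>q'\<close> there. The second rotation mixes \<open>w\<close> with
    \<open>y\<close> and merges \<open>q'\<close> and \<open>t\<close> into \<open>t'\<close>. One
    variable is left over and integrates to 1.\<close>
  define s' where "s' = sqrt (s\<^sup>2 + (p b)\<^sup>2)"
  define r' where "r' = r * c + q b * d"
  define q' where "q' = q b * c - r * d"
  obtain e f where ef: "e\<^sup>2 + f\<^sup>2 = 1" and e: "sqrt (q'\<^sup>2 + t\<^sup>2) * e = q'" and f: "sqrt (q'\<^sup>2 + t\<^sup>2) * f = t"
    by (rule sincos_direction_exists)
  define t' where "t' = sqrt (q'\<^sup>2 + t\<^sup>2)"
  show ?case
  proof (rule insert.prems)
    show "s'\<^sup>2 = (\<Sum>a\<in>insert b A. (p a)\<^sup>2)"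
      using insert.hyps by (simp add: s'_def flip: srt)
    have "s' * r' = r * (s' * c) + q b * (s' * d)"
      by (simp add: r'_def algebra_simps)
    also have "\<dots> = s * r + p b * q b"
      by (simp add: s'_def c d)
    finally show "s' * r' = (\<Sum>a\<in>insert b A. p a * q a)"
      using insert.hyps srt by simp
    have "t'\<^sup>2 = q'\<^sup>2 + t\<^sup>2"
      by (simp add: t'_def)
    hence "r'\<^sup>2 + t'\<^sup>2 = (c\<^sup>2 + d\<^sup>2) * (r\<^sup>2 + (q b)\<^sup>2) + t\<^sup>2"
      by (simp add: r'_def q'_def power2_eq_square algebra_simps)
    thus "r'\<^sup>2 + t'\<^sup>2 = (\<Sum>a\<in>insert b A. (q a)\<^sup>2)"
      using insert.hyps srt by (simp add: cd)
    fix h :: "real \<Rightarrow> real \<Rightarrow> ennreal"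
    assume h [measurable]: "case_prod h \<in> borel_measurable (borel \<Otimes>\<^sub>M borel)"
    have "(\<integral>\<^sup>+\<xi>. h (\<Sum>a\<in>insert b A. \<xi> a * p a) (\<Sum>a\<in>insert b A. \<xi> a * q a) \<partial>Pi\<^sub>M (insert b A) (\<lambda>_. std_normal)) =
        (\<integral>\<^sup>+\<xi>. \<integral>\<^sup>+w. h ((\<Sum>a\<in>A. \<xi> a * p a) + w * p b) ((\<Sum>a\<in>A. \<xi> a * q a) + w * q b) \<partial>std_normal \<partial>Pi\<^sub>M A (\<lambda>_. std_normal))"
    proof (subst P.product_nn_integral_insert)
      have "(\<Sum>a\<in>A. (if a = b then w else \<xi> a) * p a) = (\<Sum>a\<in>A. \<xi> a * p a)" for w \<xi> and p :: "'a \<Rightarrow> real"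
        using insert.hyps by (intro sum.cong) auto
      thus "(\<integral>\<^sup>+\<xi>. \<integral>\<^sup>+w. h (\<Sum>a\<in>insert b A. (\<xi>(b := w)) a * p a) (\<Sum>a\<in>insert b A. (\<xi>(b := w)) a * q a) \<partial>std_normal \<partial>Pi\<^sub>M A (\<lambda>_. std_normal)) =
        (\<integral>\<^sup>+\<xi>. \<integral>\<^sup>+w. h ((\<Sum>a\<in>A. \<xi> a * p a) + w * p b) ((\<Sum>a\<in>A. \<xi> a * q a) + w * q b) \<partial>std_normal \<partial>Pi\<^sub>M A (\<lambda>_. std_normal))"
        using insert.hyps by (simp add: fun_upd_def add.commute)
    qed (use insert.hyps in measurable)
    also have "\<dots> = (\<integral>\<^sup>+x. \<integral>\<^sup>+y. \<integral>\<^sup>+w. h (s * x + w * p b) (r * x + t * y + w * q b) \<partial>std_normal \<partial>std_normal \<partial>std_normal)"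
      by (subst IH[of "\<lambda>u v. \<integral>\<^sup>+w. h (u + w * p b) (v + w * q b) \<partial>std_normal"]) auto
    also have "\<dots> = (\<integral>\<^sup>+y. \<integral>\<^sup>+x. \<integral>\<^sup>+w. h (s * x + w * p b) (r * x + t * y + w * q b) \<partial>std_normal \<partial>std_normal \<partial>std_normal)"
      by (rule nn_integral_std_normal_Fubini) measurable
    also have "\<dots> = (\<integral>\<^sup>+y. \<integral>\<^sup>+x. \<integral>\<^sup>+w. h (s' * x) (r' * x + q' * w + t * y) \<partial>std_normal \<partial>std_normal \<partial>std_normal)"
    proof (rule nn_integral_cong)
      fix y
      have 1: "s' * (c * x + d * w) = s * x + w * p b" for x w
      proof -
        have "s' * (c * x + d * w) = (s' * c) * x + w * (s' * d)" by (simp add: algebra_simps)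
        thus ?thesis by (simp only: s'_def c d)
      qed
      have "r' * (c * x + d * w) + q' * (c * w - d * x) = (c\<^sup>2 + d\<^sup>2) * (r * x + w * q b)" for x w
        by (simp add: r'_def q'_def power2_eq_square algebra_simps)
      hence 2: "r' * (c * x + d * w) + q' * (c * w - d * x) + t * y = r * x + t * y + w * q b" for x w
        by (simp add: cd)
      show "(\<integral>\<^sup>+x. \<integral>\<^sup>+w. h (s * x + w * p b) (r * x + t * y + w * q b) \<partial>std_normal \<partial>std_normal) =
          (\<integral>\<^sup>+x. \<integral>\<^sup>+w. h (s' * x) (r' * x + q' * w + t * y) \<partial>std_normal \<partial>std_normal)"
        by (subst nn_integral_std_normal_rotation[OF _ cd, symmetric, where h = "\<lambda>x w. h (s' * x) (r' * x + q' * w + t * y)"])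
           (measurable, simp only: 1 2)
    qed
    also have "\<dots> = (\<integral>\<^sup>+x. \<integral>\<^sup>+y. \<integral>\<^sup>+w. h (s' * x) (r' * x + q' * w + t * y) \<partial>std_normal \<partial>std_normal \<partial>std_normal)"
      by (rule nn_integral_std_normal_Fubini) measurable
    also have "\<dots> = (\<integral>\<^sup>+x. \<integral>\<^sup>+w. \<integral>\<^sup>+y. h (s' * x) (r' * x + q' * w + t * y) \<partial>std_normal \<partial>std_normal \<partial>std_normal)"
      by (intro nn_integral_cong nn_integral_std_normal_Fubini) measurable
    also have "\<dots> = (\<integral>\<^sup>+x. \<integral>\<^sup>+w. \<integral>\<^sup>+y. h (s' * x) (r' * x + t' * w) \<partial>std_normal \<partial>std_normal \<partial>std_normal)"
    proof (rule nn_integral_cong)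
      fix x
      have 1: "r' * x + t' * (e * w + f * y) = r' * x + q' * w + t * y" for w y
      proof -
        have "r' * x + t' * (e * w + f * y) = r' * x + (t' * e) * w + (t' * f) * y" by (simp add: algebra_simps)
        thus ?thesis by (simp only: t'_def e f)
      qed
      show "(\<integral>\<^sup>+w. \<integral>\<^sup>+y. h (s' * x) (r' * x + q' * w + t * y) \<partial>std_normal \<partial>std_normal) =
          (\<integral>\<^sup>+w. \<integral>\<^sup>+y. h (s' * x) (r' * x + t' * w) \<partial>std_normal \<partial>std_normal)"
        by (subst nn_integral_std_normal_rotation[OF _ ef, symmetric, where h = "\<lambda>w y. h (s' * x) (r' * x + t' * w)"])
           (measurable, simp only: 1)
    qed
    also have "\<dots> = (\<integral>\<^sup>+x. \<integral>\<^sup>+w. h (s' * x) (r' * x + t' * w) \<partial>std_normal \<partial>std_normal)"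
      by (simp add: N.emeasure_space_1[simplified])
    finally show "(\<integral>\<^sup>+\<xi>. h (\<Sum>a\<in>insert b A. \<xi> a * p a) (\<Sum>a\<in>insert b A. \<xi> a * q a) \<partial>Pi\<^sub>M (insert b A) (\<lambda>_. std_normal)) =
      (\<integral>\<^sup>+x. \<integral>\<^sup>+y. h (s' * x) (r' * x + t' * y) \<partial>std_normal \<partial>std_normal)" .
  qed
qed

section \<open>Gaussian integrals in closed form\<close>

lemma mult_exp_eqI1:
  fixes a b c d x y z :: real
  shows "a * b = c * d \<Longrightarrow> x + y = z \<Longrightarrow> (a * exp x) * (b * exp y) = c * (d * exp z)"
  by (metis exp_add mult.assoc mult.left_commute)

lemma mult_exp_eqI2:
  fixes a b c d x y z w :: real
  shows "a * b = c * d \<Longrightarrow> x + y = z + w \<Longrightarrow> (a * exp x) * (b * exp y) = (c * exp z) * (d * exp w)"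
  using mult_exp_eqI1[of a b c d x y "z + w"] by (simp add: exp_add mult_ac)

text \<open>A convolution of centred normal laws with variances 1 and \<open>t\<^sup>2\<close>.
  Completing the square in \<open>y\<close> splits off a normal density in \<open>y\<close> of
  deviation \<open>1 / \<sigma>\<close>, whose integral is 1.\<close>

lemma nn_integral_std_normal_shifted_density:
  "(\<integral>\<^sup>+y. ennreal (std_normal_density (u + t * y)) \<partial>std_normal) =
    ennreal (normal_density 0 (sqrt (1 + t\<^sup>2)) u)"
proof -
  define \<sigma> where "\<sigma> = sqrt (1 + t\<^sup>2)"
  have \<sigma>: "\<sigma> > 0" "\<sigma>\<^sup>2 = 1 + t\<^sup>2"
    by (auto simp: \<sigma>_def add_pos_nonneg)
  have 1: "std_normal_density y * std_normal_density (u + t * y) =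
      normal_density 0 \<sigma> u * normal_density (- (u * t) / \<sigma>\<^sup>2) (1 / \<sigma>) y" for y
  proof -
    have "- y\<^sup>2 / 2 + - (u + t * y)\<^sup>2 / 2 = - (u - 0)\<^sup>2 / (2 * \<sigma>\<^sup>2) + - (y - - (u * t) / \<sigma>\<^sup>2)\<^sup>2 / (2 * (1 / \<sigma>)\<^sup>2)"
    proof -
      have "\<sigma>\<^sup>2 * (y\<^sup>2 + (u + t * y)\<^sup>2) = u\<^sup>2 + (\<sigma>\<^sup>2 * y + u * t)\<^sup>2"
        unfolding \<sigma>(2) by (simp add: power2_eq_square algebra_simps)
      moreover have "(y - - (u * t) / \<sigma>\<^sup>2)\<^sup>2 = (\<sigma>\<^sup>2 * y + u * t)\<^sup>2 / (\<sigma>\<^sup>2)\<^sup>2"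
        using \<sigma>(1) by (subst power_divide[symmetric]) (simp add: add_divide_distrib)
      moreover have "- (u - 0)\<^sup>2 / (2 * \<sigma>\<^sup>2) + - (K / (\<sigma>\<^sup>2)\<^sup>2) / (2 * (1 / \<sigma>)\<^sup>2) = - (u\<^sup>2 + K) / (2 * \<sigma>\<^sup>2)" for K
        using \<sigma>(1) by (simp add: power_divide field_simps power2_eq_square)
      moreover have "- y\<^sup>2 / 2 + - (u + t * y)\<^sup>2 / 2 = - (\<sigma>\<^sup>2 * (y\<^sup>2 + (u + t * y)\<^sup>2)) / (2 * \<sigma>\<^sup>2)"
        using \<sigma>(1) by (simp add: field_simps)
      ultimately show ?thesis
        by simp
    qed
    moreover have "(1 / sqrt (2 * pi * \<sigma>\<^sup>2)) * (1 / sqrt (2 * pi * (1 / \<sigma>)\<^sup>2)) = (1 / sqrt (2 * pi)) * (1 / sqrt (2 * pi))"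
      using \<sigma>(1) by (simp add: real_sqrt_mult real_sqrt_divide)
    ultimately show ?thesis
      unfolding std_normal_density_def unfolding normal_density_def
      by (rule mult_exp_eqI2[OF sym, rotated])
  qed
  have "(\<integral>\<^sup>+y. ennreal (std_normal_density (u + t * y)) \<partial>std_normal) =
      (\<integral>\<^sup>+y. ennreal (normal_density 0 \<sigma> u) * ennreal (normal_density (- (u * t) / \<sigma>\<^sup>2) (1 / \<sigma>) y) \<partial>lborel)"
    by (simp add: nn_integral_density 1 flip: ennreal_mult')
  also have "\<dots> = ennreal (normal_density 0 \<sigma> u)"
    using \<sigma>(1) by (simp add: nn_integral_cmult nn_integral_eq_integral)
  finally show ?thesis by (simp add: \<sigma>_def)
qed

text \<open>Let \<open>U\<close>, \<open>V\<close> be the forms of \<open>p\<close>,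
  \<open>q\<close> and \<open>W\<close> a further independent standard normal variable. The left
  side is the density of \<open>W - V\<close> at 0 times the mean of \<open>\<bar>U\<bar>\<close>
  given \<open>W = V\<close>. The 1 in \<open>Q\<close> is the variance of \<open>W\<close>, and the
  radicand is the Gram determinant of \<open>(0, p)\<close> and \<open>(1, q)\<close>.\<close>

lemma nn_integral_PiM_std_normal_abs_density:
  fixes p q :: "'a \<Rightarrow> real"
  assumes "finite A"
  defines "Q \<equiv> 1 + (\<Sum>a\<in>A. (q a)\<^sup>2)"
  shows "(\<integral>\<^sup>+\<xi>. ennreal (std_normal_density (\<Sum>a\<in>A. \<xi> a * q a)) * ennreal \<bar>\<Sum>a\<in>A. \<xi> a * p a\<bar> \<partial>Pi\<^sub>M A (\<lambda>_. std_normal)) =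
    ennreal (sqrt ((\<Sum>a\<in>A. (p a)\<^sup>2) * Q - (\<Sum>a\<in>A. p a * q a)\<^sup>2) / (pi * Q))"
proof -
  obtain s r t where srt: "s\<^sup>2 = (\<Sum>a\<in>A. (p a)\<^sup>2)" "s * r = (\<Sum>a\<in>A. p a * q a)" "r\<^sup>2 + t\<^sup>2 = (\<Sum>a\<in>A. (q a)\<^sup>2)"
    and law: "\<And>h :: real \<Rightarrow> real \<Rightarrow> ennreal. case_prod h \<in> borel_measurable (borel \<Otimes>\<^sub>M borel) \<Longrightarrow>
      (\<integral>\<^sup>+\<xi>. h (\<Sum>a\<in>A. \<xi> a * p a) (\<Sum>a\<in>A. \<xi> a * q a) \<partial>Pi\<^sub>M A (\<lambda>_. std_normal)) =
      (\<integral>\<^sup>+x. \<integral>\<^sup>+y. h (s * x) (r * x + t * y) \<partial>std_normal \<partial>std_normal)"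
    using nn_integral_PiM_std_normal_two_sums[OF assms(1), of p q] by blast
  define \<sigma> where "\<sigma> = sqrt (1 + t\<^sup>2)"
  have \<sigma>: "\<sigma> > 0" "\<sigma>\<^sup>2 = 1 + t\<^sup>2"
    by (auto simp: \<sigma>_def add_pos_nonneg)
  have Q: "Q = \<sigma>\<^sup>2 + r\<^sup>2"
    using srt \<sigma> by (simp add: Q_def)
  have Q0: "Q > 0" unfolding Q using \<sigma> by (simp add: add_pos_nonneg)
  \<comment> \<open>Once \<open>y\<close> is integrated out, what remains in \<open>x\<close> is, up
    to a factor, the centred normal density of deviation \<open>\<tau>\<close>, with first absolute
    moment \<open>\<tau> * sqrt (2 / pi)\<close>.\<close>
  define \<tau> where "\<tau> = \<sigma> / sqrt Q"
  have \<tau>: "\<tau> > 0" "\<tau>\<^sup>2 = \<sigma>\<^sup>2 / Q"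
    using \<sigma> Q0 by (auto simp: \<tau>_def power_divide)
  have 1: "std_normal_density x * normal_density 0 \<sigma> (r * x) = \<tau> / (sqrt (2 * pi) * \<sigma>) * normal_density 0 \<tau> x" for x
  proof -
    have "- x\<^sup>2 / 2 + - (r * x - 0)\<^sup>2 / (2 * \<sigma>\<^sup>2) = - (x - 0)\<^sup>2 / (2 * \<tau>\<^sup>2)"
      using \<sigma>(1) Q0 unfolding \<tau>(2) by (simp add: Q power_mult_distrib field_simps)
    moreover have "(1 / sqrt (2 * pi)) * (1 / sqrt (2 * pi * \<sigma>\<^sup>2)) = \<tau> / (sqrt (2 * pi) * \<sigma>) * (1 / sqrt (2 * pi * \<tau>\<^sup>2))"
      using \<sigma>(1) \<tau>(1) by (simp add: real_sqrt_mult)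
    ultimately show ?thesis
      unfolding std_normal_density_def unfolding normal_density_def
      by (rule mult_exp_eqI1[rotated])
  qed
  have abs: "has_bochner_integral lborel (\<lambda>x. normal_density 0 \<tau> x * \<bar>x\<bar>) (\<tau> * sqrt (2 / pi))"
    using normal_moment_abs_odd[OF \<tau>(1), of 0 0] by (simp add: mult.commute)
  have "(\<integral>\<^sup>+\<xi>. ennreal (std_normal_density (\<Sum>a\<in>A. \<xi> a * q a)) * ennreal \<bar>\<Sum>a\<in>A. \<xi> a * p a\<bar> \<partial>Pi\<^sub>M A (\<lambda>_. std_normal)) =
      (\<integral>\<^sup>+x. \<integral>\<^sup>+y. ennreal \<bar>s * x\<bar> * ennreal (std_normal_density (r * x + t * y)) \<partial>std_normal \<partial>std_normal)"
    by (subst law[of "\<lambda>u v. ennreal (std_normal_density v) * ennreal \<bar>u\<bar>"]) (auto simp: mult.commute)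
  also have "\<dots> = (\<integral>\<^sup>+x. ennreal \<bar>s * x\<bar> * ennreal (normal_density 0 \<sigma> (r * x)) \<partial>std_normal)"
    by (simp add: nn_integral_cmult nn_integral_std_normal_shifted_density \<sigma>_def)
  also have "\<dots> = (\<integral>\<^sup>+x. ennreal (\<bar>s\<bar> * \<tau> / (sqrt (2 * pi) * \<sigma>)) * ennreal (normal_density 0 \<tau> x * \<bar>x\<bar>) \<partial>lborel)"
  proof (subst nn_integral_std_normal, measurable, rule nn_integral_cong)
    fix x :: real
    have "std_normal_density x * (\<bar>s * x\<bar> * normal_density 0 \<sigma> (r * x)) =
        (std_normal_density x * normal_density 0 \<sigma> (r * x)) * (\<bar>s\<bar> * \<bar>x\<bar>)"
      by (simp add: abs_mult)
    also have "\<dots> = \<bar>s\<bar> * \<tau> / (sqrt (2 * pi) * \<sigma>) * (normal_density 0 \<tau> x * \<bar>x\<bar>)"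
      unfolding 1 by simp
    finally show "ennreal (std_normal_density x) * (ennreal \<bar>s * x\<bar> * ennreal (normal_density 0 \<sigma> (r * x))) =
        ennreal (\<bar>s\<bar> * \<tau> / (sqrt (2 * pi) * \<sigma>)) * ennreal (normal_density 0 \<tau> x * \<bar>x\<bar>)"
      using \<sigma>(1) \<tau>(1) by (simp flip: ennreal_mult)
  qed
  also have "\<dots> = ennreal (\<bar>s\<bar> * \<tau> / (sqrt (2 * pi) * \<sigma>) * (\<tau> * sqrt (2 / pi)))"
    using abs \<sigma>(1) \<tau>(1)
    by (subst nn_integral_cmult)
       (auto simp: nn_integral_eq_integral has_bochner_integral_iff ennreal_mult[symmetric])
  also have "\<bar>s\<bar> * \<tau> / (sqrt (2 * pi) * \<sigma>) * (\<tau> * sqrt (2 / pi)) = \<bar>s\<bar> * \<tau>\<^sup>2 / (pi * \<sigma>)"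
    by (simp add: real_sqrt_mult real_sqrt_divide power2_eq_square)
  also have "\<dots> = \<bar>s\<bar> * \<sigma> / (pi * Q)"
    unfolding \<tau>(2) using \<sigma>(1) Q0 by (simp add: field_simps power2_eq_square)
  also have "\<bar>s\<bar> * \<sigma> = sqrt (s\<^sup>2 * \<sigma>\<^sup>2)"
    using \<sigma>(1) by (simp add: real_sqrt_mult)
  also have "s\<^sup>2 * \<sigma>\<^sup>2 = s\<^sup>2 * Q - (s * r)\<^sup>2"
    by (simp add: Q algebra_simps power_mult_distrib)
  finally show ?thesis
    by (simp only: srt)
qed

section \<open>Determinants with independent rows\<close>

text \<open>Weights and row maps can be absorbed into the factor measures because both sides agree
  on boxes. Sigma-finiteness of the factors is a hypothesis since it does not pass to image
  measures.\<close>

lemma PiM_distr_density: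
  fixes M :: "'i \<Rightarrow> 'a measure" and N :: "'i \<Rightarrow> 'b measure"
  assumes I: "finite I" and M: "product_sigma_finite M"
    and w: "\<And>i. i \<in> I \<Longrightarrow> w i \<in> borel_measurable (M i)" and D: "\<And>i. i \<in> I \<Longrightarrow> D i \<in> measurable (M i) (N i)"
    and sf: "product_sigma_finite (\<lambda>i. distr (density (M i) (w i)) (N i) (D i))"
  shows "Pi\<^sub>M I (\<lambda>i. distr (density (M i) (w i)) (N i) (D i)) =
    distr (density (Pi\<^sub>M I M) (\<lambda>\<omega>. \<Prod>i\<in>I. w i (\<omega> i))) (Pi\<^sub>M I N) (\<lambda>\<omega>. \<lambda>i\<in>I. D i (\<omega> i))"
  (is "_ = ?D")
proof -
  interpret M: product_sigma_finite M by fact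
  interpret P: product_sigma_finite "\<lambda>i. distr (density (M i) (w i)) (N i) (D i)" by fact
  have Dm: "(\<lambda>\<omega>. \<lambda>i\<in>I. D i (\<omega> i)) \<in> measurable (Pi\<^sub>M I M) (Pi\<^sub>M I N)"
    using D by (intro measurable_restrict measurable_compose[OF measurable_component_singleton]) auto
  have wm: "(\<lambda>\<omega>. \<Prod>i\<in>I. w i (\<omega> i)) \<in> borel_measurable (Pi\<^sub>M I M)"
    using w by (intro borel_measurable_prod_ennreal measurable_compose[OF measurable_component_singleton]) auto
  show ?thesis
  proof (rule P.PiM_eqI[OF I, symmetric])
    show "sets (?D) =
      sets (Pi\<^sub>M I (\<lambda>i. distr (density (M i) (w i)) (N i) (D i)))"
      unfolding sets_distr by (intro sets_PiM_cong) auto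
    fix E assume E: "\<And>i. i \<in> I \<Longrightarrow> E i \<in> sets (distr (density (M i) (w i)) (N i) (D i))"
    hence E': "E i \<in> sets (N i)" if "i \<in> I" for i using that by auto
    have PE: "Pi\<^sub>E I E \<in> sets (Pi\<^sub>M I N)" using I E' by (intro sets_PiM_I_finite) auto
    have "emeasure (?D) (Pi\<^sub>E I E) =
        (\<integral>\<^sup>+\<omega>. (\<Prod>i\<in>I. w i (\<omega> i)) * indicator ((\<lambda>\<omega>. \<lambda>i\<in>I. D i (\<omega> i)) -` Pi\<^sub>E I E \<inter> space (Pi\<^sub>M I M)) \<omega> \<partial>Pi\<^sub>M I M)"
      using PE Dm wm by (subst emeasure_distr) (auto simp: emeasure_density measurable_sets)
    also have "\<dots> = (\<integral>\<^sup>+\<omega>. (\<Prod>i\<in>I. w i (\<omega> i) * indicator (D i -` E i \<inter> space (M i)) (\<omega> i)) \<partial>Pi\<^sub>M I M)"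
    proof (intro nn_integral_cong)
      fix \<omega> assume \<omega>: "\<omega> \<in> space (Pi\<^sub>M I M)"
      have "indicator ((\<lambda>\<omega>. \<lambda>i\<in>I. D i (\<omega> i)) -` Pi\<^sub>E I E \<inter> space (Pi\<^sub>M I M)) \<omega> =
          (\<Prod>i\<in>I. indicator (D i -` E i \<inter> space (M i)) (\<omega> i) :: ennreal)"
        using \<omega> I by (auto simp: indicator_def space_PiM PiE_iff prod_zero_iff)
      thus "(\<Prod>i\<in>I. w i (\<omega> i)) * indicator ((\<lambda>\<omega>. \<lambda>i\<in>I. D i (\<omega> i)) -` Pi\<^sub>E I E \<inter> space (Pi\<^sub>M I M)) \<omega> =
          (\<Prod>i\<in>I. w i (\<omega> i) * indicator (D i -` E i \<inter> space (M i)) (\<omega> i))"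
        by (simp add: prod.distrib)
    qed
    also have "\<dots> = (\<Prod>i\<in>I. \<integral>\<^sup>+\<omega>. w i \<omega> * indicator (D i -` E i \<inter> space (M i)) \<omega> \<partial>M i)"
      using w D E' I by (intro M.product_nn_integral_prod borel_measurable_times borel_measurable_indicator) (auto simp: measurable_sets)
    also have "\<dots> = (\<Prod>i\<in>I. emeasure (distr (density (M i) (w i)) (N i) (D i)) (E i))"
    proof (intro prod.cong refl)
      fix i assume i: "i \<in> I"
      show "(\<integral>\<^sup>+\<omega>. w i \<omega> * indicator (D i -` E i \<inter> space (M i)) \<omega> \<partial>M i) =
          emeasure (distr (density (M i) (w i)) (N i) (D i)) (E i)"
        using w[OF i] D[OF i] E'[OF i] by (subst emeasure_distr) (auto simp: emeasure_density measurable_sets)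
    qed
    finally show "emeasure (?D) (Pi\<^sub>E I E) =
      (\<Prod>i\<in>I. emeasure (distr (density (M i) (w i)) (N i) (D i)) (E i))" .
  qed
qed

text \<open>\<open>c\<close> is the vector of cofactors of row \<open>k\<close>, found as the values
  of the determinant at the basis vectors; it depends on the other rows only.\<close>

lemma det_row_eq_inner:
  fixes r :: "'n::finite \<Rightarrow> real ^ 'n"
  shows "\<exists>c. \<forall>v. det (\<chi> i. (r(k := v)) i) = v \<bullet> c"
proof (intro exI allI)
  fix v :: "real ^ 'n"
  have lin: "linear (\<lambda>v. det (\<chi> i. (r(k := v)) i))"
  proof (rule linearI)
    have eq: "(\<chi> i. (r(k := v)) i) = (\<chi> i. if i = k then v else r i)" for v
      by (simp add: vec_eq_iff)
    show "det (\<chi> i. (r(k := u + v)) i) = det (\<chi> i. (r(k := u)) i) + det (\<chi> i. (r(k := v)) i)" for u v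
      unfolding eq by (rule det_row_add)
    show "det (\<chi> i. (r(k := a *\<^sub>R v)) i) = a *\<^sub>R det (\<chi> i. (r(k := v)) i)" for a v
    proof -
      have "a *\<^sub>R v = a *s v" by (simp add: vec_eq_iff)
      show ?thesis unfolding eq \<open>a *\<^sub>R v = a *s v\<close> real_scaleR_def by (rule det_row_mul[of k a "\<lambda>_. v" r])
    qed
  qed
  have "det (\<chi> i. (r(k := v)) i) = (\<lambda>v. det (\<chi> i. (r(k := v)) i)) (\<Sum>b\<in>Basis. (v \<bullet> b) *\<^sub>R b)"
    by (simp add: euclidean_representation)
  also have "\<dots> = v \<bullet> (\<Sum>b\<in>Basis. det (\<chi> i. (r(k := b)) i) *\<^sub>R b)"
    by (simp only: linear_sum[OF lin] linear_scale[OF lin] inner_sum_right inner_scaleR_right real_scaleR_def mult.commute)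
  finally show "det (\<chi> i. (r(k := v)) i) = v \<bullet> (\<Sum>b\<in>Basis. det (\<chi> i. (r(k := b)) i) *\<^sub>R b)" .
qed

lemma borel_measurable_det:
  fixes A :: "'w \<Rightarrow> real ^ 'n ^ 'n"
  assumes "\<And>i. (\<lambda>\<omega>. A \<omega> $ i) \<in> borel_measurable M"
  shows "(\<lambda>\<omega>. det (A \<omega>)) \<in> borel_measurable M"
proof -
  have "(\<lambda>v :: real ^ 'n. v $ j) \<in> borel_measurable borel" for j
    by (intro borel_measurable_continuous_onI continuous_intros)
  from measurable_compose[OF assms this] have "(\<lambda>\<omega>. A \<omega> $ i $ j) \<in> borel_measurable M" for i j .
  thus ?thesis
    unfolding det_def by measurable
qed

text \<open>The determinant is linear in each row, so its rows can be replaced one after the other.\<close>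

lemma nn_integral_det_rows_mono:
  fixes \<mu> \<nu> :: "'n \<Rightarrow> (real ^ 'n) measure"
  assumes sf: "\<And>i. sigma_finite_measure (\<mu> i)" "\<And>i. sigma_finite_measure (\<nu> i)"
    and sets: "\<And>i. sets (\<mu> i) = sets borel" "\<And>i. sets (\<nu> i) = sets borel"
    and h [measurable]: "h \<in> borel_measurable borel"
    and le: "\<And>i c. (\<integral>\<^sup>+r. h (r \<bullet> c) \<partial>\<mu> i) \<le> (\<integral>\<^sup>+r. h (r \<bullet> c) \<partial>\<nu> i)"
  shows "(\<integral>\<^sup>+r. h (det (\<chi> i. r i)) \<partial>Pi\<^sub>M (UNIV :: 'n set) \<mu>) \<le>
    (\<integral>\<^sup>+r. h (det (\<chi> i. r i)) \<partial>Pi\<^sub>M (UNIV :: 'n set) \<nu>)"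
proof -
  \<comment> \<open>Hybrid laws: the rows in \<open>S\<close> already follow \<open>\<nu>\<close>,
    the others still follow \<open>\<mu>\<close>. Adding \<open>k\<close> to \<open>S\<close>
    freezes all other rows, and \<open>le\<close> is applied to their cofactor vector.\<close>
  define P where "P S = (\<lambda>i :: 'n. if i \<in> S then \<nu> i else \<mu> i)" for S
  have P: "product_sigma_finite (P S)" for S
    unfolding P_def using sf by (intro product_sigma_finite.intro) auto
  have cm: "sets (P S i) = sets borel" for S i using sets by (simp add: P_def)
  have setsP: "sets (Pi\<^sub>M UNIV (P S)) = sets (Pi\<^sub>M UNIV (\<lambda>_. borel))" for S
    using cm by (intro sets_PiM_cong) auto
  have meas: "(\<lambda>r. h (det (\<chi> i. r i))) \<in> borel_measurable (Pi\<^sub>M UNIV (P S))" for S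
  proof -
    have "(\<lambda>r. h (det (\<chi> i. r i))) \<in> borel_measurable (Pi\<^sub>M (UNIV :: 'n set) (\<lambda>_. borel))"
      by (intro measurable_compose[OF borel_measurable_det h]) simp
    thus ?thesis using measurable_cong_sets[OF setsP refl] by blast
  qed
  have "(\<integral>\<^sup>+r. h (det (\<chi> i. r i)) \<partial>Pi\<^sub>M UNIV (P {})) \<le> (\<integral>\<^sup>+r. h (det (\<chi> i. r i)) \<partial>Pi\<^sub>M UNIV (P S))" if "finite S" for S
    using that
  proof (induction S rule: finite_induct)
    case (insert k S)
    interpret A: product_sigma_finite "P S" by (rule P)
    interpret B: product_sigma_finite "P (insert k S)" by (rule P)
    have U: "insert k (UNIV - {k}) = UNIV" by auto
    have eq: "Pi\<^sub>M (UNIV - {k}) (P (insert k S)) = Pi\<^sub>M (UNIV - {k}) (P S)"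
      by (intro PiM_cong) (auto simp: P_def)
    have "(\<integral>\<^sup>+r. h (det (\<chi> i. r i)) \<partial>Pi\<^sub>M UNIV (P S)) =
        (\<integral>\<^sup>+r. \<integral>\<^sup>+v. h (det (\<chi> i. (r(k := v)) i)) \<partial>\<mu> k \<partial>Pi\<^sub>M (UNIV - {k}) (P S))"
      using A.product_nn_integral_insert[of "UNIV - {k}" k "\<lambda>r. h (det (\<chi> i. r i))", unfolded U, OF _ _ meas] insert.hyps
      by (simp add: P_def)
    also have "\<dots> \<le> (\<integral>\<^sup>+r. \<integral>\<^sup>+v. h (det (\<chi> i. (r(k := v)) i)) \<partial>\<nu> k \<partial>Pi\<^sub>M (UNIV - {k}) (P S))"
    proof (intro nn_integral_mono)
      fix r :: "'n \<Rightarrow> real ^ 'n"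
      obtain c where "\<And>v. det (\<chi> i. (r(k := v)) i) = v \<bullet> c" using det_row_eq_inner[of r k] by blast
      thus "(\<integral>\<^sup>+v. h (det (\<chi> i. (r(k := v)) i)) \<partial>\<mu> k) \<le> (\<integral>\<^sup>+v. h (det (\<chi> i. (r(k := v)) i)) \<partial>\<nu> k)"
        using le by simp
    qed
    also have "\<dots> = (\<integral>\<^sup>+r. h (det (\<chi> i. r i)) \<partial>Pi\<^sub>M UNIV (P (insert k S)))"
      using B.product_nn_integral_insert[of "UNIV - {k}" k "\<lambda>r. h (det (\<chi> i. r i))", unfolded U eq, OF _ _ meas]
      by (simp add: P_def)
    finally show ?case using insert.IH by (rule order_trans[rotated])
  qed simp
  from this[of UNIV] show ?thesis by (simp add: P_def)
qed

text \<open>A finite total weight makes each row law a finite measure, hence sigma-finite, as the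
  product construction demands.\<close>

lemma nn_integral_PiM_weighted_rows:
  fixes D :: "'n::finite \<Rightarrow> 'a \<Rightarrow> real ^ 'n" and h :: "real \<Rightarrow> ennreal"
  assumes "prob_space M" and w [measurable]: "\<And>i. w i \<in> borel_measurable M"
    and fin: "\<And>i. (\<integral>\<^sup>+\<omega>. w i \<omega> \<partial>M) \<noteq> \<infinity>"
    and D [measurable]: "\<And>i. D i \<in> borel_measurable M" and h [measurable]: "h \<in> borel_measurable borel"
  shows "(\<integral>\<^sup>+r. h (det (\<chi> i. r i)) \<partial>Pi\<^sub>M UNIV (\<lambda>i. distr (density M (w i)) borel (D i))) =
      (\<integral>\<^sup>+\<omega>. (\<Prod>i\<in>UNIV. w i (\<omega> i)) * h (det (\<chi> i. D i (\<omega> i))) \<partial>Pi\<^sub>M UNIV (\<lambda>_. M))"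
    and "sigma_finite_measure (distr (density M (w i)) borel (D i))"
proof -
  interpret prob_space M by fact
  have fm: "finite_measure (distr (density M (w i)) borel (D i))" for i
    using fin[of i] by (intro finite_measureI) (simp add: emeasure_distr emeasure_density cong: nn_integral_cong)
  thus "sigma_finite_measure (distr (density M (w i)) borel (D i))"
    by (simp add: finite_measure.axioms)
  have hm: "(\<lambda>r. h (det (\<chi> i. r i))) \<in> borel_measurable (Pi\<^sub>M (UNIV :: 'n set) (\<lambda>_. borel))"
    by (intro measurable_compose[OF borel_measurable_det h]) simp
  have Dm: "(\<lambda>\<omega>. \<lambda>i\<in>UNIV. D i (\<omega> i)) \<in> measurable (Pi\<^sub>M (UNIV :: 'n set) (\<lambda>_. M)) (Pi\<^sub>M UNIV (\<lambda>_. borel))"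
    by (intro measurable_restrict) measurable
  have wm: "(\<lambda>\<omega>. \<Prod>i\<in>UNIV. w i (\<omega> i)) \<in> borel_measurable (Pi\<^sub>M (UNIV :: 'n set) (\<lambda>_. M))"
    by measurable
  have "Pi\<^sub>M UNIV (\<lambda>i. distr (density M (w i)) borel (D i)) =
      distr (density (Pi\<^sub>M UNIV (\<lambda>_. M)) (\<lambda>\<omega>. \<Prod>i\<in>UNIV. w i (\<omega> i))) (Pi\<^sub>M UNIV (\<lambda>_. borel)) (\<lambda>\<omega>. \<lambda>i\<in>UNIV. D i (\<omega> i))"
    using fm by (intro PiM_distr_density product_sigma_finite.intro) (auto simp: finite_measure.axioms intro: sigma_finite_measure_axioms)
  thus "(\<integral>\<^sup>+r. h (det (\<chi> i. r i)) \<partial>Pi\<^sub>M UNIV (\<lambda>i. distr (density M (w i)) borel (D i))) =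
      (\<integral>\<^sup>+\<omega>. (\<Prod>i\<in>UNIV. w i (\<omega> i)) * h (det (\<chi> i. D i (\<omega> i))) \<partial>Pi\<^sub>M UNIV (\<lambda>_. M))"
    using measurable_compose[OF Dm hm] Dm hm wm
    by (simp add: nn_integral_distr nn_integral_density restrict_def)
qed

text \<open>The form in which random matrices are compared below. \<open>h\<close> is the absolute
  value for expected determinants, and the indicator of the nonzero numbers for the invertibility of
  a random matrix.\<close>

lemma nn_integral_det_weighted_rows_mono:
  fixes D :: "'n::finite \<Rightarrow> 'a \<Rightarrow> real ^ 'n" and D' :: "'n::finite \<Rightarrow> 'b \<Rightarrow> real ^ 'n" and h :: "real \<Rightarrow> ennreal"
  assumes M: "prob_space M" "\<And>i. w i \<in> borel_measurable M" "\<And>i. (\<integral>\<^sup>+\<omega>. w i \<omega> \<partial>M) \<noteq> \<infinity>" "\<And>i. D i \<in> borel_measurable M"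
    and N: "prob_space N" "\<And>i. w' i \<in> borel_measurable N" "\<And>i. (\<integral>\<^sup>+\<omega>. w' i \<omega> \<partial>N) \<noteq> \<infinity>" "\<And>i. D' i \<in> borel_measurable N"
    and h: "h \<in> borel_measurable borel"
    and le: "\<And>i c. (\<integral>\<^sup>+\<omega>. w i \<omega> * h (D i \<omega> \<bullet> c) \<partial>M) \<le> (\<integral>\<^sup>+\<omega>. w' i \<omega> * h (D' i \<omega> \<bullet> c) \<partial>N)"
  shows "(\<integral>\<^sup>+\<omega>. (\<Prod>i\<in>UNIV. w i (\<omega> i)) * h (det (\<chi> i. D i (\<omega> i))) \<partial>Pi\<^sub>M UNIV (\<lambda>_. M)) \<le>
    (\<integral>\<^sup>+\<omega>. (\<Prod>i\<in>UNIV. w' i (\<omega> i)) * h (det (\<chi> i. D' i (\<omega> i))) \<partial>Pi\<^sub>M UNIV (\<lambda>_. N))"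
proof -
  note [measurable] = M(2,4) N(2,4) h
  have hc: "(\<lambda>r :: real ^ 'n. h (r \<bullet> c)) \<in> borel_measurable borel" for c
    by measurable
  have 1: "(\<integral>\<^sup>+r. h (r \<bullet> c) \<partial>distr (density M (w i)) borel (D i)) = (\<integral>\<^sup>+\<omega>. w i \<omega> * h (D i \<omega> \<bullet> c) \<partial>M)" for i c
    by (simp add: nn_integral_distr nn_integral_density)
  have 2: "(\<integral>\<^sup>+r. h (r \<bullet> c) \<partial>distr (density N (w' i)) borel (D' i)) = (\<integral>\<^sup>+\<omega>. w' i \<omega> * h (D' i \<omega> \<bullet> c) \<partial>N)" for i c
    by (simp add: nn_integral_distr nn_integral_density)
  have "(\<integral>\<^sup>+r. h (det (\<chi> i. r i)) \<partial>Pi\<^sub>M UNIV (\<lambda>i. distr (density M (w i)) borel (D i))) \<le>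
      (\<integral>\<^sup>+r. h (det (\<chi> i. r i)) \<partial>Pi\<^sub>M UNIV (\<lambda>i. distr (density N (w' i)) borel (D' i)))"
    using le nn_integral_PiM_weighted_rows(2)[OF M h] nn_integral_PiM_weighted_rows(2)[OF N h]
    by (intro nn_integral_det_rows_mono h) (simp_all add: 1 2)
  thus ?thesis
    unfolding nn_integral_PiM_weighted_rows(1)[OF M h] nn_integral_PiM_weighted_rows(1)[OF N h] .
qed

section \<open>Change of variables and the area formula\<close>

text \<open>The change of variables theorems of the library require a well-ordered index type; a finite type has
  such an order only on a copy.\<close>

typedef 'a ranked = "UNIV :: 'a set" morphisms unrank rank by simp

lemma bij_unrank: "bij (unrank :: 'a ranked \<Rightarrow> 'a)"
  by (metis bijI' unrank_inject UNIV_I unrank_inverse rank_inverse)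

instance ranked :: (finite) finite
  by intro_classes (metis bij_unrank bij_betw_finite finite_code)

instantiation ranked :: (finite) wellorder
begin

definition less_eq_ranked where
  "(x :: 'a ranked) \<le> y \<longleftrightarrow> to_nat_on UNIV x \<le> to_nat_on UNIV y"

definition less_ranked where
  "(x :: 'a ranked) < y \<longleftrightarrow> to_nat_on UNIV x < to_nat_on UNIV y"

instance
proof
  fix x y z :: "'a ranked" and P :: "'a ranked \<Rightarrow> bool"
  have inj: "inj (to_nat_on (UNIV :: 'a ranked set))"
    by (intro inj_on_to_nat_on uncountable_infinite) (auto intro: countable_finite)
  show "x \<le> y \<Longrightarrow> y \<le> x \<Longrightarrow> x = y"
    using injD[OF inj] by (auto simp: less_eq_ranked_def)
  show "P x" if "\<And>x. (\<And>y. y < x \<Longrightarrow> P y) \<Longrightarrow> P x"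
  proof (induction x rule: measure_induct_rule[of "to_nat_on UNIV"])
    case (less x)
    show ?case by (rule that, rule less) (simp add: less_ranked_def)
  qed
qed (auto simp: less_eq_ranked_def less_ranked_def)

end

text \<open>Conjugation with \<open>g\<close> is a bijection between the two symmetric groups that
  preserves signs.\<close>

lemma det_reindex:
  fixes A :: "'c::comm_ring_1 ^ 'b::finite ^ 'b" and g :: "'a::finite \<Rightarrow> 'b"
  assumes g: "bij g"
  shows "det (\<chi> i j. A $ g i $ g j) = det A"
proof -
  have ig: "inj_on g UNIV" using g by (simp add: bij_is_inj)
  have bij: "bij_betw (map_permutation UNIV g) {p. p permutes (UNIV :: 'a set)} {p. p permutes (UNIV :: 'b set)}"
  proof (rule bij_betw_byWitness[where f' = "map_permutation UNIV (inv g)"])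
    have "bij (inv g)" using g by (rule bij_imp_bij_inv)
    show "\<forall>p\<in>{p. p permutes UNIV}. map_permutation UNIV (inv g) (map_permutation UNIV g p) = p"
      using g by (auto intro!: map_permutation_compose_inv simp: bij_is_inj)
    show "\<forall>p\<in>{p. p permutes UNIV}. map_permutation UNIV g (map_permutation UNIV (inv g) p) = p"
      using g \<open>bij (inv g)\<close> by (auto intro!: map_permutation_compose_inv simp: bij_is_surj surj_f_inv_f)
    show "map_permutation UNIV g ` {p. p permutes UNIV} \<subseteq> {p. p permutes UNIV}"
      using g by (auto intro: map_permutation_permutes)
    show "map_permutation UNIV (inv g) ` {p. p permutes UNIV} \<subseteq> {p. p permutes UNIV}"
      using \<open>bij (inv g)\<close> by (auto intro: map_permutation_permutes)
  qed
  have "det A = (\<Sum>p\<in>{p. p permutes (UNIV :: 'a set)}.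
      of_int (sign (map_permutation UNIV g p)) * (\<Prod>i\<in>UNIV. A $ i $ map_permutation UNIV g p i))"
    unfolding det_def by (rule sum.reindex_bij_betw[OF bij, symmetric])
  also have "\<dots> = det (\<chi> i j. A $ g i $ g j)"
    unfolding det_def
  proof (intro sum.cong refl arg_cong2[where f = "(*)"])
    fix p assume "p \<in> {p. p permutes (UNIV :: 'a set)}"
    hence p: "p permutes UNIV" by simp
    show "of_int (sign (map_permutation UNIV g p)) = (of_int (sign p) :: 'c)"
      using p ig by (simp add: sign_map_permutation)
    have "(\<Prod>i\<in>UNIV. A $ i $ map_permutation UNIV g p i) = (\<Prod>i\<in>UNIV. A $ g i $ map_permutation UNIV g p (g i))"
      by (rule prod.reindex_bij_betw[OF g, symmetric])
    thus "(\<Prod>i\<in>UNIV. A $ i $ map_permutation UNIV g p i) = (\<Prod>i\<in>UNIV. (\<chi> i j. A $ g i $ g j) $ i $ p i)"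
      using ig by (simp add: map_permutation_apply)
  qed
  finally show ?thesis ..
qed

lemma box_cart: "box (l :: real ^ 'n) u = {x. \<forall>i. l $ i < x $ i \<and> x $ i < u $ i}"
  by (auto simp: box_def Basis_vec_def inner_axis)

lemma Basis_prod_cart:
  fixes F :: "real ^ 'n \<Rightarrow> 'b :: comm_monoid_mult"
  shows "(\<Prod>b\<in>Basis. F b) = (\<Prod>i\<in>UNIV. F (axis i 1))"
proof -
  have B: "(Basis :: (real ^ 'n) set) = range (\<lambda>i. axis i 1)"
    by (auto simp: Basis_vec_def)
  have inj: "inj (\<lambda>i :: 'n. axis i (1::real))"
    by (auto intro!: injI simp: axis_eq_axis)
  show ?thesis
    unfolding B by (subst prod.reindex[OF inj]) simp
qed

text \<open>Relabelling coordinates maps boxes to boxes with the same side lengths.\<close>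

lemma distr_lborel_reindex:
  fixes g :: "'a::finite \<Rightarrow> 'b::finite"
  assumes g: "bij g"
  shows "distr lborel borel (\<lambda>x :: real ^ 'b. \<chi> i. x $ g i) = lborel"
proof (rule lborel_eqI[symmetric])
  fix l u :: "real ^ 'a"
  assume le: "\<And>b. b \<in> Basis \<Longrightarrow> l \<bullet> b \<le> u \<bullet> b"
  let ?h = "\<lambda>x :: real ^ 'b. \<chi> i. x $ g i" and ?k = "\<lambda>x :: real ^ 'a. \<chi> i. x $ inv g i"
  have [measurable]: "?h \<in> borel_measurable borel"
    by (intro borel_measurable_continuous_onI continuous_intros)
  have "?h -` box l u = box (?k l) (?k u)"
    unfolding box_cart using g
    by (auto simp: bij_is_surj surj_f_inv_f) (metis bij_inv_eq_iff)+
  moreover have "?k l \<bullet> b \<le> ?k u \<bullet> b" if "b \<in> Basis" for b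
  proof -
    from that obtain i where b: "b = axis i 1" by (auto simp: Basis_vec_def)
    show ?thesis using le[of "axis (inv g i) 1"] by (simp add: b inner_axis axis_in_Basis_iff)
  qed
  ultimately have "emeasure (distr lborel borel ?h) (box l u) = ennreal (\<Prod>b\<in>Basis. (?k u - ?k l) \<bullet> b)"
    by (simp add: emeasure_distr emeasure_lborel_box_eq)
  also have "(\<Prod>b\<in>Basis. (?k u - ?k l) \<bullet> b) = (\<Prod>i\<in>UNIV. u $ inv g i - l $ inv g i)"
    by (simp add: Basis_prod_cart inner_axis)
  also have "\<dots> = (\<Prod>i\<in>UNIV. u $ i - l $ i)"
    by (rule prod.reindex_bij_betw) (rule bij_imp_bij_inv[OF g])
  also have "\<dots> = (\<Prod>b\<in>Basis. (u - l) \<bullet> b)"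
    by (simp add: Basis_prod_cart inner_axis)
  finally show "emeasure (distr lborel borel ?h) (box l u) = ennreal (\<Prod>b\<in>Basis. (u - l) \<bullet> b)" .
qed simp

text \<open>Compactness of \<open>K\<close> makes \<open>\<bar>det (J x)\<bar>\<close> integrable on
  it, so that the real-valued change of variables applies and its value can be read as an
  \<open>emeasure\<close>.\<close>

lemma emeasure_compact_differentiable_image_ranked:
  fixes f :: "real ^ 'n::{finite,wellorder} \<Rightarrow> real ^ 'n::_" and J :: "real ^ 'n::_ \<Rightarrow> real ^ 'n::_ ^ 'n::_"
  assumes K: "compact K" and f: "\<And>x. (f has_derivative (*v) (J x)) (at x)"
    and J: "continuous_on UNIV J" and inj: "inj_on f K"
  shows "emeasure lborel (f ` K) = (\<integral>\<^sup>+x. ennreal \<bar>det (J x)\<bar> * indicator K x \<partial>lborel)"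
proof -
  have "continuous_on UNIV (\<lambda>x. \<bar>det (J x)\<bar>)"
    unfolding det_def by (intro continuous_intros J)
  hence [measurable]: "(\<lambda>x. det (J x)) \<in> borel_measurable borel" and cont: "continuous_on K (\<lambda>x. \<bar>det (J x)\<bar>)"
     apply (auto intro: continuous_on_subset)
    unfolding det_def by (intro borel_measurable_continuous_onI continuous_intros J)
  have "set_integrable lborel K (\<lambda>x. \<bar>det (J x)\<bar>)"
    using borel_integrable_compact[OF K cont] by (simp add: set_integrable_def indicator_scaleR_eq_if)
  hence si: "set_integrable lebesgue K (\<lambda>x. \<bar>det (J x)\<bar>)"
    by (auto simp: set_integrable_def intro!: integrable_completion[THEN iffD2])
  hence "(\<lambda>x. \<bar>det (J x)\<bar>) integrable_on K"
    by (rule set_lebesgue_integral_eq_integral(1))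
  then obtain m where m: "((\<lambda>x. \<bar>det (J x)\<bar>) has_integral m) K" by blast
  have der: "(f has_derivative (*v) (J x)) (at x within K)" for x
    using f by (rule has_derivative_at_withinI)
  have "K \<in> sets lebesgue" using K by (simp add: borel_compact)
  from has_measure_differentiable_image[OF this der inj, of m] m
  have fm: "f ` K \<in> lmeasurable" "measure lebesgue (f ` K) = m" by auto
  have "emeasure lborel (f ` K) = emeasure lebesgue (f ` K)"
  proof -
    have "continuous_on K f" using f by (meson continuous_at_imp_continuous_on has_derivative_continuous)
    hence "f ` K \<in> sets borel" using K by (intro borel_compact compact_continuous_image)
    thus ?thesis by simp
  qed
  also have "\<dots> = ennreal m" using fm by (simp add: emeasure_eq_measure2)
  also have "\<dots> = (\<integral>\<^sup>+x. ennreal (indicator K x * \<bar>det (J x)\<bar>) \<partial>lborel)"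
    using m by (intro nn_integral_has_integral_lebesgue[symmetric]) auto
  also have "\<dots> = (\<integral>\<^sup>+x. ennreal \<bar>det (J x)\<bar> * indicator K x \<partial>lborel)"
    by (intro nn_integral_cong) (simp add: indicator_def)
  finally show ?thesis .
qed


text \<open>The relabelling \<open>R\<close> preserves Lebesgue measure and permutes the rows and
  columns of \<open>J\<close> in the same way, which leaves the determinant unchanged.\<close>

lemma emeasure_compact_differentiable_image:
  fixes f :: "real ^ 'n \<Rightarrow> real ^ 'n" and J :: "real ^ 'n \<Rightarrow> real ^ 'n ^ 'n"
  assumes K: "compact K" and f: "\<And>x. (f has_derivative (*v) (J x)) (at x)"
    and J: "continuous_on UNIV J" and inj: "inj_on f K"
  shows "emeasure lborel (f ` K) = (\<integral>\<^sup>+x. ennreal \<bar>det (J x)\<bar> * indicator K x \<partial>lborel)"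
proof -
  define R where "R = (\<lambda>x :: real ^ 'n. \<chi> i :: 'n ranked. x $ unrank i)"
  define R' where "R' = (\<lambda>x :: real ^ 'n ranked. \<chi> i :: 'n. x $ rank i)"
  have RR' [simp]: "R (R' x) = x" for x by (simp add: R_def R'_def unrank_inverse)
  have R'R [simp]: "R' (R x) = x" for x by (simp add: R_def R'_def rank_inverse)
  have bl: "bounded_linear R" "bounded_linear R'"
    unfolding linear_conv_bounded_linear[symmetric] by (auto simp: R_def R'_def vec_eq_iff intro!: linearI)
  have contR: "continuous_on S R" and contR': "continuous_on S' R'" for S S'
    using bl by (simp_all add: linear_continuous_on)
  have [measurable]: "R \<in> borel_measurable borel" "R' \<in> borel_measurable borel"
    by (intro borel_measurable_continuous_onI contR contR')+
  have dR: "distr lborel borel R = lborel"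
    unfolding R_def by (rule distr_lborel_reindex) (rule bij_unrank)
  define f' where "f' = (\<lambda>x. R (f (R' x)))"
  define J' where "J' = (\<lambda>x. \<chi> i j. J (R' x) $ unrank i $ unrank j)"
  have J'v: "J' x *v v = R (J (R' x) *v R' v)" for x v
  proof -
    have "(\<Sum>j\<in>UNIV. J (R' x) $ unrank i $ unrank j * v $ j) = (\<Sum>j\<in>UNIV. J (R' x) $ unrank i $ j * v $ rank j)" for i
      by (subst sum.reindex_bij_betw[OF bij_unrank, symmetric]) (simp add: unrank_inverse)
    thus ?thesis
      by (simp add: J'_def R_def R'_def vec_eq_iff matrix_vector_mult_def)
  qed
  have f': "(f' has_derivative (*v) (J' x)) (at x)" for x
  proof -
    have "((\<lambda>x. R (f (R' x))) has_derivative (\<lambda>v. R (J (R' x) *v R' v))) (at x)"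
      by (intro bounded_linear.has_derivative[OF bl(1)]
           has_derivative_compose[OF bounded_linear.has_derivative[OF bl(2) has_derivative_ident] f])
    thus ?thesis by (simp add: f'_def J'v[abs_def])
  qed
  have J': "continuous_on UNIV J'"
    unfolding J'_def
    by (intro continuous_intros continuous_on_compose2[OF J] contR') auto
  have det: "det (J' x) = det (J (R' x))" for x
    unfolding J'_def by (rule det_reindex) (rule bij_unrank)
  have inj': "inj_on f' (R ` K)"
    using inj by (intro inj_onI) (metis RR' R'R f'_def imageE inj_onD)
  have fK: "f ` K \<in> sets borel"
  proof -
    have "continuous_on K f" using f by (meson continuous_at_imp_continuous_on has_derivative_continuous)
    thus ?thesis using K by (intro borel_compact compact_continuous_image)
  qed
  have "emeasure lborel (f ` K) = emeasure (distr lborel borel R') (f ` K)"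
  proof -
    have "distr lborel borel R' = distr (distr lborel borel R) borel R'" by (simp add: dR)
    also have "\<dots> = lborel" by (subst distr_distr) (auto simp: comp_def distr_id2)
    finally show ?thesis by simp
  qed
  also have "\<dots> = emeasure lborel (f' ` (R ` K))"
  proof (subst emeasure_distr)
    have "R' -` (f ` K) \<inter> space lborel = f' ` (R ` K)"
      by (auto simp: f'_def image_image) (metis RR' image_eqI)
    thus "emeasure lborel (R' -` f ` K \<inter> space lborel) = emeasure lborel (f' ` R ` K)" by simp
  qed (use fK in auto)
  also have "\<dots> = (\<integral>\<^sup>+x. ennreal \<bar>det (J' x)\<bar> * indicator (R ` K) x \<partial>lborel)"
    by (rule emeasure_compact_differentiable_image_ranked)
       (use f' J' inj' K in \<open>auto intro: compact_continuous_image contR\<close>)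
  also have "\<dots> = (\<integral>\<^sup>+x. ennreal \<bar>det (J (R' x))\<bar> * indicator (R ` K) x \<partial>distr lborel borel R)"
    by (simp add: dR det)
  also have "\<dots> = (\<integral>\<^sup>+x. ennreal \<bar>det (J x)\<bar> * indicator K x \<partial>lborel)"
  proof -
    have "R ` K \<in> sets borel"
      using K by (intro borel_compact compact_continuous_image contR)
    moreover have "(\<lambda>x. det (J (R' x))) \<in> borel_measurable borel"
      unfolding det_def
      by (intro borel_measurable_continuous_onI continuous_intros continuous_on_compose2[OF J] contR') auto
    moreover have "indicator (R ` K) (R x) = (indicator K x :: ennreal)" for x
      by (auto simp: indicator_def) (metis R'R)
    ultimately show ?thesis
      by (subst nn_integral_distr) auto
  qed
  finally show ?thesis .
qed


text \<open>Sets \<open>V \<inter> C\<close> are increasing unions of compact sets, and they are the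
  sets met below: differences of open sets, and the intersections of these with preimages of closed
  sets.\<close>

lemma differentiable_image_open_Int_closed:
  fixes f :: "real ^ 'n \<Rightarrow> real ^ 'n" and J :: "real ^ 'n \<Rightarrow> real ^ 'n ^ 'n"
  assumes V: "open V" and C: "closed C" and f: "\<And>x. (f has_derivative (*v) (J x)) (at x)"
    and J: "continuous_on UNIV J" and inj: "inj_on f (V \<inter> C)"
  shows "f ` (V \<inter> C) \<in> sets borel"
    and "emeasure lborel (f ` (V \<inter> C)) = (\<integral>\<^sup>+x. ennreal \<bar>det (J x)\<bar> * indicator (V \<inter> C) x \<partial>lborel)"
proof -
  obtain D where D: "\<And>n. compact (D n)" "\<And>n. D n \<subseteq> interior (D (Suc n))" "\<Union>(range D) = V"
    using open_Union_compact_subsets[OF V] by metis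
  define K where "K n = D n \<inter> C" for n :: nat
  have K: "compact (K n)" for n unfolding K_def by (intro compact_Int_closed D C)
  have "D n \<subseteq> D (Suc n)" for n using D(2)[of n] interior_subset by blast
  hence inc: "incseq K" by (intro incseq_SucI) (auto simp: K_def)
  have UK: "(\<Union>n. K n) = V \<inter> C" using D(3) by (auto simp: K_def)
  have contf: "continuous_on S f" for S
    using f by (meson continuous_at_imp_continuous_on has_derivative_continuous)
  have fK: "f ` K n \<in> sets borel" for n
    by (intro borel_compact compact_continuous_image contf K)
  have fUK: "f ` (V \<inter> C) = (\<Union>n. f ` K n)" by (auto simp flip: UK)
  show "f ` (V \<inter> C) \<in> sets borel" unfolding fUK using fK by blast
  have [measurable]: "(\<lambda>x. det (J x)) \<in> borel_measurable borel"
    unfolding det_def by (intro borel_measurable_continuous_onI continuous_intros J)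
  let ?D = "density lborel (\<lambda>x. ennreal \<bar>det (J x)\<bar>)"
  have KD: "K n \<in> sets borel" for n using K by (rule borel_compact)
  have eq: "emeasure lborel (f ` K n) = emeasure ?D (K n)" for n
  proof -
    have "inj_on f (K n)" using inj UK by (rule_tac inj_on_subset) auto
    thus ?thesis
      using emeasure_compact_differentiable_image[OF K f J] KD by (subst emeasure_density) auto
  qed
  have "emeasure lborel (f ` (V \<inter> C)) = (SUP n. emeasure lborel (f ` K n))"
    unfolding fUK using inc fK by (intro SUP_emeasure_incseq[symmetric]) (auto simp: incseq_def)
  also have "\<dots> = (SUP n. emeasure ?D (K n))" by (simp add: eq)
  also have "\<dots> = emeasure ?D (V \<inter> C)"
    unfolding UK[symmetric] using inc KD by (intro SUP_emeasure_incseq) auto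
  also have "\<dots> = (\<integral>\<^sup>+x. ennreal \<bar>det (J x)\<bar> * indicator (V \<inter> C) x \<partial>lborel)"
    using V C by (subst emeasure_density) auto
  finally show "emeasure lborel (f ` (V \<inter> C)) = (\<integral>\<^sup>+x. ennreal \<bar>det (J x)\<bar> * indicator (V \<inter> C) x \<partial>lborel)" .
qed

text \<open>The image under \<open>f\<close> of the measure with density
  \<open>\<bar>det (J x)\<bar>\<close> on \<open>V \<inter> C\<close> is Lebesgue measure on the
  image set. It suffices to test closed sets, an intersection-stable generator; requiring
  \<open>f x\<close> to lie in a closed set merely shrinks \<open>C\<close>.\<close>

lemma nn_integral_change_of_variables:
  fixes f :: "real ^ 'n \<Rightarrow> real ^ 'n" and J :: "real ^ 'n \<Rightarrow> real ^ 'n ^ 'n"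
  assumes V: "open V" and C: "closed C" and f: "\<And>x. (f has_derivative (*v) (J x)) (at x)"
    and J: "continuous_on UNIV J" and inj: "inj_on f (V \<inter> C)"
    and h [measurable]: "h \<in> borel_measurable borel"
  shows "(\<integral>\<^sup>+x. h (f x) * ennreal \<bar>det (J x)\<bar> * indicator (V \<inter> C) x \<partial>lborel) =
    (\<integral>\<^sup>+y. h y * indicator (f ` (V \<inter> C)) y \<partial>lborel)"
proof -
  let ?S = "V \<inter> C"
  have contf: "continuous_on S f" for S
    using f by (meson continuous_at_imp_continuous_on has_derivative_continuous)
  have [measurable]: "f \<in> borel_measurable borel" by (intro borel_measurable_continuous_onI contf)
  have [measurable]: "(\<lambda>x. det (J x)) \<in> borel_measurable borel"
    unfolding det_def by (intro borel_measurable_continuous_onI continuous_intros J)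
  have [measurable]: "V \<inter> C \<in> sets borel" using V C by auto
  have fS [measurable]: "f ` ?S \<in> sets borel"
    by (rule differentiable_image_open_Int_closed(1)[OF V C f J inj])
  define \<mu> where "\<mu> = distr (density lborel (\<lambda>x. ennreal \<bar>det (J x)\<bar> * indicator ?S x)) borel f"
  define \<nu> where "\<nu> = density lborel (indicator (f ` ?S) :: _ \<Rightarrow> ennreal)"
  have "\<nu> = \<mu>"
  proof (rule measure_eqI_generator_eq[where E = "Collect closed" and \<Omega> = UNIV and A = "\<lambda>n. cball 0 (real n)"])
    show "Int_stable (Collect closed :: (real ^ 'n) set set)" by (auto simp: Int_stable_def)
    have "sets borel = sigma_sets UNIV (Collect closed :: (real ^ 'n) set set)"
      by (simp add: borel_eq_closed)
    thus "sets \<nu> = sigma_sets UNIV (Collect closed)" "sets \<mu> = sigma_sets UNIV (Collect closed)"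
      by (simp_all add: \<mu>_def \<nu>_def)
    fix T :: "(real ^ 'n) set" assume "T \<in> Collect closed"
    hence T: "closed T" by simp
    have fT: "closed (f -` T)" using T contf by (rule closed_vimage)
    have "emeasure \<mu> T = (\<integral>\<^sup>+x. ennreal \<bar>det (J x)\<bar> * indicator ?S x * indicator (f -` T) x \<partial>lborel)"
      unfolding \<mu>_def using T fT by (simp add: emeasure_distr emeasure_density)
    also have "\<dots> = (\<integral>\<^sup>+x. ennreal \<bar>det (J x)\<bar> * indicator (V \<inter> (C \<inter> f -` T)) x \<partial>lborel)"
      by (intro nn_integral_cong) (simp add: indicator_def)
    also have "\<dots> = emeasure lborel (f ` (V \<inter> (C \<inter> f -` T)))"
      by (rule differentiable_image_open_Int_closed(2)[symmetric])
         (use V C fT f J inj in \<open>auto intro: inj_on_subset\<close>)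
    also have "f ` (V \<inter> (C \<inter> f -` T)) = f ` ?S \<inter> T" by auto
    also have "emeasure lborel (f ` ?S \<inter> T) = (\<integral>\<^sup>+y. indicator (f ` ?S \<inter> T) y \<partial>lborel)"
      using T by (intro nn_integral_indicator[symmetric]) auto
    also have "\<dots> = (\<integral>\<^sup>+y. indicator (f ` ?S) y * indicator T y \<partial>lborel)"
      by (intro nn_integral_cong) (simp add: indicator_inter_arith)
    also have "\<dots> = emeasure \<nu> T"
      unfolding \<nu>_def using T by (subst emeasure_density) auto
    finally show "emeasure \<nu> T = emeasure \<mu> T" ..
  next
    show "(\<Union>n. cball (0 :: real ^ 'n) (real n)) = UNIV"
      by (auto simp: real_arch_simple)
    fix n
    have "emeasure \<nu> (cball 0 (real n)) \<le> emeasure lborel (cball 0 (real n) :: (real ^ 'n) set)"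
      unfolding \<nu>_def by (subst emeasure_density)
        (auto simp: nn_integral_indicator[symmetric] indicator_def intro!: nn_integral_mono simp del: nn_integral_indicator)
    thus "emeasure \<nu> (cball 0 (real n)) \<noteq> \<infinity>"
      using emeasure_lborel_cball_finite[of "0 :: real ^ 'n" "real n"] by (auto simp: top_unique)
  qed auto
  hence "(\<integral>\<^sup>+y. h y \<partial>\<mu>) = (\<integral>\<^sup>+y. h y \<partial>\<nu>)" by simp
  thus ?thesis
    by (simp add: \<mu>_def \<nu>_def nn_integral_distr nn_integral_density mult_ac)
qed

text \<open>Where \<open>det (J x)\<close> vanishes the left integrand is 0; elsewhere
  \<open>f\<close> is locally injective by the inverse function argument. A neighbourhood of the
  regular points is cut into countably many disjoint pieces on which \<open>f\<close> is injective,
  and at each \<open>y\<close> the number of pieces whose image contains \<open>y\<close> is at most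
  the size of the fibre.\<close>

lemma nn_integral_area_le:
  fixes f :: "real ^ 'n \<Rightarrow> real ^ 'n" and J :: "real ^ 'n \<Rightarrow> real ^ 'n ^ 'n"
  assumes f: "\<And>x. (f has_derivative (*v) (J x)) (at x)" and J: "continuous_on UNIV J"
    and h [measurable]: "h \<in> borel_measurable borel"
  shows "(\<integral>\<^sup>+x. h (f x) * ennreal \<bar>det (J x)\<bar> \<partial>lborel) \<le>
    (\<integral>\<^sup>+y. h y * emeasure (count_space UNIV) {x. f x = y} \<partial>lborel)"
proof -
  have contf: "continuous_on S f" for S
    using f by (meson continuous_at_imp_continuous_on has_derivative_continuous)
  have [measurable]: "f \<in> borel_measurable borel" by (intro borel_measurable_continuous_onI contf)
  have contdet: "continuous_on UNIV (\<lambda>x. det (J x))"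
    unfolding det_def by (intro continuous_intros J)
  hence [measurable]: "(\<lambda>x. det (J x)) \<in> borel_measurable borel"
    by (intro borel_measurable_continuous_onI)
  define \<V> where "\<V> = {V. open V \<and> inj_on f V}"
  have loc: "\<exists>V\<in>\<V>. x \<in> V" if "det (J x) \<noteq> 0" for x
  proof -
    have "invertible (J x)" using that by (simp add: invertible_det_nz)
    then obtain B where B: "B ** J x = mat 1" by (auto simp: invertible_def)
    \<comment> \<open>Local injectivity requires continuity of the derivative in the operator norm.
      Passing from entries to that norm costs the factor \<open>k\<close>, the number of entries of
      the matrix.\<close>
    have "\<exists>d>0. \<forall>y. dist x y < d \<longrightarrow> onorm (\<lambda>v. J y *v v - J x *v v) < e" if e: "e > 0" for e
    proof -
      define k where "k = real CARD('n) * real CARD('n)"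
      have k: "k > 0" by (simp add: k_def)
      from J have "isCont J x" by (simp add: continuous_on_eq_continuous_at)
      then obtain d where d: "d > 0" "\<And>y. dist y x < d \<Longrightarrow> dist (J y) (J x) < e / (2 * k)"
        using e k unfolding continuous_at_eps_delta by (metis divide_pos_pos mult_pos_pos zero_less_numeral)
      show ?thesis
      proof (intro exI[of _ d] conjI allI impI)
        fix y assume y: "dist x y < d"
        have "\<bar>(J y - J x) $ i $ j\<bar> \<le> e / (2 * k)" for i j
        proof -
          have "\<bar>(J y - J x) $ i $ j\<bar> \<le> norm ((J y - J x) $ i)" by (rule component_le_norm_cart)
          also have "\<dots> \<le> norm (J y - J x)" by (rule Finite_Cartesian_Product.norm_nth_le)
          also have "\<dots> \<le> e / (2 * k)" using d(2)[of y] y by (simp add: dist_norm norm_minus_commute)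
          finally show ?thesis .
        qed
        hence "onorm ((*v) (J y - J x)) \<le> real CARD('n) * real CARD('n) * (e / (2 * k))"
          by (rule onorm_le_matrix_component)
        also have "\<dots> = e / 2" using k by (simp add: k_def)
        also have "\<dots> < e" using e by simp
        finally show "onorm (\<lambda>v. J y *v v - J x *v v) < e"
          by (simp add: matrix_vector_mult_diff_rdistrib[abs_def])
      qed (use d in auto)
    qed
    moreover have "(*v) B \<circ> (*v) (J x) = id"
      by (auto simp: fun_eq_iff matrix_vector_mul_assoc B)
    ultimately obtain r where "r > 0" "inj_on f (ball x r)"
      using has_derivative_locally_injective[of x UNIV "(*v) B" "\<lambda>x. (*v) (J x)" f] f by auto
    thus ?thesis by (intro bexI[of _ "ball x r"]) (auto simp: \<V>_def)
  qed
  obtain \<V>' where \<V>': "\<V>' \<subseteq> \<V>" "countable \<V>'" "\<Union>\<V>' = \<Union>\<V>"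
    using Lindelof[of \<V>] by (auto simp: \<V>_def)
  \<comment> \<open>The empty set is inserted because \<open>\<V>'\<close> may be empty, whereas an
    enumeration needs a nonempty set.\<close>
  define V where "V = from_nat_into (insert {} \<V>')"
  have rV: "range V = insert {} \<V>'"
    unfolding V_def using \<V>' by (intro range_from_nat_into) auto
  have V: "open (V n)" "inj_on f (V n)" for n
    using rangeI[of V n] \<V>'(1) unfolding rV by (auto simp: \<V>_def)
  have cover: "(\<Union>n. V n) = \<Union>\<V>"
    using rV \<V>'(3) by auto
  \<comment> \<open>Removing the earlier open sets makes the pieces disjoint, so that no preimage is
    counted twice, and keeps each of them the intersection of an open and a closed set.\<close>
  define B where "B = disjointed V"
  have Beq: "B n = V n \<inter> (- (\<Union>i\<in>{0..<n}. V i))" for n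
    by (auto simp: B_def disjointed_def)
  have UB: "(\<Union>n. B n) = \<Union>\<V>" by (simp add: B_def UN_disjointed_eq cover)
  have dB: "disjoint_family B" by (simp add: B_def disjoint_family_disjointed)
  have cl: "closed (- (\<Union>i\<in>{0..<n}. V i))" for n using V by auto
  have injB: "inj_on f (B n)" for n using V(2)[of n] by (auto simp: Beq intro: inj_on_subset)
  have [measurable]: "B n \<in> sets borel" for n
    unfolding Beq by (intro sets.Int borel_open borel_closed V cl)
  have [measurable]: "f ` B n \<in> sets borel" for n
    unfolding Beq using differentiable_image_open_Int_closed(1)[OF V(1) cl f J] injB unfolding Beq by blast
  have suminf_ind: "(\<Sum>n. indicator (f ` B n) y) \<le> emeasure (count_space UNIV) {x. f x = y}" for y
  proof -
    have "(\<Sum>n. indicator (f ` B n) y :: ennreal) \<le> (\<Sum>n. emeasure (count_space UNIV) {x \<in> B n. f x = y})"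
    proof (intro suminf_le summableI)
      fix n show "indicator (f ` B n) y \<le> emeasure (count_space UNIV) {x \<in> B n. f x = y}"
      proof (cases "y \<in> f ` B n")
        case True
        then obtain x where "x \<in> B n" "f x = y" by auto
        hence "{x} \<subseteq> {x \<in> B n. f x = y}" by auto
        hence "emeasure (count_space UNIV) {x} \<le> emeasure (count_space UNIV) {x \<in> B n. f x = y}"
          by (intro emeasure_mono) auto
        thus ?thesis by (simp add: indicator_def)
      qed simp
    qed
    also have "\<dots> = emeasure (count_space UNIV) (\<Union>n. {x \<in> B n. f x = y})"
      using dB by (intro suminf_emeasure) (auto simp: disjoint_family_on_def)
    also have "\<dots> \<le> emeasure (count_space UNIV) {x. f x = y}"
      by (intro emeasure_mono) auto
    finally show ?thesis .
  qed
  have "(\<integral>\<^sup>+x. h (f x) * ennreal \<bar>det (J x)\<bar> \<partial>lborel) \<le>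
      (\<integral>\<^sup>+x. (\<Sum>n. h (f x) * ennreal \<bar>det (J x)\<bar> * indicator (B n) x) \<partial>lborel)"
  proof (intro nn_integral_mono)
    fix x
    show "h (f x) * ennreal \<bar>det (J x)\<bar> \<le> (\<Sum>n. h (f x) * ennreal \<bar>det (J x)\<bar> * indicator (B n) x)"
    proof (cases "det (J x) = 0")
      case False
      hence "x \<in> (\<Union>n. B n)" using loc UB by auto
      then obtain n where n: "x \<in> B n" by blast
      have "sum (\<lambda>n. h (f x) * ennreal \<bar>det (J x)\<bar> * indicator (B n) x) {n} \<le>
          (\<Sum>n. h (f x) * ennreal \<bar>det (J x)\<bar> * indicator (B n) x)"
        by (intro sum_le_suminf summableI) auto
      thus ?thesis using n by simp
    qed simp
  qed
  also have "\<dots> = (\<Sum>n. \<integral>\<^sup>+x. h (f x) * ennreal \<bar>det (J x)\<bar> * indicator (B n) x \<partial>lborel)"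
    by (intro nn_integral_suminf) measurable
  also have "\<dots> = (\<Sum>n. \<integral>\<^sup>+y. h y * indicator (f ` B n) y \<partial>lborel)"
    unfolding Beq
    by (intro arg_cong[where f = suminf] ext nn_integral_change_of_variables V cl f J h)
       (use injB in \<open>simp add: Beq\<close>)
  also have "\<dots> = (\<integral>\<^sup>+y. (\<Sum>n. h y * indicator (f ` B n) y) \<partial>lborel)"
    by (intro nn_integral_suminf[symmetric]) measurable
  also have "\<dots> \<le> (\<integral>\<^sup>+y. h y * emeasure (count_space UNIV) {x. f x = y} \<partial>lborel)"
    by (intro nn_integral_mono) (auto intro!: mult_left_mono suminf_ind)
  finally show ?thesis .
qed

section \<open>Measurability of the number of zeros\<close>

lemma count_space_eq_SUP_finite:
  "emeasure (count_space UNIV) S = (SUP F\<in>{F. finite F \<and> F \<subseteq> S}. of_nat (card F))"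
proof (cases "finite S")
  case True
  have "(SUP F\<in>{F. finite F \<and> F \<subseteq> S}. of_nat (card F) :: ennreal) = of_nat (card S)"
    by (rule antisym, intro SUP_least) (use True in \<open>auto intro: card_mono SUP_upper2[of S]\<close>)
  thus ?thesis using True by simp
next
  case False
  have "of_nat n \<le> (SUP F\<in>{F. finite F \<and> F \<subseteq> S}. of_nat (card F) :: ennreal)" for n
  proof -
    obtain F where "finite F" "card F = n" "F \<subseteq> S"
      using infinite_arbitrarily_large[OF False] by blast
    thus ?thesis by (intro SUP_upper2[of F]) auto
  qed
  hence "(SUP n. of_nat n) \<le> (SUP F\<in>{F. finite F \<and> F \<subseteq> S}. of_nat (card F) :: ennreal)"
    by (intro SUP_least)
  hence "(SUP F\<in>{F. finite F \<and> F \<subseteq> S}. of_nat (card F) :: ennreal) = \<top>"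
    unfolding ennreal_SUP_of_nat_eq_top by (rule top_le)
  thus ?thesis using emeasure_count_space_infinite[OF subset_UNIV False] by (metis infinity_ennreal_def)
qed

text \<open>The uncountable existential becomes countable: the norm attains its infimum on
  \<open>K\<close>, so a zero exists iff the norm gets arbitrarily small along a countable dense
  subset.\<close>

lemma pred_Bex_zero_compact:
  fixes f :: "'w \<Rightarrow> 'a :: euclidean_space \<Rightarrow> 'b :: euclidean_space"
  assumes K: "compact K"
    and meas [measurable]: "\<And>x. (\<lambda>\<omega>. f \<omega> x) \<in> borel_measurable M"
    and cont: "\<And>\<omega>. \<omega> \<in> space M \<Longrightarrow> continuous_on UNIV (f \<omega>)"
  shows "Measurable.pred M (\<lambda>\<omega>. \<exists>x\<in>K. f \<omega> x = 0)"
proof -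
  obtain D where D: "countable D" "D \<subseteq> K" "K \<subseteq> closure D"
    using separable[of K] by metis
  have "(\<exists>x\<in>K. f \<omega> x = 0) \<longleftrightarrow> (\<forall>n. \<exists>x\<in>D. norm (f \<omega> x) < 1 / real (Suc n))" if "\<omega> \<in> space M" for \<omega>
  proof
    assume "\<exists>x\<in>K. f \<omega> x = 0"
    then obtain x where x: "x \<in> closure D" "f \<omega> x = 0" using D by auto
    show "\<forall>n. \<exists>x\<in>D. norm (f \<omega> x) < 1 / real (Suc n)"
    proof
      fix n
      have "isCont (f \<omega>) x" using cont[OF that] by (simp add: continuous_on_eq_continuous_at)
      then obtain d where "d > 0" "\<And>y. dist y x < d \<Longrightarrow> dist (f \<omega> y) (f \<omega> x) < 1 / real (Suc n)"
        unfolding continuous_at_eps_delta by (metis of_nat_0_less_iff zero_less_Suc zero_less_divide_1_iff)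
      moreover obtain y where "y \<in> D" "dist y x < d"
        using x(1) \<open>d > 0\<close> unfolding closure_approachable by blast
      ultimately show "\<exists>x\<in>D. norm (f \<omega> x) < 1 / real (Suc n)" using x(2) by (auto simp: dist_norm)
    qed
  next
    assume *: "\<forall>n. \<exists>x\<in>D. norm (f \<omega> x) < 1 / real (Suc n)"
    have contK: "continuous_on K (\<lambda>x. norm (f \<omega> x))"
      using continuous_on_subset[OF cont[OF that]] by (intro continuous_intros) auto
    have "K \<noteq> {}" using * D by blast
    then obtain x where x: "x \<in> K" "\<And>y. y \<in> K \<Longrightarrow> norm (f \<omega> x) \<le> norm (f \<omega> y)"
      using continuous_attains_inf[OF K _ contK] by blast
    have "norm (f \<omega> x) < 1 / real (Suc n)" for n
      using * x(2) D(2) by (meson order.strict_trans1 subsetD)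
    hence "norm (f \<omega> x) \<le> 0"
      by (metis nat_approx_posE not_le less_asym)
    thus "\<exists>x\<in>K. f \<omega> x = 0" using x(1) by auto
  qed
  moreover have "Measurable.pred M (\<lambda>\<omega>. \<forall>n. \<exists>x\<in>D. norm (f \<omega> x) < 1 / real (Suc n))"
    using D(1) by measurable
  ultimately show ?thesis
    by (simp cong: measurable_cong)
qed

text \<open>The number of zeros is the supremum, over the finite disjoint families taken from a
  countable stock of balls, of the number of balls that contain a zero. Splitting off the
  coefficients of one exponential by Fubini requires this measurability.\<close>

lemma borel_measurable_zero_count:
  fixes f :: "'w \<Rightarrow> 'a :: euclidean_space \<Rightarrow> 'b :: euclidean_space"
  assumes meas: "\<And>x. (\<lambda>\<omega>. f \<omega> x) \<in> borel_measurable M"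
    and cont: "\<And>\<omega>. \<omega> \<in> space M \<Longrightarrow> continuous_on UNIV (f \<omega>)"
  shows "(\<lambda>\<omega>. emeasure (count_space UNIV) {x. f \<omega> x = 0}) \<in> borel_measurable M"
proof -
  obtain Q :: "'a set" where Q: "countable Q" "\<And>U. open U \<Longrightarrow> U \<noteq> {} \<Longrightarrow> \<exists>q\<in>Q. q \<in> U"
    using countable_dense_setE[where 'a='a] by metis
  define \<K> where "\<K> = (\<lambda>(q, n). cball q (1 / real (Suc n))) ` (Q \<times> UNIV)"
  have cK: "countable \<K>" using Q(1) by (auto simp: \<K>_def)
  have compK: "compact K" if "K \<in> \<K>" for K using that by (auto simp: \<K>_def)
  have small: "\<exists>K\<in>\<K>. x \<in> K \<and> K \<subseteq> ball x e" if e: "e > 0" for x e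
  proof -
    obtain n where n: "1 / real (Suc n) < e / 2" using nat_approx_posE[of "e / 2"] e by auto
    obtain q where q: "q \<in> Q" "q \<in> ball x (1 / real (Suc n))"
      using Q(2)[of "ball x (1 / real (Suc n))"] by (auto simp del: of_nat_Suc)
    have "cball q (1 / real (Suc n)) \<subseteq> ball x e"
    proof
      fix y assume "y \<in> cball q (1 / real (Suc n))"
      thus "y \<in> ball x e" using dist_triangle[of x y q] q n by (simp add: dist_commute del: of_nat_Suc)
    qed
    moreover have "x \<in> cball q (1 / real (Suc n))" using q by (simp add: dist_commute less_imp_le)
    ultimately show ?thesis
      using q(1) by (intro bexI[of _ "cball q (1 / real (Suc n))"]) (auto simp: \<K>_def)
  qed
  define \<F> where "\<F> = {F. finite F \<and> F \<subseteq> \<K> \<and> disjoint F}"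
  have cF: "countable \<F>"
    by (rule countable_subset[OF _ countable_Collect_finite_subset[OF cK]]) (auto simp: \<F>_def)
  define N where "N \<omega> = (SUP F\<in>\<F>. \<Sum>K\<in>F. indicator {\<omega>. \<exists>x\<in>K. f \<omega> x = 0} \<omega> :: ennreal)" for \<omega>
  have "emeasure (count_space UNIV) {x. f \<omega> x = 0} = N \<omega>" for \<omega>
  proof (rule antisym)
    show "emeasure (count_space UNIV) {x. f \<omega> x = 0} \<le> N \<omega>"
      unfolding count_space_eq_SUP_finite
    proof (rule SUP_least)
      fix Z assume "Z \<in> {F. finite F \<and> F \<subseteq> {x. f \<omega> x = 0}}"
      hence Z: "finite Z" "\<And>z. z \<in> Z \<Longrightarrow> f \<omega> z = 0" by auto
      \<comment> \<open>Distinct points of a finite set are at least some \<open>e > 0\<close>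
        apart, so balls of the stock that stay within \<open>e / 2\<close> of them are
        disjoint.\<close>
      obtain e where e: "e > 0" "\<And>x y. x \<in> Z \<Longrightarrow> y \<in> Z \<Longrightarrow> dist x y < e \<Longrightarrow> x = y"
        using uniform_discrete_finite_iff[of Z] Z(1) unfolding uniform_discrete_def by metis
      have "\<forall>z. \<exists>K\<in>\<K>. z \<in> K \<and> K \<subseteq> ball z (e / 2)" using small e(1) by simp
      then obtain k where k: "\<And>z. k z \<in> \<K>" "\<And>z. z \<in> k z" "\<And>z. k z \<subseteq> ball z (e / 2)" by metis
      have disj: "k x \<inter> k y = {}" if "x \<in> Z" "y \<in> Z" "x \<noteq> y" for x y
      proof (rule ccontr)
        assume "k x \<inter> k y \<noteq> {}"
        then obtain w where "w \<in> ball x (e / 2)" "w \<in> ball y (e / 2)" using k(3) by blast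
        hence "dist x y < e" using dist_triangle_half_r[of w x e y] by (simp add: dist_commute)
        thus False using e(2) that by blast
      qed
      have inj: "inj_on k Z"
        using disj k(2) by (intro inj_onI) (metis disjoint_iff)
      have "disjoint (k ` Z)"
        unfolding disjoint_def using disj by auto
      hence kZ: "k ` Z \<in> \<F>"
        using k(1) Z(1) by (auto simp: \<F>_def)
      have "of_nat (card Z) = (\<Sum>K\<in>k ` Z. indicator {\<omega>. \<exists>x\<in>K. f \<omega> x = 0} \<omega> :: ennreal)"
      proof -
        have "indicator {\<omega>. \<exists>x\<in>k z. f \<omega> x = 0} \<omega> = (1 :: ennreal)" if "z \<in> Z" for z
          using Z(2)[OF that] k(2)[of z] by (auto simp: indicator_def)
        thus ?thesis by (subst sum.reindex[OF inj]) simp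
      qed
      also have "\<dots> \<le> N \<omega>"
        unfolding N_def by (rule SUP_upper[OF kZ])
      finally show "of_nat (card Z) \<le> N \<omega>" .
    qed
    show "N \<omega> \<le> emeasure (count_space UNIV) {x. f \<omega> x = 0}"
      unfolding N_def
    proof (rule SUP_least)
      fix F assume F: "F \<in> \<F>"
      define F0 where "F0 = {K \<in> F. \<exists>x\<in>K. f \<omega> x = 0}"
      have fin: "finite F" "finite F0" and dis: "disjoint F" using F by (auto simp: \<F>_def F0_def)
      have "\<forall>K\<in>F0. \<exists>x\<in>K. f \<omega> x = 0" by (auto simp: F0_def)
      then obtain g where g: "\<And>K. K \<in> F0 \<Longrightarrow> g K \<in> K" "\<And>K. K \<in> F0 \<Longrightarrow> f \<omega> (g K) = 0" by metis
      have inj: "inj_on g F0"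
      proof (intro inj_onI)
        fix K L assume KL: "K \<in> F0" "L \<in> F0" "g K = g L"
        hence "g K \<in> K \<inter> L" using g(1) by (metis IntI)
        thus "K = L" using dis KL by (auto simp: F0_def disjoint_def)
      qed
      have "(\<Sum>K\<in>F. indicator {\<omega>. \<exists>x\<in>K. f \<omega> x = 0} \<omega> :: ennreal) = (\<Sum>K\<in>F0. 1)"
        unfolding F0_def using fin(1) by (intro sum.mono_neutral_cong_right) (auto simp: indicator_def)
      also have "\<dots> = of_nat (card (g ` F0))" using inj by (simp add: card_image)
      also have "\<dots> \<le> emeasure (count_space UNIV) {x. f \<omega> x = 0}"
        unfolding count_space_eq_SUP_finite using fin g by (intro SUP_upper) auto
      finally show "(\<Sum>K\<in>F. indicator {\<omega>. \<exists>x\<in>K. f \<omega> x = 0} \<omega>) \<le> emeasure (count_space UNIV) {x. f \<omega> x = 0}" .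
    qed
  qed
  moreover have "N \<in> borel_measurable M"
    unfolding N_def
  proof (intro borel_measurable_SUP cF borel_measurable_sum)
    fix F K assume "F \<in> \<F>" "K \<in> F"
    hence "compact K" using compK by (auto simp: \<F>_def)
    hence "Measurable.pred M (\<lambda>\<omega>. \<exists>x\<in>K. f \<omega> x = 0)"
      by (rule pred_Bex_zero_compact[OF _ meas cont])
    thus "indicator {\<omega>. \<exists>x\<in>K. f \<omega> x = 0} \<in> borel_measurable M"
      by (intro borel_measurable_indicator') simp_all
  qed
  ultimately show ?thesis by simp
qed

section \<open>Independent normal families\<close>

lemma product_sigma_finite_std_normal: "product_sigma_finite (\<lambda>_. std_normal)"
  by (intro product_sigma_finite.intro prob_space_imp_sigma_finite prob_space_std_normal)

lemma nn_integral_lborel_prod_cart: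
  fixes f :: "'n::finite \<Rightarrow> real \<Rightarrow> ennreal"
  assumes [measurable]: "\<And>i. f i \<in> borel_measurable borel"
  shows "(\<integral>\<^sup>+x. (\<Prod>i\<in>UNIV. f i (x $ i)) \<partial>(lborel :: (real ^ 'n) measure)) = (\<Prod>i\<in>UNIV. \<integral>\<^sup>+t. f i t \<partial>lborel)"
proof -
  define g where "g = (\<lambda>b :: real ^ 'n. f (axis_index b))"
  have g: "g (axis i 1) = f i" for i by (simp add: g_def axis_index_axis)
  have "(\<integral>\<^sup>+x. (\<Prod>b\<in>Basis. g b (x \<bullet> b)) \<partial>lborel) = (\<Prod>b\<in>Basis. \<integral>\<^sup>+t. g b t \<partial>lborel)"
    by (rule nn_integral_lborel_prod) (auto simp: g_def)
  thus ?thesis by (simp add: Basis_prod_cart g inner_axis)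
qed

text \<open>The column of the coefficients of \<open>b\<close>, one for each equation, is read as a
  point \<open>y\<close> of \<open>real ^ 'n\<close> with a Lebesgue density; in this form the area
  formula can be applied to it.\<close>

lemma PiM_std_normal_eq_distr_lborel:
  "Pi\<^sub>M (UNIV \<times> {b}) (\<lambda>_. std_normal) =
    distr (density lborel (\<lambda>y :: real ^ 'n. \<Prod>i\<in>UNIV. ennreal (std_normal_density (y $ i))))
      (Pi\<^sub>M (UNIV \<times> {b}) (\<lambda>_. borel)) (\<lambda>y. \<lambda>p\<in>UNIV \<times> {b}. y $ fst p)"
  (is "_ = ?D")
proof -
  interpret product_sigma_finite "\<lambda>_. std_normal" by (rule product_sigma_finite_std_normal)
  have nth [measurable]: "(\<lambda>y :: real ^ 'n. y $ i) \<in> borel_measurable borel" for i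
    by (intro borel_measurable_continuous_onI continuous_intros)
  have m: "(\<lambda>y :: real ^ 'n. \<lambda>p\<in>UNIV \<times> {b}. y $ fst p) \<in> measurable borel (Pi\<^sub>M (UNIV \<times> {b}) (\<lambda>_. borel))"
    by (intro measurable_restrict nth)
  show ?thesis
  proof (rule PiM_eqI[symmetric])
    show "sets ?D =
      sets (Pi\<^sub>M (UNIV \<times> {b}) (\<lambda>_. std_normal))"
      unfolding sets_distr by (intro sets_PiM_cong) auto
    fix E :: "'n \<times> 'a \<Rightarrow> real set"
    assume "\<And>p. p \<in> UNIV \<times> {b} \<Longrightarrow> E p \<in> sets std_normal"
    hence E [measurable]: "E (i, b) \<in> sets borel" for i by auto
    have PE: "Pi\<^sub>E (UNIV \<times> {b}) E \<in> sets (Pi\<^sub>M (UNIV \<times> {b}) (\<lambda>_. borel))"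
      by (intro sets_PiM_I_finite) (use E in auto)
    have "emeasure ?D (Pi\<^sub>E (UNIV \<times> {b}) E) =
      (\<integral>\<^sup>+y. (\<Prod>i\<in>UNIV. ennreal (std_normal_density (y $ i))) *
        indicator ((\<lambda>y. \<lambda>p\<in>UNIV \<times> {b}. y $ fst p) -` Pi\<^sub>E (UNIV \<times> {b}) E) y \<partial>(lborel :: (real ^ 'n) measure))"
      using PE m measurable_sets[OF m PE] by (subst emeasure_distr) (auto simp: emeasure_density)
    also have "\<dots> = (\<integral>\<^sup>+y. (\<Prod>i\<in>UNIV. ennreal (std_normal_density (y $ i)) * indicator (E (i, b)) (y $ i)) \<partial>(lborel :: (real ^ 'n) measure))"
    proof (intro nn_integral_cong)
      fix y :: "real ^ 'n"
      have "indicator ((\<lambda>y :: real ^ 'n. \<lambda>p\<in>UNIV \<times> {b}. y $ fst p) -` Pi\<^sub>E (UNIV \<times> {b}) E) y =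
          (\<Prod>i\<in>UNIV. indicator (E (i, b)) (y $ i) :: ennreal)"
        by (auto simp: indicator_def PiE_iff prod_zero_iff)
      thus "(\<Prod>i\<in>UNIV. ennreal (std_normal_density (y $ i))) *
          indicator ((\<lambda>y. \<lambda>p\<in>UNIV \<times> {b}. y $ fst p) -` Pi\<^sub>E (UNIV \<times> {b}) E) y =
        (\<Prod>i\<in>UNIV. ennreal (std_normal_density (y $ i)) * indicator (E (i, b)) (y $ i))"
        by (simp add: prod.distrib)
    qed
    also have "\<dots> = (\<Prod>i\<in>UNIV. \<integral>\<^sup>+t. ennreal (std_normal_density t) * indicator (E (i, b)) t \<partial>lborel)"
      by (rule nn_integral_lborel_prod_cart) measurable
    also have "\<dots> = (\<Prod>i\<in>UNIV. emeasure std_normal (E (i, b)))"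
      by (simp add: emeasure_density)
    also have "\<dots> = (\<Prod>p\<in>UNIV \<times> {b}. emeasure std_normal (E p))"
      using prod.cartesian_product[of "\<lambda>i a. emeasure std_normal (E (i, a))" "{b}" UNIV] by simp
    finally show "emeasure ?D (Pi\<^sub>E (UNIV \<times> {b}) E) =
      (\<Prod>p\<in>UNIV \<times> {b}. emeasure std_normal (E p))" .
  qed simp
qed

locale iid_std_normal = prob_space M for M :: "'w measure" +
  fixes A :: "'a set" and \<xi> :: "'a \<Rightarrow> 'w \<Rightarrow> real"
  assumes finite_A: "finite A" and nonempty_A: "A \<noteq> {}"
    and indep: "indep_vars (\<lambda>_. borel) \<xi> A"
    and normal: "\<And>a. a \<in> A \<Longrightarrow> distributed M lborel (\<xi> a) std_normal_density"
begin

lemma iid_std_normal_subset: "B \<subseteq> A \<Longrightarrow> B \<noteq> {} \<Longrightarrow> iid_std_normal M B \<xi>"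
  using finite_A indep normal by unfold_locales (auto intro: finite_subset indep_vars_subset)

lemma random_variable_\<xi> [measurable]: "a \<in> A \<Longrightarrow> random_variable borel (\<xi> a)"
  using indep by (auto simp: indep_vars_def)

lemma distr_\<xi>: "a \<in> A \<Longrightarrow> distr M borel (\<xi> a) = std_normal"
  using normal[of a] by (simp add: distributed_def cong: distr_cong)

lemma measurable_restrict_\<xi>: "(\<lambda>\<omega>. \<lambda>a\<in>A. \<xi> a \<omega>) \<in> measurable M (Pi\<^sub>M A (\<lambda>_. borel))"
  by (intro measurable_restrict random_variable_\<xi>)

lemma distr_restrict_\<xi>: "distr M (Pi\<^sub>M A (\<lambda>_. borel)) (\<lambda>\<omega>. \<lambda>a\<in>A. \<xi> a \<omega>) = Pi\<^sub>M A (\<lambda>_. std_normal)"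
proof -
  have "distr M (Pi\<^sub>M A (\<lambda>_. borel)) (\<lambda>\<omega>. \<lambda>a\<in>A. \<xi> a \<omega>) = Pi\<^sub>M A (\<lambda>a. distr M borel (\<xi> a))"
    using indep indep_vars_iff_distr_eq_PiM'[OF nonempty_A, where M' = "\<lambda>_. borel" and X = \<xi>] by simp
  also have "\<dots> = Pi\<^sub>M A (\<lambda>_. std_normal)"
    by (intro PiM_cong refl distr_\<xi>)
  finally show ?thesis .
qed

lemma nn_integral_abs_sum_density:
  fixes p q :: "'a \<Rightarrow> real"
  defines "Q \<equiv> 1 + (\<Sum>a\<in>A. (q a)\<^sup>2)"
  shows "(\<integral>\<^sup>+\<omega>. ennreal (std_normal_density (\<Sum>a\<in>A. \<xi> a \<omega> * q a)) * ennreal \<bar>\<Sum>a\<in>A. \<xi> a \<omega> * p a\<bar> \<partial>M) =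
    ennreal (sqrt ((\<Sum>a\<in>A. (p a)\<^sup>2) * Q - (\<Sum>a\<in>A. p a * q a)\<^sup>2) / (pi * Q))"
proof -
  have [measurable]: "(\<lambda>x. \<Sum>a\<in>A. x a * f a) \<in> borel_measurable (Pi\<^sub>M A (\<lambda>_. borel))" for f :: "'a \<Rightarrow> real"
    by measurable
  have "(\<integral>\<^sup>+\<omega>. ennreal (std_normal_density (\<Sum>a\<in>A. \<xi> a \<omega> * q a)) * ennreal \<bar>\<Sum>a\<in>A. \<xi> a \<omega> * p a\<bar> \<partial>M) =
      (\<integral>\<^sup>+x. ennreal (std_normal_density (\<Sum>a\<in>A. x a * q a)) * ennreal \<bar>\<Sum>a\<in>A. x a * p a\<bar>
        \<partial>distr M (Pi\<^sub>M A (\<lambda>_. borel)) (\<lambda>\<omega>. \<lambda>a\<in>A. \<xi> a \<omega>))"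
    using measurable_restrict_\<xi> by (subst nn_integral_distr) auto
  also have "\<dots> = ennreal (sqrt ((\<Sum>a\<in>A. (p a)\<^sup>2) * Q - (\<Sum>a\<in>A. p a * q a)\<^sup>2) / (pi * Q))"
    unfolding distr_restrict_\<xi> Q_def by (rule nn_integral_PiM_std_normal_abs_density[OF finite_A])
  finally show ?thesis .
qed

lemma measurable_all_\<xi>:
  "(\<lambda>\<omega>. \<lambda>p\<in>UNIV \<times> A. \<xi> (snd p) (\<omega> (fst p))) \<in>
    measurable (Pi\<^sub>M (UNIV :: 'i::finite set) (\<lambda>_. M)) (Pi\<^sub>M (UNIV \<times> A) (\<lambda>_. borel))"
proof (rule measurable_restrict)
  fix p :: "'i \<times> 'a" assume "p \<in> UNIV \<times> A"
  hence "\<xi> (snd p) \<in> borel_measurable M" by (intro random_variable_\<xi>) auto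
  thus "(\<lambda>\<omega>. \<xi> (snd p) (\<omega> (fst p))) \<in> borel_measurable (Pi\<^sub>M (UNIV :: 'i set) (\<lambda>_. M))"
    by (rule measurable_compose[OF measurable_component_singleton, rotated]) simp
qed

text \<open>The underlying probability space is arbitrary. Through this joint law, indexed by pairs
  of an equation and a point of \<open>A\<close>, integrals move to a concrete product of normal
  laws.\<close>

lemma distr_all_\<xi>:
  "distr (Pi\<^sub>M (UNIV :: 'i::finite set) (\<lambda>_. M)) (Pi\<^sub>M (UNIV \<times> A) (\<lambda>_. borel))
      (\<lambda>\<omega>. \<lambda>p\<in>UNIV \<times> A. \<xi> (snd p) (\<omega> (fst p))) = Pi\<^sub>M (UNIV \<times> A) (\<lambda>_. std_normal)"
  (is "?D = _")
proof -
  interpret G: product_sigma_finite "\<lambda>_. std_normal" by (rule product_sigma_finite_std_normal)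
  interpret M: product_prob_space "\<lambda>_ :: 'i. M" by unfold_locales
  show ?thesis
  proof (rule G.PiM_eqI)
    show "finite ((UNIV :: 'i set) \<times> A)" using finite_A by simp
    show "sets ?D = sets (Pi\<^sub>M (UNIV \<times> A) (\<lambda>_. std_normal))"
      unfolding sets_distr by (intro sets_PiM_cong) auto
    fix E :: "'i \<times> 'a \<Rightarrow> real set"
    assume "\<And>p. p \<in> UNIV \<times> A \<Longrightarrow> E p \<in> sets std_normal"
    hence E: "E (i, a) \<in> sets borel" if "a \<in> A" for i a using that by auto
    have PE: "Pi\<^sub>E (UNIV \<times> A) E \<in> sets (Pi\<^sub>M (UNIV \<times> A) (\<lambda>_. borel))"
      using finite_A E by (intro sets_PiM_I_finite) auto
    have PEi: "Pi\<^sub>E A (\<lambda>a. E (i, a)) \<in> sets (Pi\<^sub>M A (\<lambda>_. borel))" for i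
      using finite_A E by (intro sets_PiM_I_finite) auto
    define F where "F i = (\<lambda>\<omega>. \<lambda>a\<in>A. \<xi> a \<omega>) -` Pi\<^sub>E A (\<lambda>a. E (i, a)) \<inter> space M" for i
    have F: "F i \<in> sets M" for i
      unfolding F_def by (rule measurable_sets[OF measurable_restrict_\<xi> PEi])
    have "(\<lambda>\<omega>. \<lambda>p\<in>UNIV \<times> A. \<xi> (snd p) (\<omega> (fst p))) -` Pi\<^sub>E (UNIV \<times> A) E \<inter> space (Pi\<^sub>M (UNIV :: 'i set) (\<lambda>_. M)) = Pi\<^sub>E UNIV F"
      by (auto simp: F_def space_PiM PiE_iff)
    hence "emeasure ?D (Pi\<^sub>E (UNIV \<times> A) E) = (\<Prod>i\<in>UNIV. emeasure M (F i))"
      using PE F by (simp add: emeasure_distr measurable_all_\<xi> M.emeasure_PiM)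
    also have "\<dots> = (\<Prod>i\<in>UNIV. \<Prod>a\<in>A. emeasure std_normal (E (i, a)))"
    proof (intro prod.cong refl)
      fix i
      have "emeasure M (F i) = emeasure (distr M (Pi\<^sub>M A (\<lambda>_. borel)) (\<lambda>\<omega>. \<lambda>a\<in>A. \<xi> a \<omega>)) (Pi\<^sub>E A (\<lambda>a. E (i, a)))"
        unfolding F_def by (rule emeasure_distr[OF measurable_restrict_\<xi> PEi, symmetric])
      also have "\<dots> = (\<Prod>a\<in>A. emeasure std_normal (E (i, a)))"
        unfolding distr_restrict_\<xi> using finite_A E by (intro G.emeasure_PiM) auto
      finally show "emeasure M (F i) = (\<Prod>a\<in>A. emeasure std_normal (E (i, a)))" .
    qed
    also have "\<dots> = (\<Prod>p\<in>UNIV \<times> A. emeasure std_normal (E p))"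
      by (simp add: prod.cartesian_product)
    finally show "emeasure ?D (Pi\<^sub>E (UNIV \<times> A) E) =
      (\<Prod>p\<in>UNIV \<times> A. emeasure std_normal (E p))" .
  qed
qed

text \<open>This is conditioning on all coefficients other than those of \<open>b\<close>. They stay
  functions of \<open>\<omega>\<close> on the abstract space, while those of \<open>b\<close> are
  replaced by the explicit variable \<open>y\<close>. \<open>A - {b}\<close> has to be nonempty for
  the locale to apply to it.\<close>

lemma nn_integral_split_coordinate:
  fixes g :: "('n::finite \<times> 'a \<Rightarrow> real) \<Rightarrow> ennreal"
  assumes b: "b \<in> A" "A - {b} \<noteq> {}" and g: "g \<in> borel_measurable (Pi\<^sub>M (UNIV \<times> A) (\<lambda>_. borel))"
  shows "(\<integral>\<^sup>+\<omega>. g (\<lambda>p\<in>UNIV \<times> A. \<xi> (snd p) (\<omega> (fst p))) \<partial>Pi\<^sub>M UNIV (\<lambda>_. M)) =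
    (\<integral>\<^sup>+\<omega>. \<integral>\<^sup>+y. (\<Prod>i\<in>UNIV. ennreal (std_normal_density (y $ i))) *
        g (\<lambda>p\<in>UNIV \<times> A. if snd p = b then y $ fst p else \<xi> (snd p) (\<omega> (fst p)))
      \<partial>(lborel :: (real ^ 'n) measure) \<partial>Pi\<^sub>M UNIV (\<lambda>_. M))"
proof -
  interpret G: product_sigma_finite "\<lambda>_. std_normal" by (rule product_sigma_finite_std_normal)
  interpret B: iid_std_normal M "A - {b}" \<xi> using b by (intro iid_std_normal_subset) auto
  let ?I = "(UNIV :: 'n set) \<times> (A - {b})" and ?J = "(UNIV :: 'n set) \<times> {b}"
  have IJ: "UNIV \<times> A = ?I \<union> ?J" using b by auto
  have sets_eq: "sets (Pi\<^sub>M S (\<lambda>_. std_normal)) = sets (Pi\<^sub>M S (\<lambda>_. borel))" for S :: "('n \<times> 'a) set"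
    by (intro sets_PiM_cong) auto
  have g': "g \<in> borel_measurable (Pi\<^sub>M (?I \<union> ?J) (\<lambda>_. std_normal))"
    using g unfolding IJ[symmetric] by (simp add: measurable_cong_sets[OF sets_eq refl])
  have gm: "(\<lambda>(x, z). g (merge ?I ?J (x, z))) \<in> borel_measurable (Pi\<^sub>M ?I (\<lambda>_. borel) \<Otimes>\<^sub>M Pi\<^sub>M ?J (\<lambda>_. borel))"
    using measurable_compose[OF measurable_merge g[unfolded IJ]] by (simp add: case_prod_beta')
  have nth [measurable]: "(\<lambda>y :: real ^ 'n. y $ i) \<in> borel_measurable borel" for i
    by (intro borel_measurable_continuous_onI continuous_intros)
  have vm: "(\<lambda>y :: real ^ 'n. \<lambda>p\<in>?J. y $ fst p) \<in> measurable borel (Pi\<^sub>M ?J (\<lambda>_. borel))"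
    by (intro measurable_restrict nth)
  have sf: "sigma_finite_measure (Pi\<^sub>M ?J (\<lambda>_. std_normal))"
    by (rule G.sigma_finite) simp
  have "(\<integral>\<^sup>+\<omega>. g (\<lambda>p\<in>UNIV \<times> A. \<xi> (snd p) (\<omega> (fst p))) \<partial>Pi\<^sub>M UNIV (\<lambda>_. M)) =
      (\<integral>\<^sup>+x. g x \<partial>Pi\<^sub>M (UNIV \<times> A) (\<lambda>_. std_normal))"
    unfolding distr_all_\<xi>[symmetric] using measurable_all_\<xi> g by (subst nn_integral_distr) auto
  also have "\<dots> = (\<integral>\<^sup>+x. \<integral>\<^sup>+z. g (merge ?I ?J (x, z)) \<partial>Pi\<^sub>M ?J (\<lambda>_. std_normal) \<partial>Pi\<^sub>M ?I (\<lambda>_. std_normal))"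
    unfolding IJ by (rule G.product_nn_integral_fold) (use finite_A g' in auto)
  also have "\<dots> = (\<integral>\<^sup>+\<omega>. \<integral>\<^sup>+z. g (merge ?I ?J (\<lambda>p\<in>?I. \<xi> (snd p) (\<omega> (fst p)), z)) \<partial>Pi\<^sub>M ?J (\<lambda>_. std_normal) \<partial>Pi\<^sub>M UNIV (\<lambda>_. M))"
  proof -
    have "(\<lambda>x. \<integral>\<^sup>+z. g (merge ?I ?J (x, z)) \<partial>Pi\<^sub>M ?J (\<lambda>_. std_normal)) \<in> borel_measurable (Pi\<^sub>M ?I (\<lambda>_. borel))"
      using gm by (intro sigma_finite_measure.borel_measurable_nn_integral[OF sf])
        (simp only: measurable_cong_sets[OF sets_pair_measure_cong[OF refl sets_eq] refl])
    thus ?thesis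
      unfolding B.distr_all_\<xi>[symmetric] using B.measurable_all_\<xi> by (subst nn_integral_distr) auto
  qed
  also have "\<dots> = (\<integral>\<^sup>+\<omega>. \<integral>\<^sup>+y. (\<Prod>i\<in>UNIV. ennreal (std_normal_density (y $ i))) *
        g (\<lambda>p\<in>UNIV \<times> A. if snd p = b then y $ fst p else \<xi> (snd p) (\<omega> (fst p)))
      \<partial>(lborel :: (real ^ 'n) measure) \<partial>Pi\<^sub>M UNIV (\<lambda>_. M))"
  proof (intro nn_integral_cong)
    fix \<omega> assume \<omega>: "\<omega> \<in> space (Pi\<^sub>M (UNIV :: 'n set) (\<lambda>_. M))"
    have x: "(\<lambda>p\<in>?I. \<xi> (snd p) (\<omega> (fst p))) \<in> space (Pi\<^sub>M ?I (\<lambda>_. borel))"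
      by (simp add: space_PiM)
    have gz [measurable]: "(\<lambda>z. g (merge ?I ?J (\<lambda>p\<in>?I. \<xi> (snd p) (\<omega> (fst p)), z))) \<in> borel_measurable (Pi\<^sub>M ?J (\<lambda>_. borel))"
      using measurable_Pair2[OF gm x] by simp
    have eq: "merge ?I ?J (\<lambda>p\<in>?I. \<xi> (snd p) (\<omega> (fst p)), \<lambda>p\<in>?J. y $ fst p) =
        (\<lambda>p\<in>UNIV \<times> A. if snd p = b then y $ fst p else \<xi> (snd p) (\<omega> (fst p)))" for y :: "real ^ 'n"
      using b by (auto simp: merge_def fun_eq_iff)
    show "(\<integral>\<^sup>+z. g (merge ?I ?J (\<lambda>p\<in>?I. \<xi> (snd p) (\<omega> (fst p)), z)) \<partial>Pi\<^sub>M ?J (\<lambda>_. std_normal)) =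
      (\<integral>\<^sup>+y. (\<Prod>i\<in>UNIV. ennreal (std_normal_density (y $ i))) *
        g (\<lambda>p\<in>UNIV \<times> A. if snd p = b then y $ fst p else \<xi> (snd p) (\<omega> (fst p))) \<partial>(lborel :: (real ^ 'n) measure))"
      unfolding PiM_std_normal_eq_distr_lborel eq[symmetric]
      using vm gz measurable_compose[OF vm gz]
      by (subst nn_integral_distr) (auto simp: nn_integral_density)
  qed
  finally show ?thesis .
qed

end

section \<open>The expected determinant of a normal matrix\<close>

abbreviation std_normal_vec :: "('n::finite \<Rightarrow> real) measure" where
  "std_normal_vec \<equiv> Pi\<^sub>M UNIV (\<lambda>_. std_normal)"

text \<open>It is never evaluated; only the lower bound \<open>expected_abs_det_ge\<close> is used.
  The extended value spares a proof of finiteness.\<close>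

definition expected_abs_det :: "'n::finite itself \<Rightarrow> ennreal" where
  "expected_abs_det _ =
    (\<integral>\<^sup>+\<omega>. ennreal \<bar>det (\<chi> i j. \<omega> i j :: real ^ 'n ^ 'n)\<bar> \<partial>Pi\<^sub>M (UNIV :: 'n set) (\<lambda>_. std_normal_vec :: ('n \<Rightarrow> real) measure))"

lemma prob_space_std_normal_vec: "prob_space (std_normal_vec)"
  by (intro prob_space_PiM prob_space_std_normal)

lemma borel_measurable_vec_lambda [measurable (raw)]:
  fixes f :: "'n::finite \<Rightarrow> 'a \<Rightarrow> real"
  assumes "\<And>i. f i \<in> borel_measurable M"
  shows "(\<lambda>x. \<chi> i. f i x) \<in> borel_measurable M"
  using assms by (subst borel_measurable_euclidean_space) (auto simp: Basis_vec_def inner_axis)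

lemma borel_measurable_vec_nth [measurable (raw)]:
  fixes f :: "'a \<Rightarrow> real ^ 'n"
  assumes "f \<in> borel_measurable M"
  shows "(\<lambda>x. f x $ i) \<in> borel_measurable M"
proof -
  have "(\<lambda>v :: real ^ 'n. v $ i) \<in> borel_measurable borel"
    by (intro borel_measurable_continuous_onI continuous_intros)
  from measurable_compose[OF assms this] show ?thesis .
qed

lemma borel_measurable_matrix_vector [measurable (raw)]:
  fixes L :: "real ^ 'n ^ 'm"
  assumes "f \<in> borel_measurable M"
  shows "(\<lambda>x. L *v f x) \<in> borel_measurable M"
proof -
  have "(\<lambda>v. L *v v) \<in> borel_measurable borel"
    by (intro borel_measurable_continuous_onI linear_continuous_on) simp
  from measurable_compose[OF assms this] show ?thesis .
qed

lemma measurable_std_normal_vec_nth: "(\<lambda>v. v j) \<in> borel_measurable std_normal_vec"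
  by measurable

lemma measurable_vec_lambda_std_normal_vec: "vec_lambda \<in> borel_measurable std_normal_vec"
  using borel_measurable_vec_lambda[OF measurable_std_normal_vec_nth] by simp

lemma measurable_matrix_entry [measurable]:
  "(\<lambda>\<omega>. \<omega> i j) \<in> borel_measurable (Pi\<^sub>M (UNIV :: 'n::finite set) (\<lambda>_. std_normal_vec :: ('m::finite \<Rightarrow> real) measure))"
proof -
  have "(\<lambda>\<omega>. \<omega> i) \<in> measurable (Pi\<^sub>M (UNIV :: 'n set) (\<lambda>_. std_normal_vec :: ('m \<Rightarrow> real) measure)) std_normal_vec"
    by (rule measurable_component_singleton) simp
  thus ?thesis by (rule measurable_compose[OF _ measurable_std_normal_vec_nth])
qed

text \<open>The case \<open>q = 0\<close> of the closed form, where \<open>Q = 1\<close>. The factor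
  \<open>std_normal_density 0\<close> is the weight of such a row in the comparisons.\<close>

lemma nn_integral_std_normal_vec_linear:
  fixes L :: "real ^ 'n ^ 'n"
  shows "(\<integral>\<^sup>+v. ennreal (std_normal_density 0) * ennreal \<bar>(L *v (\<chi> j. v j)) \<bullet> c\<bar> \<partial>(std_normal_vec :: ('n \<Rightarrow> real) measure)) =
    ennreal (norm (transpose L *v c) / pi)"
proof -
  have "(L *v (\<chi> j. v j)) \<bullet> c = (\<Sum>j\<in>UNIV. v j * (transpose L *v c) $ j)" for v
  proof -
    have "(L *v (\<chi> j. v j)) \<bullet> c = (\<chi> j. v j) \<bullet> (transpose L *v c)"
      by (metis dot_lmul_matrix inner_commute transpose_matrix_vector)
    thus ?thesis by (simp only: inner_vec_def vec_lambda_beta inner_real_def)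
  qed
  moreover have "sqrt (\<Sum>j\<in>UNIV. ((transpose L *v c) $ j)\<^sup>2) = norm (transpose L *v c)"
    by (simp add: norm_vec_def L2_set_def)
  ultimately show ?thesis
    using nn_integral_PiM_std_normal_abs_density[of "UNIV :: 'n set" "\<lambda>_. 0" "\<lambda>j. (transpose L *v c) $ j"]
    by simp
qed

lemma nn_integral_std_normal_vec_weighted:
  fixes z c :: "real ^ 'n"
  defines "S \<equiv> 1 + (norm z)\<^sup>2"
  shows "(\<integral>\<^sup>+v. ennreal (std_normal_density ((\<chi> j. v j) \<bullet> z)) * ennreal \<bar>(\<chi> j. v j) \<bullet> c\<bar> \<partial>(std_normal_vec :: ('n \<Rightarrow> real) measure)) =
    ennreal (sqrt ((norm c)\<^sup>2 * S - (c \<bullet> z)\<^sup>2) / (pi * S))"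
proof -
  have 1: "(\<chi> j. v j) \<bullet> x = (\<Sum>j\<in>UNIV. v j * x $ j)" for v and x :: "real ^ 'n"
    by (simp add: inner_vec_def)
  have 2: "(\<Sum>j\<in>UNIV. (x $ j)\<^sup>2) = (norm x)\<^sup>2" for x :: "real ^ 'n"
    by (simp add: norm_vec_def L2_set_def sum_nonneg)
  have 3: "(\<Sum>j\<in>UNIV. c $ j * z $ j) = c \<bullet> z"
    by (simp add: inner_vec_def)
  show ?thesis
    using nn_integral_PiM_std_normal_abs_density[of "UNIV :: 'n set" "\<lambda>j. z $ j" "\<lambda>j. c $ j"]
    unfolding 1 2 3 S_def by simp
qed

text \<open>The rows form the product of the normal matrix with \<open>transpose L\<close>.\<close>

lemma nn_integral_abs_det_linear_rows:
  fixes L :: "real ^ 'n ^ 'n"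
  shows "(\<integral>\<^sup>+\<omega>. ennreal \<bar>det (\<chi> i. L *v (\<chi> j. \<omega> i j))\<bar> \<partial>Pi\<^sub>M (UNIV :: 'n set) (\<lambda>_. std_normal_vec :: ('n \<Rightarrow> real) measure)) =
    ennreal \<bar>det L\<bar> * expected_abs_det TYPE('n)"
proof -
  have "(\<chi> i. L *v (\<chi> j. \<omega> i j)) = (\<chi> i j. \<omega> i j) ** transpose L" for \<omega> :: "'n \<Rightarrow> 'n \<Rightarrow> real"
    by (simp add: vec_eq_iff matrix_vector_mult_def matrix_matrix_mult_def transpose_def mult.commute)
  hence "det (\<chi> i. L *v (\<chi> j. \<omega> i j)) = det L * det (\<chi> i j. \<omega> i j)" for \<omega> :: "'n \<Rightarrow> 'n \<Rightarrow> real"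
    by (simp add: det_mul)
  moreover have "(\<lambda>\<omega>. det (\<chi> i j. \<omega> i j :: real ^ 'n ^ 'n)) \<in> borel_measurable (Pi\<^sub>M (UNIV :: 'n set) (\<lambda>_. std_normal_vec :: ('n \<Rightarrow> real) measure))"
    unfolding det_def vec_lambda_beta by measurable
  ultimately show ?thesis
    by (simp add: expected_abs_det_def abs_mult ennreal_mult' nn_integral_cmult)
qed

text \<open>\<open>L L^T\<close> is the matrix \<open>I - z z^T / S\<close>. Since
  \<open>1 - (norm z)\<^sup>2 / S = 1 / S\<close>, it has eigenvalue \<open>1 / S\<close> along
  \<open>z\<close> and 1 across. Accordingly \<open>L\<close> is a diagonal matrix followed by an
  orthogonal map that takes a coordinate axis to the direction of \<open>z\<close>.\<close>

lemma matrix_sqrt_rank_one_update: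
  fixes z :: "real ^ 'n"
  defines "S \<equiv> 1 + (norm z)\<^sup>2"
  obtains L :: "real ^ 'n ^ 'n" where "\<And>c. (norm (transpose L *v c))\<^sup>2 = (norm c)\<^sup>2 - (c \<bullet> z)\<^sup>2 / S" "\<bar>det L\<bar> = 1 / sqrt S"
proof -
  have S: "S > 0" by (simp add: S_def add_pos_nonneg)
  obtain k :: 'n where True by simp
  obtain f :: "real ^ 'n \<Rightarrow> real ^ 'n" where f: "orthogonal_transformation f" "f (norm z *\<^sub>R axis k 1) = z"
    using orthogonal_transformation_exists[of "norm z *\<^sub>R axis k 1" z] by auto
  define R where "R = matrix f"
  have R: "orthogonal_matrix R" and lin: "linear f"
    using f(1) by (auto simp: R_def orthogonal_transformation_matrix)
  have Rv: "R *v x = f x" for x using lin by (simp add: R_def)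
  define d where "d i = (if i = k then 1 / sqrt S else 1)" for i
  define E where "E = (\<chi> i j. if i = j then d i else 0)"
  define L where "L = R ** E"
  have detE: "det E = 1 / sqrt S"
  proof -
    have "det E = (\<Prod>i\<in>UNIV. E $ i $ i)" by (rule det_diagonal) (simp add: E_def)
    also have "\<dots> = (\<Prod>i\<in>UNIV. d i)" by (simp add: E_def)
    also have "\<dots> = 1 / sqrt S" by (simp add: d_def)
    finally show ?thesis .
  qed
  have "\<bar>det R\<bar> = 1" using det_orthogonal_matrix[OF R] by auto
  hence detL: "\<bar>det L\<bar> = 1 / sqrt S"
    using S by (simp add: L_def det_mul abs_mult detE)
  have "(norm (transpose L *v c))\<^sup>2 = (norm c)\<^sup>2 - (c \<bullet> z)\<^sup>2 / S" for c
  proof -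
    define u where "u = transpose R *v c"
    have "orthogonal_transformation (\<lambda>x. transpose R *v x)"
      using R by (simp add: orthogonal_transformation_matrix orthogonal_matrix_transpose del: transpose_matrix_vector)
    hence nu: "norm u = norm c" unfolding u_def by (rule orthogonal_transformation_norm)
    have "c \<bullet> z = c \<bullet> (R *v (norm z *\<^sub>R axis k 1))" by (simp add: Rv f(2))
    also have "\<dots> = u \<bullet> (norm z *\<^sub>R axis k 1)"
      by (simp only: u_def dot_lmul_matrix[symmetric] transpose_matrix_vector)
    also have "\<dots> = norm z * u $ k" by (simp add: inner_axis)
    finally have cz: "c \<bullet> z = norm z * u $ k" .
    have "transpose E = E" by (simp add: E_def transpose_def vec_eq_iff)
    hence "transpose L *v c = E *v u"
      by (simp add: L_def u_def matrix_transpose_mul matrix_vector_mul_assoc del: transpose_matrix_vector)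
    also have "E *v u = (\<chi> i. d i * u $ i)"
      by (simp add: E_def matrix_vector_mult_def vec_eq_iff if_distrib[of "\<lambda>x. x * _"] cong: if_cong)
    finally have "(norm (transpose L *v c))\<^sup>2 = (\<Sum>i\<in>UNIV. (d i)\<^sup>2 * (u $ i)\<^sup>2)"
      by (simp add: norm_vec_def L2_set_def sum_nonneg power_mult_distrib)
    also have "\<dots> = (\<Sum>i\<in>UNIV. (u $ i)\<^sup>2 - (if i = k then (1 - 1 / S) * (u $ i)\<^sup>2 else 0))"
      using S by (intro sum.cong) (auto simp: d_def power_divide algebra_simps)
    also have "\<dots> = (norm u)\<^sup>2 - (1 - 1 / S) * (u $ k)\<^sup>2"
      by (simp add: sum_subtractf norm_vec_def L2_set_def sum_nonneg)
    also have "(1 - 1 / S) * (u $ k)\<^sup>2 = (c \<bullet> z)\<^sup>2 / S"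
      using S by (simp add: cz power_mult_distrib field_simps) (simp add: S_def algebra_simps)
    finally show ?thesis by (simp add: nu)
  qed
  with detL show ?thesis using that by blast
qed

lemma std_normal_density_le_one: "std_normal_density x \<le> 1"
proof -
  have "exp (- (x\<^sup>2 / 2)) \<le> 1" "1 \<le> sqrt (2 * pi)" using pi_gt3 by simp_all
  hence "exp (- (x\<^sup>2 / 2)) \<le> sqrt (2 * pi)" by linarith
  thus ?thesis
    unfolding std_normal_density_def by (simp add: divide_le_eq)
qed

text \<open>A normal matrix is almost surely invertible. Its rows are compared with the constant
  rows of the identity matrix: if \<open>c\<close> has a nonzero coordinate, then the form of
  \<open>c\<close> is normal with positive variance and hence almost surely nonzero.\<close>

lemma expected_det_nonzero:
  "1 \<le> (\<integral>\<^sup>+\<omega>. indicator {t. t \<noteq> 0} (det (\<chi> i j. \<omega> i j :: real ^ 'n ^ 'n)) \<partial>Pi\<^sub>M (UNIV :: 'n::finite set) (\<lambda>_. std_normal_vec :: ('n \<Rightarrow> real) measure))"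
proof -
  interpret Q: prob_space "std_normal_vec :: ('n \<Rightarrow> real) measure" by (rule prob_space_std_normal_vec)
  interpret QQ: prob_space "Pi\<^sub>M (UNIV :: 'n set) (\<lambda>_. std_normal_vec :: ('n \<Rightarrow> real) measure)"
    by (intro prob_space_PiM prob_space_std_normal_vec)
  interpret N: prob_space std_normal by (rule prob_space_std_normal)
  have row: "indicator {t. t \<noteq> 0} (axis i 1 \<bullet> c) \<le> (\<integral>\<^sup>+v. indicator {t. t \<noteq> 0} ((\<chi> j. v j) \<bullet> c) \<partial>(std_normal_vec :: ('n \<Rightarrow> real) measure))"
    for i and c :: "real ^ 'n"
  proof (cases "c $ i = 0")
    case False
    obtain s r t where srt: "s\<^sup>2 = (\<Sum>a\<in>UNIV. (c $ a)\<^sup>2)" "s * r = (\<Sum>a\<in>UNIV. c $ a * 0)" "r\<^sup>2 + t\<^sup>2 = (\<Sum>a\<in>(UNIV :: 'n set). 0\<^sup>2)"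
      and law: "\<And>h :: real \<Rightarrow> real \<Rightarrow> ennreal. case_prod h \<in> borel_measurable (borel \<Otimes>\<^sub>M borel) \<Longrightarrow>
        (\<integral>\<^sup>+\<xi>. h (\<Sum>a\<in>UNIV. \<xi> a * c $ a) (\<Sum>a\<in>UNIV. \<xi> a * 0) \<partial>Pi\<^sub>M (UNIV :: 'n set) (\<lambda>_. std_normal)) =
        (\<integral>\<^sup>+x. \<integral>\<^sup>+y. h (s * x) (r * x + t * y) \<partial>std_normal \<partial>std_normal)"
      using nn_integral_PiM_std_normal_two_sums[of "UNIV :: 'n set" "\<lambda>a. c $ a" "\<lambda>_. 0"] finite by blast
    have "s\<^sup>2 \<ge> (c $ i)\<^sup>2" unfolding srt(1) by (intro member_le_sum) auto
    hence s: "s \<noteq> 0" using False by auto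
    have "(\<integral>\<^sup>+v. indicator {t. t \<noteq> 0} ((\<chi> j. v j) \<bullet> c) \<partial>(std_normal_vec :: ('n \<Rightarrow> real) measure)) =
        (\<integral>\<^sup>+v. (\<lambda>x y. indicator {t. t \<noteq> 0} x :: ennreal) (\<Sum>a\<in>UNIV. v a * c $ a) (\<Sum>a\<in>UNIV. v a * 0) \<partial>(std_normal_vec :: ('n \<Rightarrow> real) measure))"
      by (simp add: inner_vec_def)
    also have "\<dots> = (\<integral>\<^sup>+x. \<integral>\<^sup>+y. indicator {t. t \<noteq> 0} (s * x) \<partial>std_normal \<partial>std_normal)"
      by (rule law) measurable
    also have "\<dots> = (\<integral>\<^sup>+x. indicator {t. t \<noteq> 0} (s * x) \<partial>std_normal)"
      by (simp add: N.emeasure_space_1[simplified])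
    also have "\<dots> = (\<integral>\<^sup>+x. 1 \<partial>std_normal)"
    proof (rule nn_integral_cong_AE)
      have "AE x in std_normal. x \<noteq> 0"
        using AE_lborel_singleton[of "0 :: real"] by (auto simp: AE_density elim: eventually_mono)
      thus "AE x in std_normal. indicator {t. t \<noteq> 0} (s * x) = (1 :: ennreal)"
        using s by (auto simp: indicator_def)
    qed
    also have "\<dots> = 1" by (simp add: N.emeasure_space_1[simplified])
    finally show ?thesis by (simp add: indicator_def)
  qed (simp add: inner_axis')
  have "(\<integral>\<^sup>+\<omega>. (\<Prod>i\<in>(UNIV :: 'n set). 1) * indicator {t. t \<noteq> 0} (det (\<chi> i. axis i 1 :: real ^ 'n ^ 'n)) \<partial>Pi\<^sub>M (UNIV :: 'n set) (\<lambda>_. std_normal_vec :: ('n \<Rightarrow> real) measure)) \<le>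
      (\<integral>\<^sup>+\<omega>. (\<Prod>i\<in>(UNIV :: 'n set). 1) * indicator {t. t \<noteq> 0} (det (\<chi> i. \<chi> j. \<omega> i j :: real ^ 'n ^ 'n)) \<partial>Pi\<^sub>M (UNIV :: 'n set) (\<lambda>_. std_normal_vec :: ('n \<Rightarrow> real) measure))"
    by (rule nn_integral_det_weighted_rows_mono[where D = "\<lambda>i _. axis i 1" and D' = "\<lambda>_ v. \<chi> j. v j"
          and w = "\<lambda>_ _. 1" and w' = "\<lambda>_ _. 1" and h = "indicator {t. t \<noteq> 0}"])
       (use row in \<open>auto intro!: prob_space_std_normal_vec measurable_vec_lambda_std_normal_vec simp: Q.emeasure_space_1\<close>)
  moreover have "(\<chi> i. axis i 1) = (mat 1 :: real ^ 'n ^ 'n)"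
    by (simp add: vec_eq_iff mat_def axis_def)
  ultimately show ?thesis by (simp add: QQ.emeasure_space_1)
qed

text \<open>For invertible \<open>G\<close>, the normal density at \<open>G *v z\<close> times
  \<open>\<bar>det G\<bar>\<close> has integral 1 over \<open>z\<close>. After the integrals are
  exchanged, \<open>z\<close> is fixed, and a row \<open>g\<close> weighted by
  \<open>std_normal_density (g \<bullet> z)\<close> can be replaced by the row \<open>L g\<close>
  with the constant weight \<open>k\<close>.\<close>

lemma expected_abs_det_ge:
  "1 \<le> ennreal (std_normal_density 0) ^ CARD('n) * expected_abs_det TYPE('n) *
    (\<integral>\<^sup>+z. ennreal (1 / sqrt (1 + (norm z)\<^sup>2) ^ (CARD('n) + 1)) \<partial>(lborel :: (real ^ 'n::finite) measure))"
proof -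
  let ?QQ = "Pi\<^sub>M (UNIV :: 'n set) (\<lambda>_. std_normal_vec :: ('n \<Rightarrow> real) measure)"
  interpret Q: prob_space "std_normal_vec :: ('n \<Rightarrow> real) measure" by (rule prob_space_std_normal_vec)
  interpret QQ: prob_space ?QQ by (intro prob_space_PiM prob_space_std_normal_vec)
  interpret F: pair_sigma_finite ?QQ "lborel :: (real ^ 'n) measure"
    by (intro pair_sigma_finite.intro QQ.sigma_finite_measure_axioms sigma_finite_lborel)
  define G where "G \<omega> = (\<chi> i j. \<omega> i j :: real ^ 'n ^ 'n)" for \<omega> :: "'n \<Rightarrow> 'n \<Rightarrow> real"
  have "1 \<le> (\<integral>\<^sup>+\<omega>. indicator {t. t \<noteq> 0} (det (G \<omega>)) \<partial>?QQ)"
    unfolding G_def by (rule expected_det_nonzero)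
  also have "\<dots> \<le> (\<integral>\<^sup>+\<omega>. \<integral>\<^sup>+z. (\<Prod>i\<in>UNIV. ennreal (std_normal_density ((G \<omega> *v z) $ i))) * ennreal \<bar>det (G \<omega>)\<bar> \<partial>(lborel :: (real ^ 'n) measure) \<partial>?QQ)"
  proof (intro nn_integral_mono)
    fix \<omega> :: "'n \<Rightarrow> 'n \<Rightarrow> real"
    show "indicator {t. t \<noteq> 0} (det (G \<omega>)) \<le>
      (\<integral>\<^sup>+z. (\<Prod>i\<in>UNIV. ennreal (std_normal_density ((G \<omega> *v z) $ i))) * ennreal \<bar>det (G \<omega>)\<bar> \<partial>(lborel :: (real ^ 'n) measure))"
    proof (cases "det (G \<omega>) = 0")
      case False
      hence inv: "invertible (G \<omega>)" by (simp add: invertible_det_nz)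
      hence inj: "inj ((*v) (G \<omega>))" by (rule inj_matrix_vector_mult)
      have surj: "surj ((*v) (G \<omega>))"
      proof
        obtain B where "G \<omega> ** B = mat 1" using inv by (auto simp: invertible_def)
        thus "UNIV \<subseteq> range ((*v) (G \<omega>))"
          by (metis matrix_vector_mul_assoc matrix_vector_mul_lid rangeI subsetI)
      qed simp
      have "(\<integral>\<^sup>+z. (\<Prod>i\<in>UNIV. ennreal (std_normal_density ((G \<omega> *v z) $ i))) * ennreal \<bar>det (G \<omega>)\<bar> * indicator (UNIV \<inter> UNIV) z \<partial>(lborel :: (real ^ 'n) measure)) =
          (\<integral>\<^sup>+y. (\<Prod>i\<in>UNIV. ennreal (std_normal_density (y $ i))) * indicator ((*v) (G \<omega>) ` (UNIV \<inter> UNIV)) y \<partial>(lborel :: (real ^ 'n) measure))"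
        by (rule nn_integral_change_of_variables[where J = "\<lambda>_. G \<omega>"])
           (use inj in \<open>auto intro!: bounded_linear_imp_has_derivative\<close>)
      also have "\<dots> = (\<integral>\<^sup>+y. (\<Prod>i\<in>UNIV. ennreal (std_normal_density (y $ i))) \<partial>(lborel :: (real ^ 'n) measure))"
        using surj by simp
      also have "\<dots> = (\<Prod>i\<in>(UNIV :: 'n set). \<integral>\<^sup>+t. ennreal (std_normal_density t) \<partial>lborel)"
        by (rule nn_integral_lborel_prod_cart) simp
      also have "\<dots> = 1" by (simp add: nn_integral_eq_integral)
      finally show ?thesis by (simp add: indicator_def)
    qed simp
  qed
  also have "\<dots> = (\<integral>\<^sup>+z. \<integral>\<^sup>+\<omega>. (\<Prod>i\<in>UNIV. ennreal (std_normal_density ((G \<omega> *v z) $ i))) * ennreal \<bar>det (G \<omega>)\<bar> \<partial>?QQ \<partial>(lborel :: (real ^ 'n) measure))"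
    unfolding G_def det_def matrix_vector_mult_def vec_lambda_beta by (intro F.Fubini'[symmetric]) measurable
  also have "\<dots> \<le> (\<integral>\<^sup>+z. ennreal (std_normal_density 0) ^ CARD('n) * expected_abs_det TYPE('n) * ennreal (1 / sqrt (1 + (norm z)\<^sup>2) ^ (CARD('n) + 1)) \<partial>(lborel :: (real ^ 'n) measure))"
  proof (intro nn_integral_mono)
    fix z :: "real ^ 'n"
    define S where "S = 1 + (norm z)\<^sup>2"
    have S: "S > 0" by (simp add: S_def add_pos_nonneg)
    obtain L :: "real ^ 'n ^ 'n" where L: "\<And>c. (norm (transpose L *v c))\<^sup>2 = (norm c)\<^sup>2 - (c \<bullet> z)\<^sup>2 / S" "\<bar>det L\<bar> = 1 / sqrt S"
      using matrix_sqrt_rank_one_update[of z] unfolding S_def by blast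
    \<comment> \<open>One factor \<open>1 / sqrt S\<close> for each row, and one more from
      \<open>\<bar>det L\<bar>\<close>, give the exponent \<open>CARD('n) + 1\<close>.\<close>
    define k where "k = ennreal (1 / sqrt S) * ennreal (std_normal_density 0)"
    have row: "(\<integral>\<^sup>+v. ennreal (std_normal_density ((\<chi> j. v j) \<bullet> z)) * ennreal \<bar>(\<chi> j. v j) \<bullet> c\<bar> \<partial>(std_normal_vec :: ('n \<Rightarrow> real) measure)) =
        (\<integral>\<^sup>+v. k * ennreal \<bar>(L *v (\<chi> j. v j)) \<bullet> c\<bar> \<partial>(std_normal_vec :: ('n \<Rightarrow> real) measure))" for c
    proof -
      have "sqrt ((norm c)\<^sup>2 * S - (c \<bullet> z)\<^sup>2) / (pi * S) = 1 / sqrt S * (norm (transpose L *v c) / pi)"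
      proof -
        have "(norm c)\<^sup>2 * S - (c \<bullet> z)\<^sup>2 = S * (norm (transpose L *v c))\<^sup>2"
          unfolding L(1) using S by (simp add: field_simps)
        hence "sqrt ((norm c)\<^sup>2 * S - (c \<bullet> z)\<^sup>2) = sqrt S * norm (transpose L *v c)"
          by (simp only: real_sqrt_mult real_sqrt_abs abs_norm_cancel)
        moreover have "sqrt S / S = 1 / sqrt S" using S by (simp add: real_div_sqrt field_simps)
        moreover have "sqrt S * a / (pi * S) = (sqrt S / S) * (a / pi)" for a by simp
        ultimately show ?thesis by simp
      qed
      hence "(\<integral>\<^sup>+v. ennreal (std_normal_density ((\<chi> j. v j) \<bullet> z)) * ennreal \<bar>(\<chi> j. v j) \<bullet> c\<bar> \<partial>(std_normal_vec :: ('n \<Rightarrow> real) measure)) =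
          ennreal (1 / sqrt S) * (\<integral>\<^sup>+v. ennreal (std_normal_density 0) * ennreal \<bar>(L *v (\<chi> j. v j)) \<bullet> c\<bar> \<partial>(std_normal_vec :: ('n \<Rightarrow> real) measure))"
        unfolding nn_integral_std_normal_vec_weighted nn_integral_std_normal_vec_linear S_def[symmetric]
        using S by (simp add: ennreal_mult'[symmetric])
      moreover have "(\<lambda>v. (L *v (\<chi> j. v j)) \<bullet> c) \<in> borel_measurable (std_normal_vec :: ('n \<Rightarrow> real) measure)"
        by (intro borel_measurable_inner borel_measurable_matrix_vector borel_measurable_vec_lambda borel_measurable_const measurable_std_normal_vec_nth)
      ultimately show ?thesis
        by (subst (asm) nn_integral_cmult[symmetric]) (simp_all add: k_def mult.assoc)
    qed
    have "(\<integral>\<^sup>+\<omega>. (\<Prod>i\<in>UNIV. ennreal (std_normal_density ((G \<omega> *v z) $ i))) * ennreal \<bar>det (G \<omega>)\<bar> \<partial>?QQ) =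
        (\<integral>\<^sup>+\<omega>. (\<Prod>i\<in>UNIV. ennreal (std_normal_density ((\<chi> j. \<omega> i j) \<bullet> z))) * ennreal \<bar>det (\<chi> i. \<chi> j. \<omega> i j)\<bar> \<partial>?QQ)"
      by (simp add: G_def matrix_vector_mult_def inner_vec_def)
    also have "\<dots> \<le> (\<integral>\<^sup>+\<omega>. (\<Prod>i\<in>(UNIV :: 'n set). k) * ennreal \<bar>det (\<chi> i. L *v (\<chi> j. \<omega> i j))\<bar> \<partial>?QQ)"
    proof (rule nn_integral_det_weighted_rows_mono[where D = "\<lambda>_ v. \<chi> j. v j" and D' = "\<lambda>_ v. L *v (\<chi> j. v j)"
          and w = "\<lambda>_ v. ennreal (std_normal_density ((\<chi> j. v j) \<bullet> z))" and w' = "\<lambda>_ _. k" and h = "\<lambda>t. ennreal \<bar>t\<bar>"])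
      have "(\<integral>\<^sup>+v. ennreal (std_normal_density ((\<chi> j. v j) \<bullet> z)) \<partial>(std_normal_vec :: ('n \<Rightarrow> real) measure)) \<le> (\<integral>\<^sup>+v. 1 \<partial>(std_normal_vec :: ('n \<Rightarrow> real) measure))"
        by (intro nn_integral_mono) (simp add: std_normal_density_le_one)
      thus "(\<integral>\<^sup>+v. ennreal (std_normal_density ((\<chi> j. v j) \<bullet> z)) \<partial>(std_normal_vec :: ('n \<Rightarrow> real) measure)) \<noteq> \<infinity>"
        by (auto simp: Q.emeasure_space_1 top_unique)
      show "(\<integral>\<^sup>+v. k \<partial>(std_normal_vec :: ('n \<Rightarrow> real) measure)) \<noteq> \<infinity>"
        by (simp add: Q.emeasure_space_1 k_def ennreal_mult_eq_top_iff)
      show "(\<lambda>v. L *v (\<chi> j. v j)) \<in> borel_measurable (std_normal_vec :: ('n \<Rightarrow> real) measure)"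
        using measurable_vec_lambda_std_normal_vec by (rule borel_measurable_matrix_vector)
      have "(\<lambda>v. (\<chi> j. v j) \<bullet> z) \<in> borel_measurable (std_normal_vec :: ('n \<Rightarrow> real) measure)"
        using measurable_vec_lambda_std_normal_vec by (intro borel_measurable_inner) auto
      thus "(\<lambda>v. ennreal (std_normal_density ((\<chi> j. v j) \<bullet> z))) \<in> borel_measurable (std_normal_vec :: ('n \<Rightarrow> real) measure)"
        by simp
    qed (use row in \<open>auto intro!: prob_space_std_normal_vec measurable_vec_lambda_std_normal_vec\<close>)
    also have "\<dots> = k ^ CARD('n) * (ennreal \<bar>det L\<bar> * expected_abs_det TYPE('n))"
      unfolding nn_integral_abs_det_linear_rows[symmetric]
      by (subst nn_integral_cmult[symmetric]) (simp_all add: det_def)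
    also have "\<dots> = ennreal (std_normal_density 0) ^ CARD('n) * expected_abs_det TYPE('n) * ennreal (1 / sqrt S ^ (CARD('n) + 1))"
      using S unfolding k_def L(2)
      by (simp add: power_mult_distrib ennreal_power mult_ac ennreal_mult'[symmetric] power_divide)
    finally show "(\<integral>\<^sup>+\<omega>. (\<Prod>i\<in>UNIV. ennreal (std_normal_density ((G \<omega> *v z) $ i))) * ennreal \<bar>det (G \<omega>)\<bar> \<partial>?QQ) \<le>
        ennreal (std_normal_density 0) ^ CARD('n) * expected_abs_det TYPE('n) * ennreal (1 / sqrt (1 + (norm z)\<^sup>2) ^ (CARD('n) + 1))"
      by (simp only: S_def)
  qed
  also have "\<dots> = ennreal (std_normal_density 0) ^ CARD('n) * expected_abs_det TYPE('n) *
    (\<integral>\<^sup>+z. ennreal (1 / sqrt (1 + (norm z)\<^sup>2) ^ (CARD('n) + 1)) \<partial>(lborel :: (real ^ 'n) measure))"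
    by (rule nn_integral_cmult) measurable
  finally show ?thesis .
qed

section \<open>The integral over \<open>z\<close> as half the volume of a sphere\<close>

lemma nn_integral_lborel_scale:
  fixes g :: "'a :: euclidean_space \<Rightarrow> ennreal"
  assumes [measurable]: "g \<in> borel_measurable borel" and t: "t \<noteq> 0"
  shows "(\<integral>\<^sup>+x. g x \<partial>lborel) = ennreal (\<bar>t\<bar> ^ DIM('a)) * (\<integral>\<^sup>+x. g (t *\<^sub>R x) \<partial>lborel)"
  by (subst lborel_affine[OF t, of 0]) (simp add: nn_integral_density nn_integral_distr nn_integral_cmult)

lemma nn_integral_abs_power_symmetric_interval:
  assumes b: "b > 0"
  shows "(\<integral>\<^sup>+t. ennreal (\<bar>t\<bar> ^ n) * indicator {-b<..<b} t \<partial>lborel) = ennreal (2 * b ^ (n + 1) / (n + 1))"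
proof -
  define g where "g t = ennreal (t ^ n) * indicator {0..b} t" for t :: real
  have [measurable]: "g \<in> borel_measurable borel" unfolding g_def by measurable
  have g: "(\<integral>\<^sup>+t. g t \<partial>lborel) = ennreal (b ^ (n + 1) / (n + 1))"
  proof -
    have "(\<integral>\<^sup>+t. g t \<partial>lborel) = ennreal (b ^ (n + 1) / (n + 1) - 0 ^ (n + 1) / (n + 1))"
      unfolding g_def using b
    proof (intro nn_integral_FTC_Icc)
      show "((\<lambda>t. t ^ (n + 1) / real (n + 1)) has_real_derivative t ^ n) (at t)" for t :: real
        using DERIV_cdivide[OF DERIV_pow[of "n + 1" t], of "real (n + 1)"] by simp
    qed auto
    thus ?thesis by simp
  qed
  have g': "(\<integral>\<^sup>+t. g (- t) \<partial>lborel) = (\<integral>\<^sup>+t. g t \<partial>lborel)"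
    by (subst (2) nn_integral_real_affine[of _ "-1" 0]) auto
  \<comment> \<open>The two half-intervals overlap at 0 and contain the end points that the open
    interval omits: a null set.\<close>
  have "AE t in lborel. t \<noteq> (0::real) \<and> t \<noteq> b \<and> t \<noteq> - b"
    using AE_lborel_singleton[of "0::real"] AE_lborel_singleton[of b] AE_lborel_singleton[of "-b"] by eventually_elim simp
  hence "(\<integral>\<^sup>+t. ennreal (\<bar>t\<bar> ^ n) * indicator {-b<..<b} t \<partial>lborel) = (\<integral>\<^sup>+t. g t + g (- t) \<partial>lborel)"
  proof (intro nn_integral_cong_AE, elim eventually_mono)
    fix t :: real assume "t \<noteq> 0 \<and> t \<noteq> b \<and> t \<noteq> - b"
    thus "ennreal (\<bar>t\<bar> ^ n) * indicator {-b<..<b} t = g t + g (- t)"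
      using b by (auto simp: g_def indicator_def)
  qed
  also have "\<dots> = ennreal (b ^ (n + 1) / (n + 1)) + ennreal (b ^ (n + 1) / (n + 1))"
    by (subst nn_integral_add) (simp_all add: g g' del: power_Suc)
  also have "\<dots> = ennreal (2 * b ^ (n + 1) / (n + 1))"
    using b by (simp flip: ennreal_plus del: power_Suc)
  finally show ?thesis .
qed

text \<open>The substitution \<open>x = t *\<^sub>R z\<close> in the unit ball of \<open>(real ^ 'n) \<times> real\<close>.\<close>

lemma nn_integral_inverse_sqrt_power:
  "(\<integral>\<^sup>+z. ennreal (1 / sqrt (1 + (norm z)\<^sup>2) ^ (CARD('n) + 1)) \<partial>(lborel :: (real ^ 'n::finite) measure)) =
    ennreal (real (CARD('n) + 1) * unit_ball_vol (CARD('n) + 1) / 2)"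
proof -
  define n where "n = CARD('n)"
  define b where "b z = 1 / sqrt (1 + (norm z)\<^sup>2)" for z :: "real ^ 'n"
  have b: "b z > 0" for z by (simp add: b_def add_pos_nonneg)
  define B where "B = ball (0 :: (real ^ 'n) \<times> real) 1"
  have [measurable]: "B \<in> sets (borel \<Otimes>\<^sub>M borel)" unfolding B_def borel_prod by simp
  \<comment> \<open>For fixed \<open>z\<close> the points \<open>(t *\<^sub>R z, t)\<close> run
    through a line through the origin, from which the ball cuts the segment
    \<open>\<bar>t\<bar> < b z\<close>. This is central projection: \<open>z\<close> parametrises
    the lines that leave the hyperplane \<open>t = 0\<close>.\<close>
  have mem: "(t *\<^sub>R z, t) \<in> B \<longleftrightarrow> t \<in> {- b z<..<b z}" for t and z :: "real ^ 'n"
  proof -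
    have "(t *\<^sub>R z, t) \<in> B \<longleftrightarrow> t\<^sup>2 * (1 + (norm z)\<^sup>2) < 1"
      by (simp add: B_def norm_Pair power_mult_distrib algebra_simps)
    also have "\<dots> \<longleftrightarrow> t\<^sup>2 < (b z)\<^sup>2"
      by (simp add: b_def power_divide add_pos_nonneg less_divide_eq)
    also have "\<dots> \<longleftrightarrow> \<bar>t\<bar> < b z"
      using abs_le_square_iff[of "b z" t] b[of z] by (simp flip: not_le)
    finally show ?thesis by auto
  qed
  have "ennreal (unit_ball_vol (real (n + 1))) = emeasure lborel B"
    unfolding B_def by (subst emeasure_ball) (simp_all add: n_def add.commute)
  also have "\<dots> = (\<integral>\<^sup>+p. indicator B p \<partial>(lborel \<Otimes>\<^sub>M lborel))"
    using nn_integral_indicator[of B lborel] by (simp add: lborel_prod B_def)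
  also have "\<dots> = (\<integral>\<^sup>+t. \<integral>\<^sup>+x. indicator B (x, t) \<partial>lborel \<partial>lborel)"
    by (rule lborel_pair.nn_integral_snd[symmetric]) measurable
  also have "\<dots> = (\<integral>\<^sup>+t. \<integral>\<^sup>+z. ennreal (\<bar>t\<bar> ^ n) * indicator {- b z<..<b z} t \<partial>lborel \<partial>lborel)"
  \<comment> \<open>The substitution degenerates at \<open>t = 0\<close>, a single value of
    \<open>t\<close>.\<close>
  proof (rule nn_integral_cong_AE)
    have *: "(\<integral>\<^sup>+x. indicator B (x, t) \<partial>lborel) = (\<integral>\<^sup>+z. ennreal (\<bar>t\<bar> ^ n) * indicator {- b z<..<b z} t \<partial>lborel)" if "t \<noteq> 0" for t
    proof -
      have "(\<integral>\<^sup>+x. indicator B (x, t) \<partial>lborel) = ennreal (\<bar>t\<bar> ^ n) * (\<integral>\<^sup>+z. indicator B (t *\<^sub>R z, t) \<partial>lborel)"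
        using that by (subst nn_integral_lborel_scale[where t = t]) (auto simp: n_def)
      also have "\<dots> = (\<integral>\<^sup>+z. ennreal (\<bar>t\<bar> ^ n) * indicator B (t *\<^sub>R z, t) \<partial>lborel)"
        by (rule nn_integral_cmult[symmetric]) measurable
      finally show ?thesis by (simp add: indicator_def mem)
    qed
    show "AE t in lborel. (\<integral>\<^sup>+x. indicator B (x, t) \<partial>lborel) = (\<integral>\<^sup>+z. ennreal (\<bar>t\<bar> ^ n) * indicator {- b z<..<b z} t \<partial>lborel)"
      using AE_lborel_singleton[of "0::real"] by eventually_elim (rule *)
  qed
  also have "\<dots> = (\<integral>\<^sup>+z. \<integral>\<^sup>+t. ennreal (\<bar>t\<bar> ^ n) * indicator {- b z<..<b z} t \<partial>lborel \<partial>lborel)"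
    unfolding b_def indicator_def greaterThanLessThan_iff by (rule lborel_pair.Fubini') measurable
  also have "\<dots> = (\<integral>\<^sup>+z. ennreal (2 / (n + 1)) * ennreal (1 / sqrt (1 + (norm z)\<^sup>2) ^ (n + 1)) \<partial>(lborel :: (real ^ 'n) measure))"
  proof (rule nn_integral_cong)
    fix z :: "real ^ 'n"
    have "(\<integral>\<^sup>+t. ennreal (\<bar>t\<bar> ^ n) * indicator {- b z<..<b z} t \<partial>lborel) = ennreal (2 * b z ^ (n + 1) / (n + 1))"
      by (rule nn_integral_abs_power_symmetric_interval[OF b])
    also have "2 * b z ^ (n + 1) / (n + 1) = 2 / (n + 1) * (1 / sqrt (1 + (norm z)\<^sup>2) ^ (n + 1))"
      by (simp add: b_def power_divide del: power_Suc)
    also have "ennreal (2 / (n + 1) * (1 / sqrt (1 + (norm z)\<^sup>2) ^ (n + 1))) =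
        ennreal (2 / (n + 1)) * ennreal (1 / sqrt (1 + (norm z)\<^sup>2) ^ (n + 1))"
      by (rule ennreal_mult') simp
    finally show "(\<integral>\<^sup>+t. ennreal (\<bar>t\<bar> ^ n) * indicator {- b z<..<b z} t \<partial>lborel) =
        ennreal (2 / (n + 1)) * ennreal (1 / sqrt (1 + (norm z)\<^sup>2) ^ (n + 1))" .
  qed
  also have "\<dots> = ennreal (2 / (n + 1)) * (\<integral>\<^sup>+z. ennreal (1 / sqrt (1 + (norm z)\<^sup>2) ^ (n + 1)) \<partial>(lborel :: (real ^ 'n) measure))"
    by (rule nn_integral_cmult) measurable
  finally have "ennreal ((n + 1) / 2) * ennreal (unit_ball_vol (real (n + 1))) =
      ennreal ((n + 1) / 2) * (ennreal (2 / (n + 1)) * (\<integral>\<^sup>+z. ennreal (1 / sqrt (1 + (norm z)\<^sup>2) ^ (n + 1)) \<partial>(lborel :: (real ^ 'n) measure)))"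
    by simp
  also have "\<dots> = (\<integral>\<^sup>+z. ennreal (1 / sqrt (1 + (norm z)\<^sup>2) ^ (n + 1)) \<partial>(lborel :: (real ^ 'n) measure))"
  proof -
    have "real (n + 1) / 2 * (2 / real (n + 1)) = 1" by (simp del: of_nat_Suc of_nat_add)
    hence "ennreal ((n + 1) / 2) * ennreal (2 / (n + 1)) = 1"
      by (subst ennreal_mult'[symmetric]) simp_all
    thus ?thesis unfolding mult.assoc[symmetric] by simp
  qed
  finally have "ennreal ((n + 1) / 2) * ennreal (unit_ball_vol (real (n + 1))) =
      (\<integral>\<^sup>+z. ennreal (1 / sqrt (1 + (norm z)\<^sup>2) ^ (n + 1)) \<partial>(lborel :: (real ^ 'n) measure))" .
  moreover have "ennreal ((n + 1) / 2) * ennreal (unit_ball_vol (real (n + 1))) = ennreal ((n + 1) / 2 * unit_ball_vol (real (n + 1)))"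
    by (rule ennreal_mult'[symmetric]) simp
  ultimately have "(\<integral>\<^sup>+z. ennreal (1 / sqrt (1 + (norm z)\<^sup>2) ^ (n + 1)) \<partial>(lborel :: (real ^ 'n) measure)) =
      ennreal ((n + 1) / 2 * unit_ball_vol (real (n + 1)))"
    by simp
  thus ?thesis by (simp add: n_def)
qed

section \<open>The moment map\<close>

locale exponential_weights =
  fixes A :: "(real ^ 'n) set" and \<alpha> :: "real ^ 'n \<Rightarrow> real"
  assumes finite_A: "finite A" and full_dim: "aff_dim (convex hull A) = int CARD('n)"
    and \<alpha>_pos: "\<And>a. a \<in> A \<Longrightarrow> \<alpha> a > 0"
begin

text \<open>The variance of the term of \<open>a\<close> at the point \<open>x\<close>. The square
  is the source of the factor 2 in the derivative of \<open>moment_map\<close>.\<close>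

definition weight :: "real ^ 'n \<Rightarrow> real ^ 'n \<Rightarrow> real" where
  "weight x a = (\<alpha> a * exp (a \<bullet> x))\<^sup>2"

definition total :: "real ^ 'n \<Rightarrow> real" where
  "total x = (\<Sum>a\<in>A. weight x a)"

definition prob_weight :: "real ^ 'n \<Rightarrow> real ^ 'n \<Rightarrow> real" where
  "prob_weight x a = weight x a / total x"

definition moment_map :: "real ^ 'n \<Rightarrow> real ^ 'n" where
  "moment_map x = (\<Sum>a\<in>A. prob_weight x a *\<^sub>R a)"

definition covariance :: "real ^ 'n \<Rightarrow> real ^ 'n ^ 'n" where
  "covariance x = (\<chi> i j. \<Sum>a\<in>A. prob_weight x a * (a - moment_map x) $ i * (a - moment_map x) $ j)"

section \<open>The weights, their mean and their covariance\<close>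

lemma A_nonempty: "A \<noteq> {}"
  using full_dim by auto

lemma weight_pos: "a \<in> A \<Longrightarrow> weight x a > 0"
  using \<alpha>_pos[of a] by (simp add: weight_def)

lemma total_pos: "total x > 0"
  unfolding total_def by (rule sum_pos[OF finite_A A_nonempty weight_pos])

lemma prob_weight_pos: "a \<in> A \<Longrightarrow> prob_weight x a > 0"
  by (simp add: prob_weight_def weight_pos total_pos)

lemma sum_prob_weight: "(\<Sum>a\<in>A. prob_weight x a) = 1"
  using total_pos[of x] by (simp add: prob_weight_def total_def sum_divide_distrib[symmetric])

lemma sum_prob_weight_centered: "(\<Sum>a\<in>A. prob_weight x a *\<^sub>R (a - moment_map x)) = 0"
  by (simp add: scaleR_diff_right sum_subtractf scaleR_sum_left[symmetric] sum_prob_weight moment_map_def)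

lemma sum_prob_weight_centered_inner: "(\<Sum>a\<in>A. prob_weight x a * ((a - moment_map x) \<bullet> v)) = 0"
  using arg_cong[OF sum_prob_weight_centered, of "\<lambda>u. u \<bullet> v" x] by (simp add: inner_sum_left)

lemma covariance_mult: "covariance x *v v = (\<Sum>a\<in>A. (prob_weight x a * ((a - moment_map x) \<bullet> v)) *\<^sub>R (a - moment_map x))"
proof -
  have "(\<Sum>j\<in>UNIV. (\<Sum>a\<in>A. prob_weight x a * (a - moment_map x) $ i * (a - moment_map x) $ j) * v $ j) =
      (\<Sum>a\<in>A. prob_weight x a * ((a - moment_map x) \<bullet> v) * (a - moment_map x) $ i)" for i
    unfolding sum_distrib_right
    by (subst sum.swap) (simp add: inner_vec_def sum_distrib_left sum_distrib_right mult_ac)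
  thus ?thesis
    by (simp add: covariance_def matrix_vector_mult_def vec_eq_iff)
qed

lemma covariance_quadratic: "v \<bullet> (covariance x *v v) = (\<Sum>a\<in>A. prob_weight x a * ((a - moment_map x) \<bullet> v)\<^sup>2)"
  by (simp add: covariance_mult inner_sum_right power2_eq_square inner_commute mult_ac)

lemma covariance_transpose: "transpose (covariance x) = covariance x"
  by (simp add: covariance_def transpose_def vec_eq_iff mult_ac)

text \<open>If the quadratic form vanished at \<open>v\<close>, all of \<open>A\<close> would lie in
  one hyperplane orthogonal to \<open>v\<close>, against the full dimension of the hull.\<close>

lemma covariance_pos:
  assumes "v \<noteq> 0"
  shows "v \<bullet> (covariance x *v v) > 0"
proof (rule ccontr)
  assume "\<not> v \<bullet> (covariance x *v v) > 0"
  hence "(\<Sum>a\<in>A. prob_weight x a * ((a - moment_map x) \<bullet> v)\<^sup>2) = 0"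
    unfolding covariance_quadratic
    by (intro antisym sum_nonneg) (auto intro!: mult_nonneg_nonneg less_imp_le[OF prob_weight_pos])
  hence "prob_weight x a * ((a - moment_map x) \<bullet> v)\<^sup>2 = 0" if "a \<in> A" for a
    using that finite_A by (subst (asm) sum_nonneg_eq_0_iff) (auto intro!: mult_nonneg_nonneg less_imp_le[OF prob_weight_pos])
  hence "A \<subseteq> {a. v \<bullet> a = v \<bullet> moment_map x}"
  proof safe
    fix a assume "a \<in> A"
    thus "v \<bullet> a = v \<bullet> moment_map x"
      using \<open>\<And>a. a \<in> A \<Longrightarrow> prob_weight x a * ((a - moment_map x) \<bullet> v)\<^sup>2 = 0\<close>[of a] prob_weight_pos[of a x]
      by (simp add: inner_diff_left inner_commute[of v])
  qed
  hence "aff_dim (convex hull A) \<le> aff_dim {a. v \<bullet> a = v \<bullet> moment_map x}"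
    by (simp add: aff_dim_convex_hull aff_dim_subset)
  thus False
    using assms full_dim by (simp add: aff_dim_hyperplane)
qed

lemma weight_has_derivative:
  "((\<lambda>x. weight x a) has_derivative (\<lambda>v. 2 * (a \<bullet> v) * weight x a)) (at x)"
  unfolding weight_def
  by (auto intro!: derivative_eq_intros simp: power2_eq_square algebra_simps)

lemma continuous_weight [continuous_intros]: "continuous_on S (\<lambda>x. weight x a)"
  unfolding weight_def by (intro continuous_intros)

lemma continuous_prob_weight [continuous_intros]: "continuous_on S (\<lambda>x. prob_weight x a)"
  unfolding prob_weight_def total_def
  by (intro continuous_intros) (use total_pos in \<open>auto simp: total_def less_imp_neq[symmetric]\<close>)

lemma continuous_moment_map [continuous_intros]: "continuous_on S moment_map"
  unfolding moment_map_def[abs_def] by (intro continuous_intros)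

lemma continuous_covariance: "continuous_on S covariance"
  unfolding covariance_def[abs_def] by (intro continuous_intros)

text \<open>The logarithmic derivative of a probability weight along \<open>v\<close> is twice the
  deviation \<open>(a - moment_map x) \<bullet> v\<close>. As the deviations average to 0, the
  remaining factor \<open>a\<close> may be centred too, which produces the covariance.\<close>

lemma moment_map_has_derivative: "(moment_map has_derivative (*v) (2 *\<^sub>R covariance x)) (at x)"
proof -
  have Z: "(total has_derivative (\<lambda>v. \<Sum>a\<in>A. 2 * (a \<bullet> v) * weight x a)) (at x)"
    unfolding total_def[abs_def] by (intro has_derivative_sum weight_has_derivative)
  have p: "((\<lambda>x. prob_weight x a) has_derivative (\<lambda>v. 2 * prob_weight x a * ((a - moment_map x) \<bullet> v))) (at x)" for a
  proof -
    have m: "moment_map x \<bullet> v = (\<Sum>a\<in>A. (a \<bullet> v) * weight x a) / total x" for v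
      by (simp add: moment_map_def prob_weight_def inner_sum_left sum_divide_distrib mult.commute)
    have "((\<lambda>x. weight x a / total x) has_derivative
        (\<lambda>v. - weight x a * (inverse (total x) * (\<Sum>a\<in>A. 2 * (a \<bullet> v) * weight x a) * inverse (total x)) + 2 * (a \<bullet> v) * weight x a / total x)) (at x)"
      using total_pos[of x] by (intro has_derivative_divide weight_has_derivative Z) auto
    moreover have "- weight x a * (inverse (total x) * (\<Sum>a\<in>A. 2 * (a \<bullet> v) * weight x a) * inverse (total x)) + 2 * (a \<bullet> v) * weight x a / total x =
        2 * prob_weight x a * ((a - moment_map x) \<bullet> v)" for v
    proof -
      have "(\<Sum>a\<in>A. 2 * (a \<bullet> v) * weight x a) = 2 * (\<Sum>a\<in>A. (a \<bullet> v) * weight x a)"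
        by (simp add: sum_distrib_left mult.assoc)
      thus ?thesis
        unfolding inner_diff_left m using total_pos[of x]
        by (simp add: prob_weight_def field_simps)
    qed
    ultimately show ?thesis by (simp add: prob_weight_def)
  qed
  have "((\<lambda>x. \<Sum>a\<in>A. prob_weight x a *\<^sub>R a) has_derivative
      (\<lambda>v. \<Sum>a\<in>A. (2 * prob_weight x a * ((a - moment_map x) \<bullet> v)) *\<^sub>R a)) (at x)"
    by (intro has_derivative_sum has_derivative_scaleR_left p)
  moreover have "(\<lambda>x. \<Sum>a\<in>A. prob_weight x a *\<^sub>R a) = moment_map"
    by (simp add: moment_map_def fun_eq_iff)
  moreover have "(\<Sum>a\<in>A. (2 * prob_weight x a * ((a - moment_map x) \<bullet> v)) *\<^sub>R a) = (2 *\<^sub>R covariance x) *v v" for v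
  proof -
    have "(2 *\<^sub>R covariance x) *v v = 2 *\<^sub>R (covariance x *v v)"
      by (simp add: scaleR_matrix_vector_assoc)
    also have "\<dots> = (\<Sum>a\<in>A. (2 * prob_weight x a * ((a - moment_map x) \<bullet> v)) *\<^sub>R a) -
        (2 * (\<Sum>a\<in>A. prob_weight x a * ((a - moment_map x) \<bullet> v))) *\<^sub>R moment_map x"
      by (simp add: covariance_mult scaleR_sum_right scaleR_diff_right sum_subtractf sum_distrib_left scaleR_sum_left mult.assoc)
    finally show ?thesis by (simp add: sum_prob_weight_centered_inner)
  qed
  ultimately show ?thesis by simp
qed

text \<open>\<open>moment_map\<close> is the gradient of the strictly convex function
  \<open>ln (total x) / 2\<close>, so its component along a segment increases strictly on that
  segment.\<close>

lemma inj_moment_map: "inj moment_map"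
proof (rule injI, rule ccontr)
  fix x y assume eq: "moment_map x = moment_map y" and ne: "x \<noteq> y"
  define v where "v = y - x"
  define \<psi> where "\<psi> t = moment_map (x + t *\<^sub>R v) \<bullet> v" for t :: real
  have "(\<psi> has_real_derivative 2 * (v \<bullet> (covariance (x + t *\<^sub>R v) *v v))) (at t)" for t
  proof -
    have "((\<lambda>t. moment_map (x + t *\<^sub>R v)) has_derivative (\<lambda>h. (2 *\<^sub>R covariance (x + t *\<^sub>R v)) *v (h *\<^sub>R v))) (at t)"
      by (rule has_derivative_compose[OF _ moment_map_has_derivative]) (auto intro!: derivative_eq_intros)
    hence "(\<psi> has_derivative (\<lambda>h. ((2 *\<^sub>R covariance (x + t *\<^sub>R v)) *v (h *\<^sub>R v)) \<bullet> v)) (at t)"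
      unfolding \<psi>_def by (intro has_derivative_inner_left)
    moreover have "(\<lambda>h. ((2 *\<^sub>R covariance (x + t *\<^sub>R v)) *v (h *\<^sub>R v)) \<bullet> v) = (*) (2 * (v \<bullet> (covariance (x + t *\<^sub>R v) *v v)))"
      by (rule ext) (simp add: scaleR_matrix_vector_assoc[symmetric] matrix_vector_mult_scaleR inner_commute)
    ultimately show ?thesis
      by (simp add: has_field_derivative_def)
  qed
  moreover have "v \<noteq> 0" using ne by (simp add: v_def)
  ultimately have "\<psi> 0 < \<psi> 1"
    by (intro DERIV_pos_imp_increasing[of 0 1 \<psi>]) (auto intro!: exI covariance_pos)
  thus False using eq by (simp add: \<psi>_def v_def)
qed

text \<open>The point \<open>y\<close> is the image of the minimiser of \<open>x \<mapsto> \<Sum>a\<in>A. weight x a * exp (- 2 * (y \<bullet> x))\<close>, a function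
  that tends to infinity because \<open>y\<close> is interior.\<close>

lemma interior_subset_range_moment_map: "interior (convex hull A) \<subseteq> range moment_map"
proof
  fix y assume "y \<in> interior (convex hull A)"
  then obtain \<delta> where \<delta>: "\<delta> > 0" "cball y \<delta> \<subseteq> convex hull A"
    by (auto simp: mem_interior_cball)
  define G where "G x = (\<Sum>a\<in>A. (\<alpha> a)\<^sup>2 * exp (2 * ((a - y) \<bullet> x)))" for x
  define m where "m = Min ((\<lambda>a. (\<alpha> a)\<^sup>2) ` A)"
  have "m \<in> (\<lambda>a. (\<alpha> a)\<^sup>2) ` A"
    unfolding m_def using finite_A A_nonempty by (intro Min_in) auto
  then obtain a0 where "a0 \<in> A" "m = (\<alpha> a0)\<^sup>2" by blast
  hence m: "m > 0" using \<alpha>_pos[of a0] by simp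
  have m_le: "m \<le> (\<alpha> a)\<^sup>2" if "a \<in> A" for a
    using finite_A that by (simp add: m_def)
  have G_nonneg: "G x \<ge> 0" for x by (auto simp: G_def intro!: sum_nonneg)
  \<comment> \<open>The ball of radius \<open>\<delta>\<close> about \<open>y\<close> lies in the
    hull and so protrudes from the half-space
    \<open>x \<bullet> a < \<delta> * norm x + x \<bullet> y\<close>, which therefore cannot contain
    all of \<open>A\<close>.\<close>
  have far: "\<exists>a\<in>A. \<delta> * norm x \<le> (a - y) \<bullet> x" for x
  proof (rule ccontr)
    assume "\<not> (\<exists>a\<in>A. \<delta> * norm x \<le> (a - y) \<bullet> x)"
    hence "(a - y) \<bullet> x < \<delta> * norm x" if "a \<in> A" for a using that by (simp add: not_le)
    hence "A \<subseteq> {a. x \<bullet> a < \<delta> * norm x + x \<bullet> y}"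
      by (auto simp: inner_diff_left inner_commute[of x] less_diff_eq diff_less_eq)
    hence hull: "convex hull A \<subseteq> {a. x \<bullet> a < \<delta> * norm x + x \<bullet> y}"
      by (intro hull_minimal convex_halfspace_lt)
    have "x \<noteq> 0" using \<open>A \<subseteq> _\<close> A_nonempty by auto
    have "y + (\<delta> / norm x) *\<^sub>R x \<in> cball y \<delta>"
      using \<delta>(1) \<open>x \<noteq> 0\<close> by (simp add: dist_norm)
    hence "x \<bullet> (y + (\<delta> / norm x) *\<^sub>R x) < \<delta> * norm x + x \<bullet> y" using \<delta>(2) hull by blast
    thus False using \<open>x \<noteq> 0\<close> by (simp add: inner_add_right dot_square_norm power2_eq_square)
  qed
  have grow: "m * (2 * (\<delta> * norm x)) \<le> G x" for x
  proof -
    obtain a where a: "a \<in> A" "\<delta> * norm x \<le> (a - y) \<bullet> x" using far by blast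
    have "m * (2 * (\<delta> * norm x)) \<le> m * (2 * ((a - y) \<bullet> x))" using a m by simp
    also have "\<dots> \<le> m * exp (2 * ((a - y) \<bullet> x))"
      using m exp_ge_add_one_self[of "2 * ((a - y) \<bullet> x)"] by (intro mult_left_mono) linarith+
    also have "\<dots> \<le> (\<alpha> a)\<^sup>2 * exp (2 * ((a - y) \<bullet> x))" using m_le[OF a(1)] by (intro mult_right_mono) auto
    also have "\<dots> \<le> G x" unfolding G_def by (rule member_le_sum) (use a finite_A in auto)
    finally show ?thesis .
  qed
  \<comment> \<open>At norm \<open>R\<close> the linear lower bound \<open>grow\<close> equals
    \<open>G 0 + 1\<close>, so a minimiser over this ball is a global one.\<close>
  define R where "R = (G 0 + 1) / (2 * m * \<delta>)"
  have R: "R > 0" using G_nonneg[of 0] m \<delta>(1) by (simp add: R_def)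
  have "continuous_on (cball 0 R) G" unfolding G_def by (intro continuous_intros)
  then obtain x where x: "x \<in> cball 0 R" "\<And>z. z \<in> cball 0 R \<Longrightarrow> G x \<le> G z"
    using continuous_attains_inf[of "cball 0 R" G] R by auto
  have min: "G x \<le> G z" for z
  proof (cases "norm z \<le> R")
    case False
    have "G x \<le> G 0" using x(2)[of 0] R by simp
    also have "\<dots> \<le> m * (2 * (\<delta> * R))" using m \<delta>(1) by (simp add: R_def)
    also have "\<dots> \<le> m * (2 * (\<delta> * norm z))" using False m \<delta>(1) by simp
    also have "\<dots> \<le> G z" by (rule grow)
    finally show ?thesis .
  qed (use x in auto)
  define D where "D v = (\<Sum>a\<in>A. (\<alpha> a)\<^sup>2 * (exp (2 * ((a - y) \<bullet> x)) * (2 * ((a - y) \<bullet> v))))" for v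
  have "(G has_derivative D) (at x)"
    unfolding G_def D_def by (auto intro!: derivative_eq_intros simp: mult_ac)
  hence D0: "D = (\<lambda>v. 0)"
    by (intro differential_zero_maxmin[of x UNIV G]) (use min in auto)
  have "moment_map x - y = 0"
  proof -
    have e: "exp (2 * ((a - y) \<bullet> x)) = (exp (a \<bullet> x))\<^sup>2 * exp (- 2 * (y \<bullet> x))" for a
      by (simp add: power2_eq_square inner_diff_left flip: exp_add)
    \<comment> \<open>The derivative is a positive multiple of the inner product with
      \<open>moment_map x - y\<close>; a critical point is therefore a preimage of
      \<open>y\<close>.\<close>
    have "D v = 2 * exp (- 2 * (y \<bullet> x)) * total x * ((moment_map x - y) \<bullet> v)" for v
    proof -
      have "(moment_map x - y) \<bullet> v = (\<Sum>a\<in>A. prob_weight x a * ((a - y) \<bullet> v))"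
        using sum_prob_weight[of x]
        by (simp add: moment_map_def inner_diff_left inner_sum_left right_diff_distrib sum_subtractf flip: sum_distrib_right)
      hence "total x * ((moment_map x - y) \<bullet> v) = (\<Sum>a\<in>A. weight x a * ((a - y) \<bullet> v))"
        using total_pos[of x] by (simp add: prob_weight_def sum_distrib_left)
      moreover have "D v = 2 * exp (- 2 * (y \<bullet> x)) * (\<Sum>a\<in>A. weight x a * ((a - y) \<bullet> v))"
        unfolding D_def e weight_def by (simp add: sum_distrib_left power_mult_distrib mult_ac)
      ultimately show ?thesis by (simp add: mult.assoc)
    qed
    hence "(moment_map x - y) \<bullet> v = 0" for v
      using fun_cong[OF D0, of v] total_pos[of x] by simp
    thus ?thesis by (metis inner_eq_zero_iff)
  qed
  thus "y \<in> range moment_map" by auto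
qed

text \<open>Covering the interior of the hull suffices because the frontier of a convex set is
  negligible. The power of 2 is the contribution of the factor 2 in the derivative to the
  determinant.\<close>

lemma volume_le_nn_integral_covariance:
  "ennreal (measure lebesgue (convex hull A) / 2 ^ CARD('n)) \<le> (\<integral>\<^sup>+x. ennreal \<bar>det (covariance x)\<bar> \<partial>lborel)"
proof -
  let ?P = "convex hull A"
  have comp: "compact ?P" using finite_A by (simp add: finite_imp_compact_convex_hull)
  have "measure lebesgue ?P = measure lebesgue (interior ?P)"
    using comp by (intro measure_interior[symmetric] compact_imp_bounded negligible_convex_frontier) auto
  hence "ennreal (measure lebesgue ?P) = emeasure lborel (interior ?P)"
    using emeasure_eq_measure2[OF lmeasurable_interior[OF compact_imp_bounded[OF comp]]] by simp
  also have "\<dots> \<le> emeasure lborel (range moment_map)"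
  proof (rule emeasure_mono[OF interior_subset_range_moment_map])
    show "range moment_map \<in> sets lborel"
      using differentiable_image_open_Int_closed(1)[OF open_UNIV closed_UNIV moment_map_has_derivative]
        continuous_covariance inj_moment_map by (simp add: continuous_intros)
  qed
  also have "\<dots> = (\<integral>\<^sup>+x. ennreal \<bar>det (2 *\<^sub>R covariance x)\<bar> \<partial>lborel)"
    using differentiable_image_open_Int_closed(2)[OF open_UNIV closed_UNIV moment_map_has_derivative]
      continuous_covariance inj_moment_map by (simp add: continuous_intros)
  also have "\<dots> = (\<integral>\<^sup>+x. ennreal (2 ^ CARD('n)) * ennreal \<bar>det (covariance x)\<bar> \<partial>lborel)"
  proof -
    have "det (2 *\<^sub>R B) = 2 ^ CARD('n) * det B" for B :: "real ^ 'n ^ 'n"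
      by (simp add: det_def prod.distrib sum_distrib_left mult_ac)
    thus ?thesis by (simp add: abs_mult ennreal_mult')
  qed
  also have "\<dots> = ennreal (2 ^ CARD('n)) * (\<integral>\<^sup>+x. ennreal \<bar>det (covariance x)\<bar> \<partial>lborel)"
  proof (rule nn_integral_cmult)
    have "(\<lambda>x. det (covariance x)) \<in> borel_measurable borel"
      unfolding det_def by (intro borel_measurable_continuous_onI continuous_intros continuous_covariance)
    thus "(\<lambda>x. ennreal \<bar>det (covariance x)\<bar>) \<in> borel_measurable lborel" by simp
  qed
  finally have "ennreal (1 / 2 ^ CARD('n)) * ennreal (measure lebesgue ?P) \<le>
      ennreal (1 / 2 ^ CARD('n)) * (ennreal (2 ^ CARD('n)) * (\<integral>\<^sup>+x. ennreal \<bar>det (covariance x)\<bar> \<partial>lborel))"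
    by (rule mult_left_mono) simp
  thus ?thesis
    by (simp add: ennreal_mult'[symmetric] mult.assoc[symmetric])
qed

end

section \<open>Zeros of random exponential sums\<close>

context exponential_weights
begin

text \<open>The variance of \<open>a \<bullet> v\<close> is half the mean squared difference of two
  independent copies, and no such difference exceeds the diameter times
  \<open>norm v\<close>.\<close>

lemma covariance_quadratic_le:
  "v \<bullet> (covariance x *v v) \<le> (diameter (convex hull A))\<^sup>2 / 2 * (norm v)\<^sup>2"
proof -
  define p where "p = prob_weight x"
  define t where "t a = (a - moment_map x) \<bullet> v" for a
  define d where "d = diameter (convex hull A)"
  have p1: "(\<Sum>a\<in>A. p a) = 1" and pt: "(\<Sum>a\<in>A. p a * t a) = 0"
    unfolding p_def t_def by (rule sum_prob_weight sum_prob_weight_centered_inner)+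
  have d: "\<bar>t a - t b\<bar> \<le> d * norm v" if "a \<in> A" "b \<in> A" for a b
  proof -
    have "t a - t b = (a - b) \<bullet> v" by (simp add: t_def inner_diff_left)
    hence "\<bar>t a - t b\<bar> \<le> norm (a - b) * norm v" by (simp add: Cauchy_Schwarz_ineq2)
    also have "norm (a - b) \<le> d"
      unfolding d_def dist_norm[symmetric] using that finite_A
      by (intro diameter_bounded_bound) (auto intro: hull_inc compact_imp_bounded finite_imp_compact_convex_hull)
    hence "norm (a - b) * norm v \<le> d * norm v" by (rule mult_right_mono) simp
    finally show ?thesis .
  qed
  have "2 * (\<Sum>a\<in>A. p a * (t a)\<^sup>2) = (\<Sum>a\<in>A. \<Sum>b\<in>A. p a * p b * (t a - t b)\<^sup>2)"
  proof -
    have "(\<Sum>a\<in>A. \<Sum>b\<in>A. p a * p b * (t a - t b)\<^sup>2) =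
        (\<Sum>a\<in>A. p a * (t a)\<^sup>2 * (\<Sum>b\<in>A. p b) + p a * (\<Sum>b\<in>A. p b * (t b)\<^sup>2) - 2 * (p a * t a) * (\<Sum>b\<in>A. p b * t b))"
      unfolding sum_distrib_left sum.distrib[symmetric] sum_subtractf[symmetric]
      by (intro sum.cong refl) (simp add: power2_eq_square algebra_simps)
    also have "\<dots> = 2 * (\<Sum>a\<in>A. p a * (t a)\<^sup>2)"
      by (simp add: p1 pt sum.distrib sum_distrib_right[symmetric])
    finally show ?thesis ..
  qed
  also have "\<dots> \<le> (\<Sum>a\<in>A. \<Sum>b\<in>A. p a * p b * (d * norm v)\<^sup>2)"
  proof (intro sum_mono mult_left_mono)
    fix a b assume ab: "a \<in> A" "b \<in> A"
    show "(t a - t b)\<^sup>2 \<le> (d * norm v)\<^sup>2"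
      using d[OF ab] by (simp add: abs_le_square_iff[symmetric])
    show "0 \<le> p a * p b" unfolding p_def by (intro mult_nonneg_nonneg less_imp_le[OF prob_weight_pos] ab)
  qed
  also have "\<dots> = (d * norm v)\<^sup>2"
    by (simp add: sum_distrib_right[symmetric] sum_distrib_left[symmetric] p1)
  finally show ?thesis
    by (simp add: covariance_quadratic p_def t_def d_def power_mult_distrib)
qed

text \<open>The operator inequality \<open>C^2 \<le> (d^2 / 2) C\<close> for the diameter
  \<open>d\<close>, obtained without a square root of \<open>C\<close>: with \<open>u = C c\<close>,
  Cauchy-Schwarz for the form of \<open>C\<close> bounds the square of
  \<open>u \<bullet> u = u \<bullet> C c\<close> by
  \<open>(c \<bullet> C c) * (u \<bullet> C u)\<close>, and a factor \<open>u \<bullet> u\<close>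
  cancels after the bound on \<open>u \<bullet> C u\<close>.\<close>

lemma norm_covariance_mult_le:
  "norm (covariance x *v c) \<le> diameter (convex hull A) / sqrt 2 * sqrt (c \<bullet> (covariance x *v c))"
proof -
  define u where "u = covariance x *v c"
  define d where "d = diameter (convex hull A)"
  have d: "d \<ge> 0" unfolding d_def
    by (intro diameter_ge_0 compact_imp_bounded finite_imp_compact_convex_hull finite_A)
  define p where "p = prob_weight x"
  have p: "p a \<ge> 0" if "a \<in> A" for a unfolding p_def by (rule less_imp_le[OF prob_weight_pos[OF that]])
  have "(norm u)\<^sup>2 = (\<Sum>a\<in>A. p a * ((a - moment_map x) \<bullet> c) * ((a - moment_map x) \<bullet> u))"
    unfolding dot_square_norm[symmetric] by (subst (1) u_def) (simp add: covariance_mult inner_sum_left p_def)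
  also have "\<dots> = (\<Sum>a\<in>A. (sqrt (p a) * ((a - moment_map x) \<bullet> c)) * (sqrt (p a) * ((a - moment_map x) \<bullet> u)))"
  proof (rule sum.cong)
    fix a assume "a \<in> A"
    hence "sqrt (p a) * sqrt (p a) = p a" using p by simp
    moreover have "(s * y) * (s * z) = (s * s) * y * z" for s y z :: real by (simp add: mult_ac)
    ultimately show "p a * ((a - moment_map x) \<bullet> c) * ((a - moment_map x) \<bullet> u) =
        (sqrt (p a) * ((a - moment_map x) \<bullet> c)) * (sqrt (p a) * ((a - moment_map x) \<bullet> u))"
      by (simp only:)
  qed simp
  finally have "((norm u)\<^sup>2)\<^sup>2 \<le> (\<Sum>a\<in>A. (sqrt (p a) * ((a - moment_map x) \<bullet> c))\<^sup>2) * (\<Sum>a\<in>A. (sqrt (p a) * ((a - moment_map x) \<bullet> u))\<^sup>2)"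
    using Cauchy_Schwarz_ineq_sum[of "\<lambda>a. sqrt (p a) * ((a - moment_map x) \<bullet> c)" "\<lambda>a. sqrt (p a) * ((a - moment_map x) \<bullet> u)" A] by simp
  also have "\<dots> = (c \<bullet> u) * (u \<bullet> (covariance x *v u))"
  proof -
    have "(\<Sum>a\<in>A. (sqrt (p a) * ((a - moment_map x) \<bullet> v))\<^sup>2) = v \<bullet> (covariance x *v v)" for v
      unfolding covariance_quadratic
    proof (rule sum.cong)
      fix a assume "a \<in> A"
      thus "(sqrt (p a) * ((a - moment_map x) \<bullet> v))\<^sup>2 = prob_weight x a * ((a - moment_map x) \<bullet> v)\<^sup>2"
        using p[of a] by (simp add: power_mult_distrib p_def)
    qed simp
    thus ?thesis unfolding u_def by simp
  qed
  also have "\<dots> \<le> (c \<bullet> u) * (d\<^sup>2 / 2 * (norm u)\<^sup>2)"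
  proof (rule mult_left_mono)
    show "u \<bullet> (covariance x *v u) \<le> d\<^sup>2 / 2 * (norm u)\<^sup>2" unfolding d_def by (rule covariance_quadratic_le)
    show "0 \<le> c \<bullet> u" using covariance_pos[of c x] by (cases "c = 0") (auto simp: u_def)
  qed
  finally have le: "(norm u)\<^sup>2 * (norm u)\<^sup>2 \<le> (d\<^sup>2 / 2 * (c \<bullet> u)) * (norm u)\<^sup>2"
    by (simp add: power2_eq_square mult_ac)
  have "(norm u)\<^sup>2 \<le> d\<^sup>2 / 2 * (c \<bullet> u)" if "u \<noteq> 0"
    by (rule mult_right_le_imp_le[OF le]) (use that in simp)
  moreover have "0 \<le> c \<bullet> u" using covariance_pos[of c x] by (cases "c = 0") (auto simp: u_def)
  ultimately have "(norm u)\<^sup>2 \<le> (d / sqrt 2 * sqrt (c \<bullet> u))\<^sup>2"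
  proof (cases "u = 0")
    case False
    with \<open>u \<noteq> 0 \<Longrightarrow> (norm u)\<^sup>2 \<le> d\<^sup>2 / 2 * (c \<bullet> u)\<close> \<open>0 \<le> c \<bullet> u\<close> show ?thesis
      by (simp add: power_mult_distrib power_divide)
  qed simp
  moreover have "0 \<le> d / sqrt 2 * sqrt (c \<bullet> u)" using d \<open>0 \<le> c \<bullet> u\<close> by simp
  ultimately show ?thesis
    unfolding u_def[symmetric] d_def[symmetric] by (rule power2_le_imp_le)
qed

text \<open>Dividing the system by \<open>\<alpha> b * exp (b \<bullet> x)\<close> turns the coefficient of \<open>b\<close> into a constant term.\<close>

definition ratio :: "real ^ 'n \<Rightarrow> real ^ 'n \<Rightarrow> real ^ 'n \<Rightarrow> real" where
  "ratio b x a = \<alpha> a / \<alpha> b * exp ((a - b) \<bullet> x)"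

text \<open>\<open>ratio b x b = 1\<close> accounts for the 1 in \<open>Q\<close>, and
  \<open>a - b\<close> vanishes at \<open>a = b\<close>; hence all sums extend to \<open>A\<close>
  and become \<open>Q\<close> times averages with the probability weights. The left side is
  \<open>Q\<^sup>2\<close> times the variance of \<open>(a - b) \<bullet> c\<close>, which the shift
  by \<open>b\<close> does not affect.\<close>

lemma ratio_gram_det:
  fixes x c :: "real ^ 'n"
  assumes b: "b \<in> A"
  defines "Q \<equiv> 1 + (\<Sum>a\<in>A - {b}. (ratio b x a)\<^sup>2)"
  shows "Q > 0"
    and "(\<Sum>a\<in>A - {b}. (ratio b x a * ((a - b) \<bullet> c))\<^sup>2) * Q - (\<Sum>a\<in>A - {b}. ratio b x a * ((a - b) \<bullet> c) * ratio b x a)\<^sup>2 =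
      Q\<^sup>2 * (c \<bullet> (covariance x *v c))"
proof -
  show Q0: "Q > 0" unfolding Q_def by (intro add_pos_nonneg sum_nonneg) auto
  have rb: "ratio b x b = 1" using \<alpha>_pos[OF b] by (simp add: ratio_def)
  have r: "(ratio b x a)\<^sup>2 = weight x a / weight x b" for a
    by (simp add: ratio_def weight_def power_mult_distrib power_divide inner_diff_left exp_diff)
  have "Q = (\<Sum>a\<in>A. (ratio b x a)\<^sup>2)"
    unfolding Q_def using sum.remove[OF finite_A b, of "\<lambda>a. (ratio b x a)\<^sup>2"] by (simp add: rb)
  hence Q: "Q = total x / weight x b" by (simp add: r total_def sum_divide_distrib)
  have rp: "(ratio b x a)\<^sup>2 = Q * prob_weight x a" for a
    using total_pos[of x] by (simp add: r Q prob_weight_def)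
  have 1: "(\<Sum>a\<in>A - {b}. (ratio b x a * ((a - b) \<bullet> c))\<^sup>2) = Q * (\<Sum>a\<in>A. prob_weight x a * ((a - b) \<bullet> c)\<^sup>2)"
  proof -
    have "(\<Sum>a\<in>A - {b}. (ratio b x a * ((a - b) \<bullet> c))\<^sup>2) = (\<Sum>a\<in>A. (ratio b x a * ((a - b) \<bullet> c))\<^sup>2)"
      using sum.remove[OF finite_A b, of "\<lambda>a. (ratio b x a * ((a - b) \<bullet> c))\<^sup>2"] by simp
    thus ?thesis by (simp add: power_mult_distrib rp sum_distrib_left mult_ac)
  qed
  have 2: "(\<Sum>a\<in>A - {b}. ratio b x a * ((a - b) \<bullet> c) * ratio b x a) = Q * (\<Sum>a\<in>A. prob_weight x a * ((a - b) \<bullet> c))"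
  proof -
    have "(\<Sum>a\<in>A - {b}. ratio b x a * ((a - b) \<bullet> c) * ratio b x a) = (\<Sum>a\<in>A. (ratio b x a)\<^sup>2 * ((a - b) \<bullet> c))"
      using sum.remove[OF finite_A b, of "\<lambda>a. (ratio b x a)\<^sup>2 * ((a - b) \<bullet> c)"] by (simp add: power2_eq_square mult_ac)
    thus ?thesis by (simp add: rp sum_distrib_left mult_ac)
  qed
  define k where "k = (moment_map x - b) \<bullet> c"
  define t where "t a = (a - moment_map x) \<bullet> c" for a
  have abc: "(a - b) \<bullet> c = t a + k" for a by (simp add: t_def k_def inner_diff_left)
  have t0: "(\<Sum>a\<in>A. prob_weight x a * t a) = 0" unfolding t_def by (rule sum_prob_weight_centered_inner)
  have 3: "(\<Sum>a\<in>A. prob_weight x a * (t a + k)) = k"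
    using t0 sum_prob_weight[of x] by (simp add: distrib_left sum.distrib flip: sum_distrib_right)
  have "(\<Sum>a\<in>A. prob_weight x a * (t a + k)\<^sup>2) =
      (\<Sum>a\<in>A. prob_weight x a * (t a)\<^sup>2) + 2 * k * (\<Sum>a\<in>A. prob_weight x a * t a) + k\<^sup>2 * (\<Sum>a\<in>A. prob_weight x a)"
    unfolding sum_distrib_left sum.distrib[symmetric]
    by (intro sum.cong refl) (simp add: power2_eq_square algebra_simps)
  hence 4: "(\<Sum>a\<in>A. prob_weight x a * (t a + k)\<^sup>2) = c \<bullet> (covariance x *v c) + k\<^sup>2"
    unfolding covariance_quadratic t_def[symmetric] by (simp add: t0 sum_prob_weight)
  show "(\<Sum>a\<in>A - {b}. (ratio b x a * ((a - b) \<bullet> c))\<^sup>2) * Q - (\<Sum>a\<in>A - {b}. ratio b x a * ((a - b) \<bullet> c) * ratio b x a)\<^sup>2 =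
      Q\<^sup>2 * (c \<bullet> (covariance x *v c))"
    unfolding 1 2 unfolding abc unfolding 3 4 by (simp add: power2_eq_square algebra_simps)
qed

section \<open>Positivity of volume and diameter\<close>

lemma measure_convex_hull_pos: "measure lebesgue (convex hull A) > 0"
proof -
  have "interior (convex hull A) \<noteq> {}"
  proof
    assume "interior (convex hull A) = {}"
    then obtain v k where v: "v \<noteq> 0" "convex hull A \<subseteq> {x. v \<bullet> x = k}"
      by (rule empty_interior_subset_hyperplane[OF convex_convex_hull])
    have "aff_dim (convex hull A) \<le> aff_dim {x. v \<bullet> x = k}" by (rule aff_dim_subset[OF v(2)])
    thus False using v(1) full_dim by (simp add: aff_dim_hyperplane)
  qed
  hence "\<not> negligible (convex hull A)"
    by (simp add: negligible_convex_interior)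
  moreover have "convex hull A \<in> lmeasurable"
    by (intro lmeasurable_compact finite_imp_compact_convex_hull finite_A)
  ultimately show ?thesis
    by (auto simp: negligible_iff_measure zero_less_measure_iff)
qed

lemma diameter_convex_hull_pos: "diameter (convex hull A) > 0"
proof (rule ccontr)
  assume *: "\<not> diameter (convex hull A) > 0"
  obtain a where a: "a \<in> A" using A_nonempty by blast
  have "bounded (convex hull A)"
    by (intro compact_imp_bounded finite_imp_compact_convex_hull finite_A)
  hence "dist y a \<le> 0" if "y \<in> convex hull A" for y
    using diameter_bounded_bound[of "convex hull A" y a] that * hull_inc[OF a, of convex] by linarith
  hence "convex hull A \<subseteq> {a}" by auto
  hence "aff_dim (convex hull A) \<le> aff_dim {a}" by (rule aff_dim_subset)
  thus False using full_dim by simp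
qed

end

locale random_exponential_sum = exponential_weights A \<alpha> + iid_std_normal M A \<xi>
  for M :: "'w measure" and A :: "(real ^ 'n) set" and \<alpha> :: "real ^ 'n \<Rightarrow> real" and \<xi> :: "real ^ 'n \<Rightarrow> 'w \<Rightarrow> real"
begin

lemma A_not_singleton: "A - {b} \<noteq> {}"
proof
  assume "A - {b} = {}"
  hence "convex hull A \<subseteq> {b}" using hull_mono[of A "{b}" convex] by auto
  hence "aff_dim (convex hull A) \<le> aff_dim {b}" by (rule aff_dim_subset)
  thus False using full_dim by simp
qed

text \<open>For fixed other coefficients, the zeros of the system are the points of the fibre of \<open>fibre_map b \<omega>\<close>
  over the vector of the coefficients of \<open>b\<close>.\<close>

definition fibre_value :: "real ^ 'n \<Rightarrow> real ^ 'n \<Rightarrow> 'w \<Rightarrow> real" where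
  "fibre_value b x \<omega> = (\<Sum>a\<in>A - {b}. \<xi> a \<omega> * - ratio b x a)"

definition fibre_gradient :: "real ^ 'n \<Rightarrow> real ^ 'n \<Rightarrow> 'w \<Rightarrow> real ^ 'n" where
  "fibre_gradient b x \<omega> = (\<Sum>a\<in>A - {b}. (\<xi> a \<omega> * - ratio b x a) *\<^sub>R (a - b))"

definition fibre_map :: "real ^ 'n \<Rightarrow> ('n \<Rightarrow> 'w) \<Rightarrow> real ^ 'n \<Rightarrow> real ^ 'n" where
  "fibre_map b \<omega> x = (\<chi> i. fibre_value b x (\<omega> i))"

lemma fibre_map_has_derivative:
  "(fibre_map b \<omega> has_derivative (*v) (\<chi> i. fibre_gradient b x (\<omega> i))) (at x)"
proof (subst has_derivative_componentwise_within, safe)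
  fix e :: "real ^ 'n" assume "e \<in> Basis"
  then obtain i where e: "e = axis i 1" by (auto simp: Basis_vec_def)
  have r: "((\<lambda>x. ratio b x a) has_derivative (\<lambda>v. ratio b x a * ((a - b) \<bullet> v))) (at x)" for a
  proof -
    have "((\<lambda>x. exp ((a - b) \<bullet> x)) has_derivative (\<lambda>v. exp ((a - b) \<bullet> x) * ((a - b) \<bullet> v))) (at x)"
      by (auto intro!: derivative_eq_intros)
    from has_derivative_mult_right[OF this, of "\<alpha> a / \<alpha> b"] show ?thesis
      by (simp add: ratio_def mult.assoc)
  qed
  have "((\<lambda>x. fibre_value b x (\<omega> i)) has_derivative (\<lambda>v. \<Sum>a\<in>A - {b}. \<xi> a (\<omega> i) * - (ratio b x a * ((a - b) \<bullet> v)))) (at x)"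
    unfolding fibre_value_def by (intro has_derivative_sum has_derivative_mult_right has_derivative_minus r)
  moreover have "(\<Sum>a\<in>A - {b}. \<xi> a (\<omega> i) * - (ratio b x a * ((a - b) \<bullet> v))) = ((\<chi> i. fibre_gradient b x (\<omega> i)) *v v) \<bullet> e" for v
  proof -
    have "((\<chi> i. fibre_gradient b x (\<omega> i)) *v v) \<bullet> e = fibre_gradient b x (\<omega> i) \<bullet> v"
      by (simp add: e inner_axis matrix_vector_mul_component)
    thus ?thesis by (simp add: fibre_gradient_def inner_sum_left mult.assoc)
  qed
  ultimately show "((\<lambda>x. fibre_map b \<omega> x \<bullet> e) has_derivative (\<lambda>v. ((\<chi> i. fibre_gradient b x (\<omega> i)) *v v) \<bullet> e)) (at x)"
    by (simp add: e inner_axis fibre_map_def)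
qed

lemma continuous_ratio [continuous_intros]: "continuous_on S (\<lambda>x. ratio b x a)"
  unfolding ratio_def by (intro continuous_intros)

lemma continuous_fibre_gradient: "continuous_on UNIV (\<lambda>x. \<chi> i. fibre_gradient b x (\<omega> i))"
  unfolding fibre_gradient_def by (intro continuous_intros)

text \<open>Each equation is the positive number \<open>\<alpha> b * exp (b \<bullet> x)\<close>
  times \<open>y $ i - fibre_value b x (\<omega> i)\<close>.\<close>

lemma system_zero_iff:
  assumes b: "b \<in> A"
  shows "(\<forall>i. (\<Sum>a\<in>A. (if a = b then y $ i else \<xi> a (\<omega> i)) * \<alpha> a * exp (a \<bullet> x)) = 0) \<longleftrightarrow> fibre_map b \<omega> x = y"
proof -
  have "(\<Sum>a\<in>A. (if a = b then y $ i else \<xi> a (\<omega> i)) * \<alpha> a * exp (a \<bullet> x)) = \<alpha> b * exp (b \<bullet> x) * (y $ i - fibre_value b x (\<omega> i))" for i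
  proof -
    have "(\<Sum>a\<in>A. (if a = b then y $ i else \<xi> a (\<omega> i)) * \<alpha> a * exp (a \<bullet> x)) =
        y $ i * \<alpha> b * exp (b \<bullet> x) + (\<Sum>a\<in>A - {b}. \<xi> a (\<omega> i) * \<alpha> a * exp (a \<bullet> x))"
      by (simp add: sum.remove[OF finite_A b])
    also have "(\<Sum>a\<in>A - {b}. \<xi> a (\<omega> i) * \<alpha> a * exp (a \<bullet> x)) = (\<Sum>a\<in>A - {b}. \<alpha> b * exp (b \<bullet> x) * (\<xi> a (\<omega> i) * ratio b x a))"
    proof (rule sum.cong)
      fix a assume "a \<in> A - {b}"
      have "exp (a \<bullet> x) = exp (b \<bullet> x) * exp ((a - b) \<bullet> x)" by (simp add: inner_diff_left flip: exp_add)
      thus "\<xi> a (\<omega> i) * \<alpha> a * exp (a \<bullet> x) = \<alpha> b * exp (b \<bullet> x) * (\<xi> a (\<omega> i) * ratio b x a)"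
        using \<alpha>_pos[OF b] by (simp add: ratio_def)
    qed simp
    also have "\<dots> = - (\<alpha> b * exp (b \<bullet> x) * fibre_value b x (\<omega> i))"
      by (simp add: fibre_value_def sum_distrib_left sum_negf)
    finally show ?thesis by (simp add: algebra_simps)
  qed
  thus ?thesis
    using \<alpha>_pos[OF b] by (auto simp: fibre_map_def vec_eq_iff)
qed

text \<open>For fixed \<open>\<omega>\<close> the area inequality is applied to
  \<open>fibre_map b \<omega>\<close>, with the normal density of the coefficients of
  \<open>b\<close> as test function. Its right side is then the conditional expectation of the
  number of zeros.\<close>

lemma expected_zeros_ge_density:
  assumes b: "b \<in> A"
  shows "(\<integral>\<^sup>+x. \<integral>\<^sup>+\<omega>. (\<Prod>i\<in>UNIV. ennreal (std_normal_density (fibre_value b x (\<omega> i)))) *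
      ennreal \<bar>det (\<chi> i. fibre_gradient b x (\<omega> i))\<bar> \<partial>Pi\<^sub>M (UNIV :: 'n set) (\<lambda>_. M) \<partial>lborel) \<le>
    expected_zeros M (\<lambda>\<omega> x. \<Sum>a\<in>A. \<xi> a \<omega> * \<alpha> a * exp (a \<bullet> x)) UNIV"
proof -
  let ?M = "Pi\<^sub>M (UNIV :: 'n set) (\<lambda>_. M)"
  interpret MM: prob_space ?M by (intro prob_space_PiM prob_space_axioms)
  interpret F: pair_sigma_finite ?M "lborel :: (real ^ 'n) measure"
    by (intro pair_sigma_finite.intro MM.sigma_finite_measure_axioms sigma_finite_lborel)
  define f where "f \<Xi> x = (\<chi> i. \<Sum>a\<in>A. \<Xi> (i, a) * \<alpha> a * exp (a \<bullet> x))" for \<Xi> :: "'n \<times> (real ^ 'n) \<Rightarrow> real" and x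
  define N where "N \<Xi> = emeasure (count_space UNIV) {x. f \<Xi> x = 0}" for \<Xi>
  have f0: "f \<Xi> x = 0 \<longleftrightarrow> (\<forall>i. (\<Sum>a\<in>A. \<Xi> (i, a) * \<alpha> a * exp (a \<bullet> x)) = 0)" for \<Xi> x
    by (simp add: f_def vec_eq_iff)
  have N: "N \<in> borel_measurable (Pi\<^sub>M (UNIV \<times> A) (\<lambda>_. borel))"
    unfolding N_def[abs_def]
  proof (rule borel_measurable_zero_count)
    show "(\<lambda>\<Xi>. f \<Xi> x) \<in> borel_measurable (Pi\<^sub>M (UNIV \<times> A) (\<lambda>_. borel))" for x
      unfolding f_def
    proof (intro borel_measurable_vec_lambda borel_measurable_sum borel_measurable_times borel_measurable_const)
      fix i a assume "a \<in> A"
      thus "(\<lambda>\<Xi>. \<Xi> (i, a)) \<in> borel_measurable (Pi\<^sub>M (UNIV \<times> A) (\<lambda>_. borel))"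
        by (intro measurable_component_singleton) simp
    qed
    show "continuous_on UNIV (f \<Xi>)" for \<Xi>
      unfolding f_def by (intro continuous_intros)
  qed
  have [measurable]: "(\<lambda>x. ratio b x a) \<in> borel_measurable borel" for a
    by (intro borel_measurable_continuous_onI continuous_ratio)
  have \<xi>m: "(\<lambda>\<omega>. \<xi> a (\<omega> i)) \<in> borel_measurable ?M" if "a \<in> A" for a i
    using random_variable_\<xi>[OF that] by (intro measurable_compose[OF measurable_component_singleton]) auto
  \<comment> \<open>Extension by 0 outside \<open>A\<close> makes the coefficient measurable for
    every index, so that the expanded determinant can be treated without side conditions on
    \<open>a\<close>.\<close>
  define X where "X a = (if a \<in> A then \<xi> a else (\<lambda>_. 0))" for a
  have [measurable]: "(\<lambda>\<omega>. X a (\<omega> i)) \<in> borel_measurable ?M" for a i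
    using \<xi>m[of a i] by (simp add: X_def)
  have v: "fibre_value b x \<omega> = (\<Sum>a\<in>A - {b}. X a \<omega> * - ratio b x a)" for x \<omega>
    unfolding fibre_value_def by (intro sum.cong) (auto simp: X_def)
  have g: "fibre_gradient b x \<omega> $ j = (\<Sum>a\<in>A - {b}. X a \<omega> * - ratio b x a * (a - b) $ j)" for x \<omega> j
    unfolding fibre_gradient_def sum_component by (intro sum.cong) (auto simp: X_def)
  have "(\<integral>\<^sup>+x. \<integral>\<^sup>+\<omega>. (\<Prod>i\<in>UNIV. ennreal (std_normal_density (fibre_value b x (\<omega> i)))) *
      ennreal \<bar>det (\<chi> i. fibre_gradient b x (\<omega> i))\<bar> \<partial>?M \<partial>lborel) =
    (\<integral>\<^sup>+\<omega>. \<integral>\<^sup>+x. (\<Prod>i\<in>UNIV. ennreal (std_normal_density (fibre_value b x (\<omega> i)))) *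
      ennreal \<bar>det (\<chi> i. fibre_gradient b x (\<omega> i))\<bar> \<partial>lborel \<partial>?M)"
    unfolding det_def vec_lambda_beta v g by (intro F.Fubini') measurable
  also have "\<dots> \<le> (\<integral>\<^sup>+\<omega>. \<integral>\<^sup>+y. (\<Prod>i\<in>UNIV. ennreal (std_normal_density (y $ i))) *
      N (\<lambda>p\<in>UNIV \<times> A. if snd p = b then y $ fst p else \<xi> (snd p) (\<omega> (fst p))) \<partial>lborel \<partial>?M)"
  proof (rule nn_integral_mono)
    fix \<omega> :: "'n \<Rightarrow> 'w"
    have "(\<lambda>y :: real ^ 'n. \<Prod>i\<in>UNIV. ennreal (std_normal_density (y $ i))) \<in> borel_measurable borel"
      by measurable
    from nn_integral_area_le[OF fibre_map_has_derivative continuous_fibre_gradient this]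
    have "(\<integral>\<^sup>+x. (\<Prod>i\<in>UNIV. ennreal (std_normal_density (fibre_map b \<omega> x $ i))) * ennreal \<bar>det (\<chi> i. fibre_gradient b x (\<omega> i))\<bar> \<partial>lborel) \<le>
      (\<integral>\<^sup>+y. (\<Prod>i\<in>UNIV. ennreal (std_normal_density (y $ i))) * emeasure (count_space UNIV) {x. fibre_map b \<omega> x = y} \<partial>lborel)" .
    moreover have "{x. f (\<lambda>p\<in>UNIV \<times> A. if snd p = b then y $ fst p else \<xi> (snd p) (\<omega> (fst p))) x = 0} = {x. fibre_map b \<omega> x = y}" for y
      unfolding system_zero_iff[OF b, symmetric] f0 by (simp cong: if_cong)
    ultimately show "(\<integral>\<^sup>+x. (\<Prod>i\<in>UNIV. ennreal (std_normal_density (fibre_value b x (\<omega> i)))) *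
        ennreal \<bar>det (\<chi> i. fibre_gradient b x (\<omega> i))\<bar> \<partial>lborel) \<le>
      (\<integral>\<^sup>+y. (\<Prod>i\<in>UNIV. ennreal (std_normal_density (y $ i))) *
        N (\<lambda>p\<in>UNIV \<times> A. if snd p = b then y $ fst p else \<xi> (snd p) (\<omega> (fst p))) \<partial>lborel)"
      by (simp add: N_def fibre_map_def)
  qed
  also have "\<dots> = (\<integral>\<^sup>+\<omega>. N (\<lambda>p\<in>UNIV \<times> A. \<xi> (snd p) (\<omega> (fst p))) \<partial>?M)"
    by (rule nn_integral_split_coordinate[OF b A_not_singleton N, symmetric])
  also have "\<dots> = expected_zeros M (\<lambda>\<omega> x. \<Sum>a\<in>A. \<xi> a \<omega> * \<alpha> a * exp (a \<bullet> x)) UNIV"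
    unfolding expected_zeros_def N_def f0 by simp
  finally show ?thesis .
qed

lemma density_ge_det_covariance:
  assumes b: "b \<in> A"
  defines "d \<equiv> diameter (convex hull A) / sqrt 2"
  shows "ennreal (std_normal_density 0) ^ CARD('n) * (ennreal (\<bar>det (covariance x)\<bar> / d ^ CARD('n)) * expected_abs_det TYPE('n)) \<le>
    (\<integral>\<^sup>+\<omega>. (\<Prod>i\<in>UNIV. ennreal (std_normal_density (fibre_value b x (\<omega> i)))) *
      ennreal \<bar>det (\<chi> i. fibre_gradient b x (\<omega> i))\<bar> \<partial>Pi\<^sub>M (UNIV :: 'n set) (\<lambda>_. M))"
proof -
  interpret B: iid_std_normal M "A - {b}" \<xi>
    using A_not_singleton by (intro iid_std_normal_subset) auto
  interpret Q: prob_space "std_normal_vec :: ('n \<Rightarrow> real) measure" by (rule prob_space_std_normal_vec)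
  have d: "d > 0" using diameter_convex_hull_pos by (simp add: d_def)
  \<comment> \<open>\<open>norm_covariance_mult_le\<close> bounds the norm of
    \<open>covariance x *v c / d\<close> by the root of the quadratic form at \<open>c\<close>: with
    this scaling it is the row inequality.\<close>
  define L where "L = (1 / d) *\<^sub>R covariance x"
  have tL: "transpose L *v c = (1 / d) *\<^sub>R (covariance x *v c)" for c
  proof -
    have "transpose L = L" using covariance_transpose[of x] by (simp add: L_def transpose_def vec_eq_iff)
    thus ?thesis by (simp add: L_def scaleR_matrix_vector_assoc del: transpose_matrix_vector)
  qed
  have detL: "\<bar>det L\<bar> = \<bar>det (covariance x)\<bar> / d ^ CARD('n)"
    using d by (simp add: L_def det_def prod_dividef sum_divide_distrib[symmetric] abs_divide prod.distrib)
  have vm: "fibre_value b x \<in> borel_measurable M"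
    unfolding fibre_value_def[abs_def] by (intro borel_measurable_sum borel_measurable_times borel_measurable_const random_variable_\<xi>) auto
  have gm: "fibre_gradient b x \<in> borel_measurable M"
    unfolding fibre_gradient_def[abs_def]
    by (intro borel_measurable_sum borel_measurable_scaleR borel_measurable_times borel_measurable_const random_variable_\<xi>) auto
  have row: "(\<integral>\<^sup>+v. ennreal (std_normal_density 0) * ennreal \<bar>(L *v (\<chi> j. v j)) \<bullet> c\<bar> \<partial>std_normal_vec) \<le>
      (\<integral>\<^sup>+\<omega>. ennreal (std_normal_density (fibre_value b x \<omega>)) * ennreal \<bar>fibre_gradient b x \<omega> \<bullet> c\<bar> \<partial>M)" for c
  proof -
    define Q where "Q = 1 + (\<Sum>a\<in>A - {b}. (ratio b x a)\<^sup>2)"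
    note gram = ratio_gram_det[OF b, of x, folded Q_def]
    have "fibre_gradient b x \<omega> \<bullet> c = (\<Sum>a\<in>A - {b}. \<xi> a \<omega> * - (ratio b x a * ((a - b) \<bullet> c)))" for \<omega>
      by (simp add: fibre_gradient_def inner_sum_left mult.assoc)
    hence "(\<integral>\<^sup>+\<omega>. ennreal (std_normal_density (fibre_value b x \<omega>)) * ennreal \<bar>fibre_gradient b x \<omega> \<bullet> c\<bar> \<partial>M) =
        ennreal (sqrt (Q\<^sup>2 * (c \<bullet> (covariance x *v c))) / (pi * Q))"
      using B.nn_integral_abs_sum_density[of "\<lambda>a. - ratio b x a" "\<lambda>a. - (ratio b x a * ((a - b) \<bullet> c))"]
      unfolding fibre_value_def power2_minus minus_mult_minus Q_def[symmetric] gram(2) by simp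
    \<comment> \<open>\<open>Q\<close> cancels, and with it the last trace of the choice of
      \<open>b\<close>.\<close>
    also have "sqrt (Q\<^sup>2 * (c \<bullet> (covariance x *v c))) / (pi * Q) = sqrt (c \<bullet> (covariance x *v c)) / pi"
      using gram(1) by (simp add: real_sqrt_mult)
    finally have 1: "(\<integral>\<^sup>+\<omega>. ennreal (std_normal_density (fibre_value b x \<omega>)) * ennreal \<bar>fibre_gradient b x \<omega> \<bullet> c\<bar> \<partial>M) =
        ennreal (sqrt (c \<bullet> (covariance x *v c)) / pi)" .
    have "norm (transpose L *v c) \<le> sqrt (c \<bullet> (covariance x *v c))"
      unfolding tL using norm_covariance_mult_le[of x c] d by (simp add: d_def[symmetric] divide_le_eq mult.commute)
    thus ?thesis
      unfolding 1 nn_integral_std_normal_vec_linear by (intro ennreal_leI divide_right_mono) auto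
  qed
  have "ennreal (std_normal_density 0) ^ CARD('n) * (ennreal (\<bar>det (covariance x)\<bar> / d ^ CARD('n)) * expected_abs_det TYPE('n)) =
    (\<integral>\<^sup>+\<omega>. (\<Prod>i\<in>(UNIV :: 'n set). ennreal (std_normal_density 0)) * ennreal \<bar>det (\<chi> i. L *v (\<chi> j. \<omega> i j))\<bar>
      \<partial>Pi\<^sub>M (UNIV :: 'n set) (\<lambda>_. std_normal_vec :: ('n \<Rightarrow> real) measure))"
    unfolding detL[symmetric] nn_integral_abs_det_linear_rows[symmetric]
    by (subst nn_integral_cmult[symmetric]) (simp_all add: det_def)
  also have "\<dots> \<le> (\<integral>\<^sup>+\<omega>. (\<Prod>i\<in>UNIV. ennreal (std_normal_density (fibre_value b x (\<omega> i)))) *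
      ennreal \<bar>det (\<chi> i. fibre_gradient b x (\<omega> i))\<bar> \<partial>Pi\<^sub>M (UNIV :: 'n set) (\<lambda>_. M))"
  proof (rule nn_integral_det_weighted_rows_mono[where D = "\<lambda>_ v. L *v (\<chi> j. v j)" and D' = "\<lambda>_. fibre_gradient b x"
        and w = "\<lambda>_ _. ennreal (std_normal_density 0)" and w' = "\<lambda>_ \<omega>. ennreal (std_normal_density (fibre_value b x \<omega>))"
        and h = "\<lambda>t. ennreal \<bar>t\<bar>"])
    show "(\<lambda>v. L *v (\<chi> j. v j)) \<in> borel_measurable (std_normal_vec :: ('n \<Rightarrow> real) measure)"
      using measurable_vec_lambda_std_normal_vec by (rule borel_measurable_matrix_vector)
    have "(\<integral>\<^sup>+\<omega>. ennreal (std_normal_density (fibre_value b x \<omega>)) \<partial>M) \<le> (\<integral>\<^sup>+\<omega>. 1 \<partial>M)"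
      by (intro nn_integral_mono) (simp add: std_normal_density_le_one)
    thus "(\<integral>\<^sup>+\<omega>. ennreal (std_normal_density (fibre_value b x \<omega>)) \<partial>M) \<noteq> \<infinity>"
      by (auto simp: emeasure_space_1 top_unique)
    show "(\<lambda>\<omega>. ennreal (std_normal_density (fibre_value b x \<omega>))) \<in> borel_measurable M"
      using vm by simp
  qed (use row gm in \<open>auto intro!: prob_space_std_normal_vec prob_space_axioms simp: Q.emeasure_space_1\<close>)
  finally show ?thesis .
qed

lemma expected_zeros_ge:
  "ennreal (2 / (real (CARD('n) + 1) * unit_ball_vol (real (CARD('n) + 1))) *
      (measure lebesgue (convex hull A) / 2 ^ CARD('n) / (diameter (convex hull A) / sqrt 2) ^ CARD('n))) \<le>
    expected_zeros M (\<lambda>\<omega> x. \<Sum>a\<in>A. \<xi> a \<omega> * \<alpha> a * exp (a \<bullet> x)) UNIV"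
proof -
  obtain b where b: "b \<in> A" using A_nonempty by blast
  define n where "n = CARD('n)"
  define d where "d = diameter (convex hull A) / sqrt 2"
  have d: "d > 0" using diameter_convex_hull_pos by (simp add: d_def)
  define s where "s = real (n + 1) * unit_ball_vol (real (n + 1))"
  have s: "s > 0" by (simp add: s_def)
  define V where "V = measure lebesgue (convex hull A)"
  have V: "V \<ge> 0" by (simp add: V_def)
  define K where "K = ennreal (std_normal_density 0) ^ n * expected_abs_det TYPE('n)"
  have "1 \<le> K * ennreal (s / 2)"
    using expected_abs_det_ge[where 'n = 'n] unfolding nn_integral_inverse_sqrt_power by (simp only: K_def s_def n_def)
  \<comment> \<open>\<open>K\<close> has not been shown to be finite, so the bound comes from
    multiplying by \<open>2 / s\<close> in the extended numbers.\<close>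
  hence "ennreal (2 / s) * 1 \<le> ennreal (2 / s) * (K * ennreal (s / 2))" by (rule mult_left_mono) simp
  also have "\<dots> = K * (ennreal (2 / s) * ennreal (s / 2))" by (simp add: mult_ac)
  also have "ennreal (2 / s) * ennreal (s / 2) = 1" using s by (simp add: ennreal_mult'[symmetric])
  finally have K: "ennreal (2 / s) \<le> K" by simp
  have "(\<lambda>x. det (covariance x)) \<in> borel_measurable borel"
    unfolding det_def by (intro borel_measurable_continuous_onI continuous_intros continuous_covariance)
  hence cm: "(\<lambda>x. ennreal \<bar>det (covariance x)\<bar>) \<in> borel_measurable lborel" by simp
  have "ennreal (2 / s * (V / 2 ^ n / d ^ n)) = ennreal (2 / s) * (ennreal (1 / d ^ n) * ennreal (V / 2 ^ n))"
    using s V d by (simp add: ennreal_mult'[symmetric])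
  also have "\<dots> \<le> K * (ennreal (1 / d ^ n) * (\<integral>\<^sup>+x. ennreal \<bar>det (covariance x)\<bar> \<partial>lborel))"
    using volume_le_nn_integral_covariance unfolding V_def n_def
    by (intro mult_mono mult_left_mono K) (auto simp: n_def)
  also have "\<dots> = (\<integral>\<^sup>+x. K * (ennreal (1 / d ^ n) * ennreal \<bar>det (covariance x)\<bar>) \<partial>lborel)"
    using cm by (simp add: nn_integral_cmult)
  also have "\<dots> = (\<integral>\<^sup>+x. ennreal (std_normal_density 0) ^ n * (ennreal (\<bar>det (covariance x)\<bar> / d ^ n) * expected_abs_det TYPE('n)) \<partial>lborel)"
    using d by (intro nn_integral_cong) (simp add: K_def mult_ac ennreal_mult'[symmetric])
  also have "\<dots> \<le> (\<integral>\<^sup>+x. \<integral>\<^sup>+\<omega>. (\<Prod>i\<in>UNIV. ennreal (std_normal_density (fibre_value b x (\<omega> i)))) *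
      ennreal \<bar>det (\<chi> i. fibre_gradient b x (\<omega> i))\<bar> \<partial>Pi\<^sub>M (UNIV :: 'n set) (\<lambda>_. M) \<partial>lborel)"
    unfolding n_def d_def by (intro nn_integral_mono density_ge_det_covariance b)
  also have "\<dots> \<le> expected_zeros M (\<lambda>\<omega> x. \<Sum>a\<in>A. \<xi> a \<omega> * \<alpha> a * exp (a \<bullet> x)) UNIV"
    by (rule expected_zeros_ge_density[OF b])
  finally show ?thesis by (simp only: s_def V_def d_def n_def)
qed

end

theorem corollary4p8:
  fixes A :: "(real ^ 'm) set"
    and \<alpha> :: "real ^ 'm \<Rightarrow> real"
    and M :: "'w measure"
    and \<xi> :: "real ^ 'm \<Rightarrow> 'w \<Rightarrow> real"
  assumes "finite A"
    and "aff_dim (convex hull A) = int CARD('m)"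
    and "\<And>a. a \<in> A \<Longrightarrow> \<alpha> a > 0"
    and "prob_space M"
    and "prob_space.indep_vars M (\<lambda>_. borel) \<xi> A"
    and "\<And>a. a \<in> A \<Longrightarrow> distributed M lborel (\<xi> a) std_normal_density"
  shows "expected_zeros M (\<lambda>\<omega> x. \<Sum>a\<in>A. \<xi> a \<omega> * \<alpha> a * exp (a \<bullet> x)) UNIV >
    ennreal (1 / (2 ^ (CARD('m) - 1) * hypersurface_volume (sphere (0 :: real ^ 'm option) 1)) *
      (measure lebesgue (convex hull A) / diameter (convex hull A) ^ CARD('m)))"
proof -
  interpret W: exponential_weights A \<alpha> using assms by unfold_locales
  interpret random_exponential_sum M A \<alpha> \<xi>
    using assms W.A_nonempty
    by (auto intro!: random_exponential_sum.intro iid_std_normal.intro iid_std_normal_axioms.intro W.exponential_weights_axioms)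
  define n where "n = CARD('m)"
  define s where "s = real (n + 1) * unit_ball_vol (real (n + 1))"
  define V where "V = measure lebesgue (convex hull A)"
  define \<delta> where "\<delta> = diameter (convex hull A)"
  have n: "n > 0" by (simp add: n_def)
  have pos: "s > 0" "V > 0" "\<delta> > 0"
    using W.measure_convex_hull_pos W.diameter_convex_hull_pos by (simp_all add: s_def V_def \<delta>_def)
  \<comment> \<open>\<open>'m option\<close> has \<open>n + 1\<close> elements, so this is the unit
    sphere of dimension \<open>n\<close>.\<close>
  have sphere: "hypersurface_volume (sphere (0 :: real ^ 'm option) 1) = s"
    unfolding hypersurface_volume_unit_sphere by (simp add: s_def n_def)
  \<comment> \<open>The truncated subtraction is harmless because \<open>n > 0\<close>. The factor 2
    in \<open>2 / s\<close> lowers the exponent of 2 from \<open>n\<close> to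
    \<open>n - 1\<close>.\<close>
  have two: "(2 :: real) ^ n = 2 * 2 ^ (n - 1)"
    using n by (cases n) auto
  have "1 / (2 ^ (n - 1) * s) * (V / \<delta> ^ n) < 1 / (2 ^ (n - 1) * s) * (V / \<delta> ^ n) * sqrt 2 ^ n"
  proof -
    have "1 < sqrt 2 ^ n" using n by (intro one_less_power) auto
    moreover have "0 < 1 / (2 ^ (n - 1) * s) * (V / \<delta> ^ n)" using pos by simp
    ultimately show ?thesis using mult_strict_left_mono by fastforce
  qed
  also have "\<dots> = 2 / s * (V / 2 ^ n / (\<delta> / sqrt 2) ^ n)"
    using pos unfolding two by (simp add: power_divide)
  finally have "ennreal (1 / (2 ^ (n - 1) * s) * (V / \<delta> ^ n)) < ennreal (2 / s * (V / 2 ^ n / (\<delta> / sqrt 2) ^ n))"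
    using pos by (intro ennreal_lessI) auto
  also have "\<dots> \<le> expected_zeros M (\<lambda>\<omega> x. \<Sum>a\<in>A. \<xi> a \<omega> * \<alpha> a * exp (a \<bullet> x)) UNIV"
    using expected_zeros_ge by (simp only: n_def s_def V_def \<delta>_def)
  finally show ?thesis
    by (simp only: sphere n_def V_def \<delta>_def)
qed

end
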